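(* Suppose that $G$ is a Roelcke precompact subgroup of $S_\infty$. Then every unitary representation of $G$ is a (Hilbert space direct) sum of irreducible representations of the form $\mathrm{Ind}_H^G(\sigma)$, where $H$ is a commensurator and $\sigma$ is an irreducible representation of $H$ that factors through a finite quotient of $H$.
   Context: $S_\infty$ is the group of all permutations of a countably infinite set, with the topology of pointwise convergence (the set being discrete); subgroups carry the subspace topology. A topological group $G$ is Roelcke precompact if for every neighborhood $U$ of the identity there is a finite $F \subseteq G$ with $G = UFU$. Two subgroups are commensurate if their intersection has finite index in both; $\mathrm{Comm}_G(H) = \{g \in G : H \text{ and } gHg^{-1}\text{ are commensurate}\}$. An open subgroup $H \le G$ is called a commensurator if $\mathrm{Comm}_G(H) = H$. Representations are strongly continuous unitary representations on complex Hilbert spaces. If $H$ is an open subgroup of $G$ and $\sigma$ a representation of $H$ on $\mathcal{H}(\sigma)$, the induced representation $\mathrm{Ind}_H^G(\sigma)$ acts on the Hilbert space of all $f\colon G \to \mathcal{H}(\sigma)$ satisfying $f(gh) = \sigma(h^{-1})f(g)$ for all $g \in G$, $h \in H$, and $\|f\|^2 = \sum_{g \in T}\|f(g)\|^2 < \infty$, where $T$ is a complete system of left coset representatives of $H$ in $G$; the action is $(\mathrm{Ind}_H^G(\sigma)(g)f)(x) = f(g^{-1}x)$. *)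

theory Defs
  imports
    "HOL-Analysis.Analysis"
    "HOL-Algebra.Algebra"
    "HOL-Library.Function_Algebras"
begin

section \<open>Groups and topologies\<close>

text \<open>
  A topological group is given by a group \<open>G\<close> and a topology \<open>T\<close> with \<open>topspace T = carrier G\<close>.
  A subgroup \<open>H\<close> becomes the topological group \<open>G\<lparr>carrier := H\<rparr>\<close>, \<open>subtopology T H\<close>.
\<close>

definition perm_group :: "'a set \<Rightarrow> ('a \<Rightarrow> 'a) set \<Rightarrow> ('a \<Rightarrow> 'a) monoid"
  where "perm_group \<Omega> G = (BijGroup \<Omega>)\<lparr>carrier := G\<rparr>"

text \<open>
  \<open>Bij \<Omega>\<close> consists of extensional functions, so it is contained in the
  topological space \<open>\<Pi>\<^sub>E i\<in>\<Omega>. \<Omega>\<close> of the product topology below.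
\<close>

definition perm_topology :: "'a set \<Rightarrow> ('a \<Rightarrow> 'a) set \<Rightarrow> ('a \<Rightarrow> 'a) topology"
  where "perm_topology \<Omega> G = subtopology (product_topology (\<lambda>_. discrete_topology \<Omega>) \<Omega>) G"

definition Roelcke_precompact :: "('g, 'm) monoid_scheme \<Rightarrow> 'g topology \<Rightarrow> bool"
  where "Roelcke_precompact G T \<longleftrightarrow>
    (\<forall>U. U \<subseteq> carrier G \<and> (\<exists>V. openin T V \<and> \<one>\<^bsub>G\<^esub> \<in> V \<and> V \<subseteq> U) \<longrightarrow>
      (\<exists>F. finite F \<and> F \<subseteq> carrier G \<and> carrier G = U <#>\<^bsub>G\<^esub> F <#>\<^bsub>G\<^esub> U))"

definition commensurate :: "('g, 'm) monoid_scheme \<Rightarrow> 'g set \<Rightarrow> 'g set \<Rightarrow> bool"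
  where "commensurate G H K \<longleftrightarrow>
    finite (rcosets\<^bsub>G\<lparr>carrier := H\<rparr>\<^esub> (H \<inter> K)) \<and> finite (rcosets\<^bsub>G\<lparr>carrier := K\<rparr>\<^esub> (H \<inter> K))"

definition Comm :: "('g, 'm) monoid_scheme \<Rightarrow> 'g set \<Rightarrow> 'g set"
  where "Comm G H = {g \<in> carrier G. commensurate G H (g <#\<^bsub>G\<^esub> H #>\<^bsub>G\<^esub> inv\<^bsub>G\<^esub> g)}"

definition is_commensurator :: "('g, 'm) monoid_scheme \<Rightarrow> 'g topology \<Rightarrow> 'g set \<Rightarrow> bool"
  where "is_commensurator G T H \<longleftrightarrow> subgroup H G \<and> openin T H \<and> Comm G H = H"


section \<open>Complex Hilbert spaces\<close>

text \<open>
  A Hilbert space is a linear subspace \<open>hcarrier K\<close> of an ambient complex vector space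
  with a complete inner product on that subspace, linear in the first argument; nothing is
  assumed about \<open>hinner K\<close> outside the subspace. The carrier makes it possible to quantify
  over Hilbert spaces inside a formula.
\<close>

record 'v hilbert =
  hcarrier :: "'v set"
  hscale :: "complex \<Rightarrow> 'v \<Rightarrow> 'v"
  hinner :: "'v \<Rightarrow> 'v \<Rightarrow> complex"

definition hnorm :: "('v, 'm) hilbert_scheme \<Rightarrow> 'v \<Rightarrow> real"
  where "hnorm K x = sqrt (Re (hinner K x x))"

text \<open>The locale \<open>Metric_space\<close> requires nonnegativity and symmetry also outside the carrier.\<close>

definition hdist :: "('v::ab_group_add, 'm) hilbert_scheme \<Rightarrow> 'v \<Rightarrow> 'v \<Rightarrow> real"
  where "hdist K x y = (if x \<in> hcarrier K \<and> y \<in> hcarrier K then hnorm K (x - y) else 0)"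

locale complex_inner_space = vector_space "hscale K"
  for K :: "('v::ab_group_add, 'm) hilbert_scheme" +
  assumes carrier_subspace: "subspace (hcarrier K)"
    and inner_add: "\<lbrakk>x \<in> hcarrier K; y \<in> hcarrier K; z \<in> hcarrier K\<rbrakk>
      \<Longrightarrow> hinner K (x + y) z = hinner K x z + hinner K y z"
    and inner_scale: "\<lbrakk>x \<in> hcarrier K; y \<in> hcarrier K\<rbrakk>
      \<Longrightarrow> hinner K (hscale K c x) y = c * hinner K x y"
    and inner_commute: "\<lbrakk>x \<in> hcarrier K; y \<in> hcarrier K\<rbrakk>
      \<Longrightarrow> hinner K x y = cnj (hinner K y x)"
    and inner_pos: "\<lbrakk>x \<in> hcarrier K; x \<noteq> 0\<rbrakk> \<Longrightarrow> 0 < Re (hinner K x x)"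
begin

lemma carrier_0: "0 \<in> hcarrier K"
  and carrier_add: "\<lbrakk>x \<in> hcarrier K; y \<in> hcarrier K\<rbrakk> \<Longrightarrow> x + y \<in> hcarrier K"
  and carrier_scale: "x \<in> hcarrier K \<Longrightarrow> hscale K c x \<in> hcarrier K"
  and carrier_diff: "\<lbrakk>x \<in> hcarrier K; y \<in> hcarrier K\<rbrakk> \<Longrightarrow> x - y \<in> hcarrier K"
  and carrier_neg: "x \<in> hcarrier K \<Longrightarrow> - x \<in> hcarrier K"
  using carrier_subspace
  by (simp_all add: subspace_0 subspace_add subspace_scale subspace_diff subspace_neg)

lemma inner_zero: "hinner K 0 0 = 0"
  using inner_scale[of 0 0 0] carrier_0 by simp

lemma inner_ge_0: "x \<in> hcarrier K \<Longrightarrow> 0 \<le> Re (hinner K x x)"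
  by (cases "x = 0") (use inner_zero inner_pos in \<open>auto simp: less_imp_le\<close>)

lemma hnorm_ge_0: "x \<in> hcarrier K \<Longrightarrow> 0 \<le> hnorm K x"
  by (simp add: hnorm_def inner_ge_0)

lemma hnorm_eq_0: "x \<in> hcarrier K \<Longrightarrow> hnorm K x = 0 \<longleftrightarrow> x = 0"
  using inner_pos[of x] inner_zero by (cases "x = 0") (auto simp: hnorm_def)

lemma hnorm_sq: "x \<in> hcarrier K \<Longrightarrow> (hnorm K x)\<^sup>2 = Re (hinner K x x)"
  by (simp add: hnorm_def inner_ge_0)

lemma inner_add_right:
  "\<lbrakk>x \<in> hcarrier K; y \<in> hcarrier K; z \<in> hcarrier K\<rbrakk>
    \<Longrightarrow> hinner K x (y + z) = hinner K x y + hinner K x z"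
  using inner_add[of y z x] inner_commute[of x "y + z"] inner_commute[of x y] inner_commute[of x z]
    carrier_add[of y z] by simp

lemma Re_inner_expand:
  assumes "x \<in> hcarrier K" "y \<in> hcarrier K"
  shows "Re (hinner K (x + y) (x + y))
    = Re (hinner K x x) + 2 * Re (hinner K x y) + Re (hinner K y y)"
  using assms inner_commute[of y x] by (simp add: inner_add inner_add_right carrier_add)

lemma inner_scale_right:
  "\<lbrakk>x \<in> hcarrier K; y \<in> hcarrier K\<rbrakk> \<Longrightarrow> hinner K x (hscale K c y) = cnj c * hinner K x y"
  using inner_scale[of y x c] inner_commute[of x "hscale K c y"] inner_commute[of x y]
    carrier_scale[of y c] by simp

lemma Re_inner_le:
  assumes x: "x \<in> hcarrier K" and y: "y \<in> hcarrier K"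
  shows "Re (hinner K x y) \<le> hnorm K x * hnorm K y"
proof -
  let ?a = "hnorm K x" and ?b = "hnorm K y"
  let ?u = "hscale K (of_real ?b) x" and ?v = "hscale K (of_real (- ?a)) y"
  have uv: "?u \<in> hcarrier K" "?v \<in> hcarrier K"
    using x y by (blast intro: carrier_scale)+
  have "0 \<le> Re (hinner K (?u + ?v) (?u + ?v))"
    using uv by (intro inner_ge_0 carrier_add)
  also have "\<dots> = ?b\<^sup>2 * ?a\<^sup>2 - 2 * (?a * ?b) * Re (hinner K x y) + ?a\<^sup>2 * ?b\<^sup>2"
    using x y uv
    by (subst Re_inner_expand)
       (simp_all add: inner_scale inner_scale_right carrier_scale hnorm_sq power2_eq_square algebra_simps
          del: of_real_minus flip: hnorm_sq)
  finally have le: "(?a * ?b) * Re (hinner K x y) \<le> (?a * ?b) * (?a * ?b)"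
    by (simp add: power2_eq_square algebra_simps)
  show ?thesis
  proof (cases "x = 0 \<or> y = 0")
    case True
    then have "Re (hinner K x y) = 0"
      using inner_scale[of x y 0] inner_scale_right[of x y 0] x y by auto
    then show ?thesis using hnorm_ge_0 x y by simp
  next
    case False
    then have "0 < ?a * ?b"
      using hnorm_eq_0 hnorm_ge_0 x y by (simp add: less_le)
    then show ?thesis using le by (simp add: mult_le_cancel_left_pos)
  qed
qed

lemma hnorm_triangle:
  assumes x: "x \<in> hcarrier K" and y: "y \<in> hcarrier K"
  shows "hnorm K (x + y) \<le> hnorm K x + hnorm K y"
proof (rule power2_le_imp_le)
  show "(hnorm K (x + y))\<^sup>2 \<le> (hnorm K x + hnorm K y)\<^sup>2"
    using Re_inner_le[OF x y] x y
    by (simp add: hnorm_sq carrier_add Re_inner_expand power2_sum)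
qed (use hnorm_ge_0 x y in simp)

lemma hnorm_minus:
  assumes "x \<in> hcarrier K"
  shows "hnorm K (- x) = hnorm K x"
proof -
  have "- x = hscale K (- 1) x" by simp
  then have "hinner K (- x) (- x) = hinner K x x"
    using assms by (metis inner_scale inner_scale_right carrier_scale complex_cnj_minus complex_cnj_one
        mult_minus1 minus_minus)
  then show ?thesis by (simp add: hnorm_def)
qed

sublocale Metric_space "hcarrier K" "hdist K"
proof
  fix x y show "0 \<le> hdist K x y"
    by (simp add: hdist_def hnorm_ge_0 carrier_diff)
next
  fix x y show "hdist K x y = hdist K y x"
    using hnorm_minus[of "x - y"] by (simp add: hdist_def carrier_diff)
next
  fix x y assume "x \<in> hcarrier K" "y \<in> hcarrier K"
  then show "hdist K x y = 0 \<longleftrightarrow> x = y"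
    by (simp add: hdist_def hnorm_eq_0 carrier_diff)
next
  fix x y z assume "x \<in> hcarrier K" "y \<in> hcarrier K" "z \<in> hcarrier K"
  then show "hdist K x z \<le> hdist K x y + hdist K y z"
    using hnorm_triangle[of "x - y" "y - z"] by (simp add: hdist_def carrier_diff)
qed

end

locale complex_hilbert_space = complex_inner_space K
  for K :: "('v::ab_group_add, 'm) hilbert_scheme" +
  assumes complete: "mcomplete"

abbreviation htopology :: "('v::ab_group_add, 'm) hilbert_scheme \<Rightarrow> 'v topology"
  where "htopology K \<equiv> Metric_space.mtopology (hcarrier K) (hdist K)"

definition closed_subspace :: "('v::ab_group_add, 'm) hilbert_scheme \<Rightarrow> 'v set \<Rightarrow> bool"
  where "closed_subspace K W \<longleftrightarrow> module.subspace (hscale K) W \<and> closedin (htopology K) W"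

definition hilbert_direct_sum :: "('v::ab_group_add, 'm) hilbert_scheme \<Rightarrow> 'v set set \<Rightarrow> bool"
  where "hilbert_direct_sum K \<W> \<longleftrightarrow>
    (\<forall>W\<in>\<W>. closed_subspace K W) \<and>
    (\<forall>W\<in>\<W>. \<forall>W'\<in>\<W>. W \<noteq> W' \<longrightarrow> (\<forall>x\<in>W. \<forall>y\<in>W'. hinner K x y = 0)) \<and>
    htopology K closure_of (module.span (hscale K) (\<Union>\<W>)) = hcarrier K"


section \<open>Unitary representations\<close>

record ('g, 'v) urep = "'v hilbert" +
  act :: "'g \<Rightarrow> 'v \<Rightarrow> 'v"

locale unitary_rep = G: group G + complex_hilbert_space \<pi>
  for G :: "('g, 'm) monoid_scheme" and T :: "'g topology"
    and \<pi> :: "('g, 'v::ab_group_add) urep" +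
  assumes topspace_carrier: "topspace T = carrier G"
    and act_bij: "g \<in> carrier G \<Longrightarrow> bij_betw (act \<pi> g) (hcarrier \<pi>) (hcarrier \<pi>)"
    and act_add: "\<lbrakk>g \<in> carrier G; x \<in> hcarrier \<pi>; y \<in> hcarrier \<pi>\<rbrakk>
      \<Longrightarrow> act \<pi> g (x + y) = act \<pi> g x + act \<pi> g y"
    and act_scale: "\<lbrakk>g \<in> carrier G; x \<in> hcarrier \<pi>\<rbrakk>
      \<Longrightarrow> act \<pi> g (hscale \<pi> c x) = hscale \<pi> c (act \<pi> g x)"
    and act_inner: "\<lbrakk>g \<in> carrier G; x \<in> hcarrier \<pi>; y \<in> hcarrier \<pi>\<rbrakk>
      \<Longrightarrow> hinner \<pi> (act \<pi> g x) (act \<pi> g y) = hinner \<pi> x y"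
    and act_mult: "\<lbrakk>g \<in> carrier G; h \<in> carrier G; x \<in> hcarrier \<pi>\<rbrakk>
      \<Longrightarrow> act \<pi> (g \<otimes>\<^bsub>G\<^esub> h) x = act \<pi> g (act \<pi> h x)"
    and strongly_continuous: "x \<in> hcarrier \<pi> \<Longrightarrow> continuous_map T mtopology (\<lambda>g. act \<pi> g x)"

definition invariant_subspace ::
    "('g, 'm) monoid_scheme \<Rightarrow> ('g, 'v::ab_group_add) urep \<Rightarrow> 'v set \<Rightarrow> bool"
  where "invariant_subspace G \<pi> W \<longleftrightarrow>
    closed_subspace \<pi> W \<and> (\<forall>g\<in>carrier G. \<forall>x\<in>W. act \<pi> g x \<in> W)"

definition irreducible_rep :: "('g, 'm) monoid_scheme \<Rightarrow> ('g, 'v::ab_group_add) urep \<Rightarrow> bool"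
  where "irreducible_rep G \<pi> \<longleftrightarrow>
    hcarrier \<pi> \<noteq> {0} \<and> (\<forall>W. invariant_subspace G \<pi> W \<longrightarrow> W = {0} \<or> W = hcarrier \<pi>)"

text \<open>The subrepresentation on an invariant subspace \<open>W\<close> is \<open>\<pi>\<lparr>hcarrier := W\<rparr>\<close>.\<close>

definition unitarily_equivalent :: "('g, 'm) monoid_scheme
    \<Rightarrow> ('g, 'v::ab_group_add) urep \<Rightarrow> ('g, 'w::ab_group_add) urep \<Rightarrow> bool"
  where "unitarily_equivalent G \<pi> \<rho> \<longleftrightarrow>
    (\<exists>\<Phi>. bij_betw \<Phi> (hcarrier \<pi>) (hcarrier \<rho>) \<and>
      (\<forall>x\<in>hcarrier \<pi>. \<forall>y\<in>hcarrier \<pi>. \<Phi> (x + y) = \<Phi> x + \<Phi> y) \<and>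
      (\<forall>c. \<forall>x\<in>hcarrier \<pi>. \<Phi> (hscale \<pi> c x) = hscale \<rho> c (\<Phi> x)) \<and>
      (\<forall>x\<in>hcarrier \<pi>. \<forall>y\<in>hcarrier \<pi>. hinner \<rho> (\<Phi> x) (\<Phi> y) = hinner \<pi> x y) \<and>
      (\<forall>g\<in>carrier G. \<forall>x\<in>hcarrier \<pi>. \<Phi> (act \<pi> g x) = act \<rho> g (\<Phi> x)))"

text \<open>Applied with a subgroup in place of \<open>G\<close>, i.e. to \<open>G\<lparr>carrier := H\<rparr>\<close>.\<close>

definition factors_through_finite_quotient ::
    "('g, 'm) monoid_scheme \<Rightarrow> ('g, 'v) urep \<Rightarrow> bool"
  where "factors_through_finite_quotient G \<sigma> \<longleftrightarrow>
    (\<exists>N \<rho>. N \<lhd> G \<and> finite (carrier (G Mod N)) \<and>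
      (\<forall>g\<in>carrier G. \<forall>x\<in>hcarrier \<sigma>. act \<sigma> g x = \<rho> (N #>\<^bsub>G\<^esub> g) x))"


section \<open>Induced representations\<close>

definition left_transversal :: "('g, 'm) monoid_scheme \<Rightarrow> 'g set \<Rightarrow> 'g set \<Rightarrow> bool"
  where "left_transversal G H S \<longleftrightarrow>
    S \<subseteq> carrier G \<and> (\<forall>g\<in>carrier G. \<exists>!t. t \<in> S \<and> g \<in> t <#\<^bsub>G\<^esub> H)"

text \<open>
  The induced representation, with the norm computed along the transversal \<open>S\<close>.
  Functions on \<open>G\<close> are represented by functions vanishing outside \<open>carrier G\<close>;
  addition of functions is pointwise.
\<close>

definition Ind_along :: "'g set \<Rightarrow> ('g, 'm) monoid_scheme \<Rightarrow> 'g set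
    \<Rightarrow> ('g, 'v::ab_group_add) urep \<Rightarrow> ('g, 'g \<Rightarrow> 'v) urep"
  where "Ind_along S G H \<sigma> = \<lparr>
    hcarrier = {f.
      (\<forall>g. g \<notin> carrier G \<longrightarrow> f g = 0) \<and>
      (\<forall>g\<in>carrier G. f g \<in> hcarrier \<sigma>) \<and>
      (\<forall>g\<in>carrier G. \<forall>h\<in>H. f (g \<otimes>\<^bsub>G\<^esub> h) = act \<sigma> (inv\<^bsub>G\<^esub> h) (f g)) \<and>
      (\<lambda>g. (hnorm \<sigma> (f g))\<^sup>2) summable_on S},
    hscale = (\<lambda>c f g. hscale \<sigma> c (f g)),
    hinner = (\<lambda>f f'. \<Sum>\<^sub>\<infinity>g\<in>S. hinner \<sigma> (f g) (f' g)),
    act = (\<lambda>g f x. if x \<in> carrier G then f (inv\<^bsub>G\<^esub> g \<otimes>\<^bsub>G\<^esub> x) else 0)\<rparr>"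

definition Ind :: "('g, 'm) monoid_scheme \<Rightarrow> 'g set
    \<Rightarrow> ('g, 'v::ab_group_add) urep \<Rightarrow> ('g, 'g \<Rightarrow> 'v) urep"
  where "Ind G H \<sigma> = Ind_along (SOME S. left_transversal G H S) G H \<sigma>"

text \<open>\<open>Ind\<close> does not depend on the transversal that is chosen.\<close>

lemma left_transversal_exists:
  assumes "group G" "subgroup H G"
  shows "\<exists>S. left_transversal G H S"
proof -
  interpret group G by fact
  define r where "r C = (SOME x. x \<in> C)" for C :: "'a set"
  have rep: "r (g <#\<^bsub>G\<^esub> H) \<in> g <#\<^bsub>G\<^esub> H" if "g \<in> carrier G" for g
    unfolding r_def using lcos_self[OF that assms(2)] by (rule someI)
  let ?S = "(\<lambda>g. r (g <#\<^bsub>G\<^esub> H)) ` carrier G"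
  have sub: "H \<subseteq> carrier G" using assms(2) by (rule subgroup.subset)
  have eq: "r (g <#\<^bsub>G\<^esub> H) <#\<^bsub>G\<^esub> H = g <#\<^bsub>G\<^esub> H" if "g \<in> carrier G" for g
    using l_repr_independence[OF rep[OF that] that assms(2)] by simp
  have inC: "r (g <#\<^bsub>G\<^esub> H) \<in> carrier G" if "g \<in> carrier G" for g
    using rep[OF that] l_coset_subset_G[OF sub that] by blast
  have "left_transversal G H ?S"
    unfolding left_transversal_def
  proof (intro conjI ballI)
    show "?S \<subseteq> carrier G" using inC by blast
  next
    fix g assume g: "g \<in> carrier G"
    show "\<exists>!t. t \<in> ?S \<and> g \<in> t <#\<^bsub>G\<^esub> H"
    proof (rule ex1I)
    show "r (g <#\<^bsub>G\<^esub> H) \<in> ?S \<and> g \<in> r (g <#\<^bsub>G\<^esub> H) <#\<^bsub>G\<^esub> H"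
      using g eq[OF g] lcos_self[OF g assms(2)] by simp
    fix t assume t: "t \<in> ?S \<and> g \<in> t <#\<^bsub>G\<^esub> H"
    then obtain k where k: "k \<in> carrier G" "t = r (k <#\<^bsub>G\<^esub> H)" by blast
    then have "g \<in> k <#\<^bsub>G\<^esub> H" using t eq by simp
    then have "k <#\<^bsub>G\<^esub> H = g <#\<^bsub>G\<^esub> H"
      using l_repr_independence[OF _ k(1) assms(2)] by simp
    then show "t = r (g <#\<^bsub>G\<^esub> H)" using k by simp
    qed
  qed
  then show ?thesis ..
qed

lemma transversal_reindex:
  assumes G: "group G" and H: "subgroup H G"
    and S: "left_transversal G H S" and S': "left_transversal G H S'"
  shows "\<exists>b. bij_betw b S S' \<and> (\<forall>t\<in>S. \<exists>h\<in>H. b t = t \<otimes>\<^bsub>G\<^esub> h)"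
proof -
  interpret group G by fact
  have main: "\<exists>!t. t \<in> R' \<and> s \<in> t <#\<^bsub>G\<^esub> H" if "left_transversal G H R'" "s \<in> carrier G" for R' s
    using that by (auto simp: left_transversal_def)
  have sub: "S \<subseteq> carrier G" "S' \<subseteq> carrier G" using S S' by (auto simp: left_transversal_def)
  define b where "b R s = (THE t. t \<in> R \<and> s \<in> t <#\<^bsub>G\<^esub> H)" for R s
  have b: "b R s \<in> R \<and> s \<in> b R s <#\<^bsub>G\<^esub> H" if "left_transversal G H R" "s \<in> carrier G" for R s
    unfolding b_def using theI'[OF main[OF that]] .
  have sym: "t \<in> s <#\<^bsub>G\<^esub> H" if "s \<in> t <#\<^bsub>G\<^esub> H" "t \<in> carrier G" for s t
    using l_repr_independence[OF that H] lcos_self[OF that(2) H] by simp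
  have invol: "b R (b R' s) = s" if "left_transversal G H R" "left_transversal G H R'" "s \<in> R" for R R' s
  proof -
    have "s \<in> carrier G" using that by (auto simp: left_transversal_def)
    note bb = b[OF that(2) this]
    then have c: "b R' s \<in> carrier G" using that by (auto simp: left_transversal_def)
    have "s \<in> R \<and> b R' s \<in> s <#\<^bsub>G\<^esub> H" using sym bb c that by blast
    then show ?thesis using main[OF that(1) c] b[OF that(1) c] by blast
  qed
  have "bij_betw (b S') S S'"
    by (rule bij_betw_byWitness[where f' = "b S"])
       (use invol S S' b sub in blast)+
  moreover have "\<exists>h\<in>H. b S' t = t \<otimes>\<^bsub>G\<^esub> h" if "t \<in> S" for t
  proof -
    have t: "t \<in> carrier G" using that sub by blast
    have "b S' t \<in> carrier G" using b[OF S' t] sub by blast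
    then have "b S' t \<in> t <#\<^bsub>G\<^esub> H" using sym b[OF S' t] by blast
    then show ?thesis by (auto simp: l_coset_def)
  qed
  ultimately show ?thesis by blast
qed

lemma Ind_along_independent:
  assumes G: "group G" and H: "subgroup H G" and \<sigma>: "unitary_rep (G\<lparr>carrier := H\<rparr>) T \<sigma>"
    and S: "left_transversal G H S" and S': "left_transversal G H S'"
  shows "hcarrier (Ind_along S G H \<sigma>) = hcarrier (Ind_along S' G H \<sigma>)"
    and "\<lbrakk>f \<in> hcarrier (Ind_along S G H \<sigma>); f' \<in> hcarrier (Ind_along S G H \<sigma>)\<rbrakk>
      \<Longrightarrow> hinner (Ind_along S G H \<sigma>) f f' = hinner (Ind_along S' G H \<sigma>) f f'"
proof -
  interpret group G by fact
  interpret \<sigma>: unitary_rep "G\<lparr>carrier := H\<rparr>" T \<sigma> by fact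
  obtain b where b: "bij_betw b S S'" "\<And>t. t \<in> S \<Longrightarrow> \<exists>h\<in>H. b t = t \<otimes>\<^bsub>G\<^esub> h"
    using transversal_reindex[OF G H S S'] by blast
  define E where "E f \<longleftrightarrow> (\<forall>g\<in>carrier G. f g \<in> hcarrier \<sigma>) \<and>
      (\<forall>g\<in>carrier G. \<forall>h\<in>H. f (g \<otimes>\<^bsub>G\<^esub> h) = act \<sigma> (inv\<^bsub>G\<^esub> h) (f g))" for f
  have inner: "hinner \<sigma> (f (b t)) (f' (b t)) = hinner \<sigma> (f t) (f' t)"
    if E: "E f" "E f'" and tS: "t \<in> S" for f f' t
  proof -
    obtain h where h: "h \<in> H" "b t = t \<otimes>\<^bsub>G\<^esub> h" using b(2)[OF tS] by blast
    have t: "t \<in> carrier G" using S tS by (auto simp: left_transversal_def)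
    have "inv\<^bsub>G\<^esub> h \<in> H" using h H by (simp add: subgroup.m_inv_closed)
    then show ?thesis using h t E by (simp add: E_def \<sigma>.act_inner)
  qed
  have summ: "(\<lambda>g. (hnorm \<sigma> (f g))\<^sup>2) summable_on S \<longleftrightarrow> (\<lambda>g. (hnorm \<sigma> (f g))\<^sup>2) summable_on S'"
    if "E f" for f
    using summable_on_reindex_bij_betw[OF b(1), of "\<lambda>g. (hnorm \<sigma> (f g))\<^sup>2"] inner[OF that that]
    by (simp add: hnorm_def cong: summable_on_cong)
  show "hcarrier (Ind_along S G H \<sigma>) = hcarrier (Ind_along S' G H \<sigma>)"
    using summ by (auto simp: Ind_along_def E_def)
  assume "f \<in> hcarrier (Ind_along S G H \<sigma>)" "f' \<in> hcarrier (Ind_along S G H \<sigma>)"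
  then have "E f" "E f'" by (auto simp: Ind_along_def E_def)
  then show "hinner (Ind_along S G H \<sigma>) f f' = hinner (Ind_along S' G H \<sigma>) f f'"
    using infsum_reindex_bij_betw[OF b(1), of "\<lambda>g. hinner \<sigma> (f g) (f' g)"] inner
    by (simp add: Ind_along_def cong: infsum_cong)
qed

end

theory Submission
  imports Defs
begin

text \<open>
  Everything rests on vectors with finitely many matrix coefficients. If \<open>V\<close> is an open subgroup,
  then \<open>G\<close> is a finite union of double cosets \<open>V f V\<close>, so for a vector \<open>\<xi>\<close> fixed by \<open>V\<close> the numbers
  \<open>\<langle>g \<xi>, \<xi>\<rangle>\<close> with \<open>g \<in> G\<close> form a finite set. Nonzero fixed vectors exist in every nonzero
  subrepresentation, because the point of least norm in the closed convex hull of a small orbit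
  \<open>V x\<close> is fixed (\<open>exists_open_fixed_vector\<close>). The orbit of such a \<open>\<xi>\<close> has only finitely many mutual
  distances, hence is uniformly discrete, and all coefficients of a weak limit of points of the orbit
  lie in the same finite set. So among the nonzero vectors with coefficients in a fixed finite set
  there is one of least norm.

  Such a minimal \<open>\<xi>\<close>, with stabilizer \<open>V\<close>, has the following property
  (\<open>exists_minimal_vector\<close>): if \<open>\<langle>g \<xi>, \<xi>\<rangle> \<noteq> 0\<close>, then the orbit \<open>V g \<xi>\<close> is finite. Otherwise infinitely many
  of its points have a weak limit \<open>\<eta>\<close> with \<open>\<langle>\<eta>, \<xi>\<rangle> = \<langle>g \<xi>, \<xi>\<rangle> \<noteq> 0\<close>, so \<open>\<eta> \<noteq> 0\<close> and by
  minimality \<open>\<eta>\<close> is as long as \<open>\<xi>\<close>. Then the convergence is in norm, which is impossible in a uniformly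
  discrete orbit. Applied to \<open>g\<close> and to its inverse, this says that \<open>\<langle>g \<xi>, \<xi>\<rangle> \<noteq> 0\<close> only for \<open>g\<close> in the
  commensurator \<open>H\<close> of \<open>V\<close>.

  As there are finitely many double cosets of \<open>V\<close>, the index of \<open>V\<close> in \<open>H\<close> is finite. Therefore \<open>H\<close> is its own
  commensurator, the orbit \<open>H \<xi>\<close> is finite, and \<open>H\<close> acts on the span of \<open>H \<xi>\<close> through a finite quotient. An
  irreducible \<open>H\<close>-subspace \<open>W\<close> of this span has orthogonal translates \<open>g W\<close> along distinct cosets \<open>g H\<close>
  (\<open>exists_commensurator_block\<close>), so the closed span of all translates is the representation
  induced from \<open>W\<close> (\<open>equivalent_Ind\<close>). It is irreducible (\<open>irreducible_envelope\<close>): the projection onto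
  an invariant subspace maps \<open>W\<close> to itself, since a vector fixed by a subgroup of finite index in \<open>H\<close> is
  orthogonal to \<open>g W\<close> as soon as the orbit of the coset \<open>g H\<close> under \<open>H\<close> is infinite, and for \<open>g\<close> outside
  \<open>H\<close> this is the case for \<open>g\<close> or for its inverse. Thus every nonzero subrepresentation contains one
  of the required form, and a maximal orthogonal family of these spans the whole space.
\<close>

section \<open>Complex inner product spaces\<close>

context complex_inner_space
begin

lemmas carrier_simps = carrier_0 carrier_add carrier_scale carrier_diff carrier_neg

lemma inner_zero_left: "x \<in> hcarrier K \<Longrightarrow> hinner K 0 x = 0"
  using inner_scale[of 0 x 0] carrier_0 by simp

lemma inner_zero_right: "x \<in> hcarrier K \<Longrightarrow> hinner K x 0 = 0"
  using inner_scale_right[of x 0 0] carrier_0 by simp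

lemma inner_diff_left:
  "\<lbrakk>x \<in> hcarrier K; y \<in> hcarrier K; z \<in> hcarrier K\<rbrakk>
    \<Longrightarrow> hinner K (x - y) z = hinner K x z - hinner K y z"
  using inner_add[of "x - y" y z] by (simp add: carrier_diff)

lemma inner_diff_right:
  "\<lbrakk>x \<in> hcarrier K; y \<in> hcarrier K; z \<in> hcarrier K\<rbrakk>
    \<Longrightarrow> hinner K x (y - z) = hinner K x y - hinner K x z"
  using inner_add_right[of x "y - z" z] by (simp add: carrier_diff)

lemma carrier_sum: "(\<And>i. i \<in> A \<Longrightarrow> f i \<in> hcarrier K) \<Longrightarrow> sum f A \<in> hcarrier K"
  by (rule subspace_sum[OF carrier_subspace])

lemma inner_sum_left:
  "\<lbrakk>\<And>i. i \<in> A \<Longrightarrow> f i \<in> hcarrier K; y \<in> hcarrier K\<rbrakk>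
    \<Longrightarrow> hinner K (sum f A) y = (\<Sum>i\<in>A. hinner K (f i) y)"
  by (induction A rule: infinite_finite_induct) (simp_all add: inner_zero_left inner_add carrier_sum)

lemma inner_sum_right:
  "\<lbrakk>\<And>i. i \<in> A \<Longrightarrow> f i \<in> hcarrier K; y \<in> hcarrier K\<rbrakk>
    \<Longrightarrow> hinner K y (sum f A) = (\<Sum>i\<in>A. hinner K y (f i))"
  by (induction A rule: infinite_finite_induct)
    (simp_all add: inner_zero_right inner_add_right carrier_sum)

lemma inner_self: "x \<in> hcarrier K \<Longrightarrow> hinner K x x = of_real ((hnorm K x)\<^sup>2)"
  using arg_cong[OF inner_commute[of x x], of Im] by (simp add: hnorm_sq complex_eq_iff)

lemma hnorm_scale: "x \<in> hcarrier K \<Longrightarrow> hnorm K (hscale K c x) = cmod c * hnorm K x"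
proof -
  assume x: "x \<in> hcarrier K"
  have "hinner K (hscale K c x) (hscale K c x) = of_real ((cmod c)\<^sup>2) * hinner K x x"
    using x by (simp add: inner_scale inner_scale_right carrier_scale complex_norm_square
        flip: mult.assoc del: of_real_power)
  then show ?thesis
    by (simp add: hnorm_def real_sqrt_mult del: of_real_power)
qed

lemma hnorm_zero: "hnorm K 0 = 0"
  by (simp add: hnorm_def inner_zero)

lemma Cauchy_Schwarz:
  assumes "x \<in> hcarrier K" "y \<in> hcarrier K"
  shows "cmod (hinner K x y) \<le> hnorm K x * hnorm K y"
proof (cases "hinner K x y = 0")
  case True
  then show ?thesis using assms by (simp add: hnorm_ge_0)
next
  case False
  \<comment> \<open>Rotating \<open>x\<close> by the phase \<open>c\<close> makes the inner product real and nonnegative.\<close>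
  define c where "c = cnj (sgn (hinner K x y))"
  have c: "cmod c = 1" using False by (simp add: c_def norm_sgn)
  have "cnj z * z = of_real (cmod z) * of_real (cmod z)" for z
    by (metis complex_norm_square mult.commute of_real_power power2_eq_square)
  then have "c * hinner K x y = of_real (cmod (hinner K x y))"
    using False by (simp add: c_def sgn_div_norm scaleR_conv_of_real field_simps)
  then have "cmod (hinner K x y) = Re (hinner K (hscale K c x) y)"
    using assms by (simp add: inner_scale)
  also have "\<dots> \<le> hnorm K (hscale K c x) * hnorm K y"
    using assms by (intro Re_inner_le carrier_scale)
  finally show ?thesis using c assms by (simp add: hnorm_scale)
qed

lemma hnorm_sq_add:
  assumes "x \<in> hcarrier K" "y \<in> hcarrier K"
  shows "(hnorm K (x + y))\<^sup>2 = (hnorm K x)\<^sup>2 + (hnorm K y)\<^sup>2 + 2 * Re (hinner K x y)"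
  using assms by (simp add: hnorm_sq carrier_simps Re_inner_expand)

lemma hnorm_sq_diff:
  assumes "x \<in> hcarrier K" "y \<in> hcarrier K"
  shows "(hnorm K (x - y))\<^sup>2 = (hnorm K x)\<^sup>2 + (hnorm K y)\<^sup>2 - 2 * Re (hinner K x y)"
  using assms inner_commute[of y x]
  by (simp add: hnorm_sq carrier_simps inner_diff_left inner_diff_right)

lemma hnorm_diff_commute: "\<lbrakk>x \<in> hcarrier K; y \<in> hcarrier K\<rbrakk> \<Longrightarrow> hnorm K (x - y) = hnorm K (y - x)"
  using hnorm_minus[of "x - y"] by (simp add: carrier_simps)

lemma parallelogram:
  assumes "x \<in> hcarrier K" "y \<in> hcarrier K"
  shows "(hnorm K (x - y))\<^sup>2 =
    2 * (hnorm K x)\<^sup>2 + 2 * (hnorm K y)\<^sup>2 - 4 * (hnorm K (hscale K (1/2) (x + y)))\<^sup>2"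
  using assms
  by (simp add: hnorm_sq_diff hnorm_scale carrier_simps power_mult_distrib hnorm_sq_add power_divide
      inner_scale inner_scale_right field_simps)

lemma polarization:
  assumes "x \<in> hcarrier K" "y \<in> hcarrier K"
  shows "4 * hinner K x y = of_real ((hnorm K (x + y))\<^sup>2) - of_real ((hnorm K (x - y))\<^sup>2)
    + \<i> * of_real ((hnorm K (x + hscale K \<i> y))\<^sup>2) - \<i> * of_real ((hnorm K (x - hscale K \<i> y))\<^sup>2)"
  using assms
  by (simp add: hnorm_sq_diff hnorm_sq_add carrier_simps inner_scale_right complex_eq_iff)

section \<open>Norm convergence and closed subspaces\<close>

definition hlim :: "(nat \<Rightarrow> 'v) \<Rightarrow> 'v \<Rightarrow> bool"
  where "hlim u l \<longleftrightarrow> range u \<subseteq> hcarrier K \<and> l \<in> hcarrier K \<and> (\<lambda>n. hnorm K (u n - l)) \<longlonglongrightarrow> 0"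

lemma hlim_carrier: "hlim u l \<Longrightarrow> u n \<in> hcarrier K" "hlim u l \<Longrightarrow> l \<in> hcarrier K"
  by (auto simp: hlim_def)

lemma hlim_iff_limitin:
  assumes "range u \<subseteq> hcarrier K"
  shows "hlim u l \<longleftrightarrow> limitin mtopology u l sequentially"
  using assms
  by (auto simp: hlim_def limitin_metric tendsto_iff hdist_def image_subset_iff hnorm_ge_0 carrier_simps
      cong: conj_cong)

lemma hlim_const: "x \<in> hcarrier K \<Longrightarrow> hlim (\<lambda>_. x) x"
  by (simp add: hlim_def hnorm_zero)

lemma hlim_squeeze:
  assumes "range u \<subseteq> hcarrier K" "l \<in> hcarrier K" "\<And>n. hnorm K (u n - l) \<le> e n" "e \<longlonglongrightarrow> 0"
  shows "hlim u l"
proof -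
  have "(\<lambda>n. hnorm K (u n - l)) \<longlonglongrightarrow> 0"
  proof (rule tendsto_sandwich[of "\<lambda>_. 0"])
    show "\<forall>\<^sub>F n in sequentially. 0 \<le> hnorm K (u n - l)"
      using assms(1,2) by (intro always_eventually allI hnorm_ge_0 carrier_diff) auto
    show "\<forall>\<^sub>F n in sequentially. hnorm K (u n - l) \<le> e n"
      using assms(3) by (intro always_eventually allI)
  qed (use assms(4) in auto)
  then show ?thesis using assms(1,2) by (simp add: hlim_def)
qed

lemma hlim_inner:
  assumes "hlim u l" "hlim v m"
  shows "(\<lambda>n. hinner K (u n) (v n)) \<longlonglongrightarrow> hinner K l m"
proof -
  note c = hlim_carrier[OF assms(1)] hlim_carrier[OF assms(2)]
  have lim: "(\<lambda>n. hnorm K (u n - l)) \<longlonglongrightarrow> 0" "(\<lambda>n. hnorm K (v n - m)) \<longlonglongrightarrow> 0"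
    using assms by (auto simp: hlim_def)
  have e: "hinner K (u n) (v n) - hinner K l m
    = hinner K (u n - l) (v n - m) + hinner K (u n - l) m + hinner K l (v n - m)" for n
    using c by (simp add: inner_diff_left inner_diff_right carrier_simps)
  have "cmod (hinner K (u n) (v n) - hinner K l m)
    \<le> hnorm K (u n - l) * hnorm K (v n - m) + hnorm K (u n - l) * hnorm K m
      + hnorm K l * hnorm K (v n - m)" for n
    unfolding e using c
    by (intro order.trans[OF norm_triangle_ineq] add_mono Cauchy_Schwarz carrier_simps) auto
  then have "\<forall>\<^sub>F n in sequentially. norm (hinner K (u n) (v n) - hinner K l m) \<le> hnorm K (u n - l) * hnorm K (v n - m) + hnorm K (u n - l) * hnorm K m
      + hnorm K l * hnorm K (v n - m)" by simp
  moreover have "(\<lambda>n. hnorm K (u n - l) * hnorm K (v n - m) + hnorm K (u n - l) * hnorm K m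
      + hnorm K l * hnorm K (v n - m)) \<longlonglongrightarrow> 0 * 0 + 0 * hnorm K m + hnorm K l * 0"
    using lim by (intro tendsto_add tendsto_mult tendsto_const)
  then have "(\<lambda>n. hnorm K (u n - l) * hnorm K (v n - m) + hnorm K (u n - l) * hnorm K m
      + hnorm K l * hnorm K (v n - m)) \<longlonglongrightarrow> 0" by simp
  ultimately have "(\<lambda>n. hinner K (u n) (v n) - hinner K l m) \<longlonglongrightarrow> 0"
    by (rule Lim_null_comparison)
  then show ?thesis by (rule LIM_zero_cancel)
qed

lemma hlim_hnorm:
  assumes "hlim u l"
  shows "(\<lambda>n. hnorm K (u n)) \<longlonglongrightarrow> hnorm K l"
  unfolding hnorm_def by (intro tendsto_intros hlim_inner assms)

lemma hlim_unique: "\<lbrakk>hlim u l; hlim u m\<rbrakk> \<Longrightarrow> l = m"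
  by (metis hlim_def hlim_iff_limitin limitin_metric_unique trivial_limit_sequentially)

lemma hlim_add:
  assumes "hlim u l" "hlim v m" shows "hlim (\<lambda>n. u n + v n) (l + m)"
proof -
  note c = hlim_carrier[OF assms(1)] hlim_carrier[OF assms(2)]
  have "(\<lambda>n. hnorm K (u n - l) + hnorm K (v n - m)) \<longlonglongrightarrow> 0 + 0"
    using assms by (intro tendsto_add) (auto simp: hlim_def)
  moreover have "hnorm K (u n + v n - (l + m)) \<le> hnorm K (u n - l) + hnorm K (v n - m)" for n
    using hnorm_triangle[of "u n - l" "v n - m"] c by (simp add: carrier_simps algebra_simps)
  ultimately show ?thesis
    using c by (intro hlim_squeeze[where e = "\<lambda>n. hnorm K (u n - l) + hnorm K (v n - m)"])
      (auto simp: carrier_simps)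
qed

lemma hlim_scale:
  assumes "hlim u l" shows "hlim (\<lambda>n. hscale K a (u n)) (hscale K a l)"
proof -
  have "(\<lambda>n. cmod a * hnorm K (u n - l)) \<longlonglongrightarrow> cmod a * 0"
    using assms by (intro tendsto_intros) (auto simp: hlim_def)
  moreover have "hnorm K (hscale K a (u n) - hscale K a l) \<le> cmod a * hnorm K (u n - l)" for n
    using assms[THEN hlim_carrier(1)] assms[THEN hlim_carrier(2)]
    by (simp add: carrier_simps hnorm_scale flip: scale_right_diff_distrib)
  ultimately show ?thesis
    using assms[THEN hlim_carrier(1)] assms[THEN hlim_carrier(2)]
    by (intro hlim_squeeze[where e = "\<lambda>n. cmod a * hnorm K (u n - l)"]) (auto simp: carrier_simps)
qed

lemma closure_iff_hlim:
  assumes "S \<subseteq> hcarrier K"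
  shows "x \<in> mtopology closure_of S \<longleftrightarrow> (\<exists>u. range u \<subseteq> S \<and> hlim u x)"
proof -
  have "x \<in> mtopology closure_of S
      \<longleftrightarrow> x \<in> hcarrier K \<and> (\<exists>u. range u \<subseteq> S \<and> limitin mtopology u x sequentially)"
    using assms by (simp add: closure_of_sequentially Int_absorb2)
  moreover have "hlim u x \<longleftrightarrow> limitin mtopology u x sequentially" if "range u \<subseteq> S" for u
    using that assms by (intro hlim_iff_limitin) blast
  moreover have "x \<in> hcarrier K" if "limitin mtopology u x sequentially" for u
    using that by (rule limitin_mspace)
  ultimately show ?thesis by blast
qed

lemma closed_iff_hlim:
  assumes "S \<subseteq> hcarrier K"
  shows "closedin mtopology S \<longleftrightarrow> (\<forall>u l. range u \<subseteq> S \<longrightarrow> hlim u l \<longrightarrow> l \<in> S)"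
proof -
  have "closedin mtopology S \<longleftrightarrow> mtopology closure_of S \<subseteq> S"
    using closure_of_eq[of mtopology S] closure_of_subset[of S mtopology] assms by auto
  then show ?thesis using closure_iff_hlim[OF assms] by blast
qed

lemma closed_subspaceI:
  assumes "subspace W" "W \<subseteq> hcarrier K"
    and "\<And>u l. \<lbrakk>\<And>n. u n \<in> W; hlim u l\<rbrakk> \<Longrightarrow> l \<in> W"
  shows "closed_subspace K W"
  using assms by (auto simp: closed_subspace_def closed_iff_hlim image_subset_iff)

lemma closed_subspaceD:
  assumes "closed_subspace K W"
  shows "subspace W" "W \<subseteq> hcarrier K" "\<And>u l. \<lbrakk>\<And>n. u n \<in> W; hlim u l\<rbrakk> \<Longrightarrow> l \<in> W"
proof -
  show s: "subspace W" "W \<subseteq> hcarrier K"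
    using assms closedin_subset[of mtopology W] by (auto simp: closed_subspace_def)
  show "l \<in> W" if "\<And>n. u n \<in> W" "hlim u l" for u l
    using that assms closed_iff_hlim[OF s(2)] by (auto simp: closed_subspace_def image_subset_iff)
qed

definition cspan :: "'v set \<Rightarrow> 'v set"
  where "cspan S = mtopology closure_of (span S)"

lemma span_carrier: "S \<subseteq> hcarrier K \<Longrightarrow> span S \<subseteq> hcarrier K"
  by (simp add: span_minimal carrier_subspace)

lemma cspan_iff: "S \<subseteq> hcarrier K \<Longrightarrow> x \<in> cspan S \<longleftrightarrow> (\<exists>u. range u \<subseteq> span S \<and> hlim u x)"
  by (simp add: cspan_def closure_iff_hlim span_carrier)

lemma span_subset_cspan: "S \<subseteq> hcarrier K \<Longrightarrow> span S \<subseteq> cspan S"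
  by (simp add: cspan_def closure_of_subset span_carrier)

lemma closed_subspace_cspan:
  assumes S: "S \<subseteq> hcarrier K"
  shows "closed_subspace K (cspan S)"
proof -
  have "subspace (cspan S)"
    unfolding subspace_def
  proof (intro conjI ballI allI)
    show "0 \<in> cspan S" using span_subset_cspan[OF S] span_zero by blast
  next
    fix x y assume "x \<in> cspan S" "y \<in> cspan S"
    then obtain u v where "range u \<subseteq> span S" "hlim u x" "range v \<subseteq> span S" "hlim v y"
      using cspan_iff[OF S] by auto
    then have "range (\<lambda>n. u n + v n) \<subseteq> span S" "hlim (\<lambda>n. u n + v n) (x + y)"
      by (auto simp: image_subset_iff span_add hlim_add)
    then show "x + y \<in> cspan S" using cspan_iff[OF S] by blast
  next
    fix x a assume "x \<in> cspan S"
    then obtain u where "range u \<subseteq> span S" "hlim u x"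
      using cspan_iff[OF S] by auto
    then have "range (\<lambda>n. hscale K a (u n)) \<subseteq> span S" "hlim (\<lambda>n. hscale K a (u n)) (hscale K a x)"
      by (auto simp: image_subset_iff span_scale hlim_scale)
    then show "hscale K a x \<in> cspan S" using cspan_iff[OF S] by blast
  qed
  then show ?thesis
    by (simp add: closed_subspace_def cspan_def)
qed

lemma cspan_minimal:
  assumes "closed_subspace K W" "S \<subseteq> W" shows "cspan S \<subseteq> W"
  unfolding cspan_def
  using assms by (intro closure_of_minimal) (auto simp: closed_subspace_def span_minimal)

lemma closed_subspace_orth:
  assumes "S \<subseteq> hcarrier K"
  shows "closed_subspace K {x \<in> hcarrier K. \<forall>y\<in>S. hinner K x y = 0}"
proof (rule closed_subspaceI)
  show "subspace {x \<in> hcarrier K. \<forall>y\<in>S. hinner K x y = 0}"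
    using assms by (auto simp: subspace_def carrier_simps inner_zero_left inner_add inner_scale)
next
  fix u l assume u: "\<And>n. u n \<in> {x \<in> hcarrier K. \<forall>y\<in>S. hinner K x y = 0}" and l: "hlim u l"
  have "hinner K l y = 0" if "y \<in> S" for y
  proof -
    have "(\<lambda>n. hinner K (u n) y) \<longlonglongrightarrow> hinner K l y"
      using that assms by (intro hlim_inner[OF l hlim_const]) auto
    moreover have "hinner K (u n) y = 0" for n using u[of n] that by auto
    ultimately show ?thesis by (simp add: LIMSEQ_const_iff)
  qed
  then show "l \<in> {x \<in> hcarrier K. \<forall>y\<in>S. hinner K x y = 0}"
    using hlim_carrier(2)[OF l] by auto
qed auto

lemma orth_cspan:
  assumes "S \<subseteq> hcarrier K" "x \<in> hcarrier K" "\<And>y. y \<in> S \<Longrightarrow> hinner K x y = 0" "z \<in> cspan S"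
  shows "hinner K x z = 0" "hinner K z x = 0"
proof -
  have "cspan S \<subseteq> {z \<in> hcarrier K. \<forall>y\<in>{x}. hinner K z y = 0}"
  proof (intro cspan_minimal closed_subspace_orth)
    show "S \<subseteq> {z \<in> hcarrier K. \<forall>y\<in>{x}. hinner K z y = 0}"
    proof
      fix y assume "y \<in> S"
      then show "y \<in> {z \<in> hcarrier K. \<forall>y\<in>{x}. hinner K z y = 0}"
        using assms(1,2) assms(3)[of y] inner_commute[of y x] by auto
    qed
  qed (use assms in auto)
  then show "hinner K z x = 0" "hinner K x z = 0"
    using assms inner_commute[of x z] by auto
qed

lemma eq_0_if_orth_self: "\<lbrakk>x \<in> hcarrier K; hinner K x x = 0\<rbrakk> \<Longrightarrow> x = 0"
  using inner_pos[of x] by auto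

end

section \<open>Midpoint hulls and points of least norm\<close>

context complex_inner_space
begin

text \<open>
  Midpoints take the place of convex combinations: they are all that the parallelogram law
  involves, and properties of the hull follow by a one-step induction.
\<close>

inductive_set midhull :: "'v set \<Rightarrow> 'v set" for A :: "'v set"
  where midhull_base: "x \<in> A \<Longrightarrow> x \<in> midhull A"
  | midhull_mid: "\<lbrakk>x \<in> midhull A; y \<in> midhull A\<rbrakk> \<Longrightarrow> hscale K (1/2) (x + y) \<in> midhull A"

lemma midhull_subset_subspace:
  assumes "subspace W" "A \<subseteq> W" shows "midhull A \<subseteq> W"
proof
  fix x assume "x \<in> midhull A"
  then show "x \<in> W"
    by induction (use assms in \<open>auto intro: subspace_scale subspace_add\<close>)
qed

lemma midhull_mono: "A \<subseteq> B \<Longrightarrow> midhull A \<subseteq> midhull B"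
proof
  fix x assume "A \<subseteq> B" and "x \<in> midhull A"
  from this(2) show "x \<in> midhull B"
    by induction (use \<open>A \<subseteq> B\<close> in \<open>auto intro: midhull.intros\<close>)
qed

lemma midhull_cball:
  assumes "A \<subseteq> hcarrier K" "a \<in> hcarrier K" "\<And>x. x \<in> A \<Longrightarrow> hnorm K (x - a) \<le> r" "x \<in> midhull A"
  shows "hnorm K (x - a) \<le> r"
  using assms(4)
proof induction
  case (midhull_mid x y)
  then have xy: "x \<in> hcarrier K" "y \<in> hcarrier K"
    using midhull_subset_subspace[OF carrier_subspace assms(1)] by auto
  have "hscale K (1/2) (x + y) - a = hscale K (1/2) ((x - a) + (y - a))"
    by (simp add: scale_right_distrib scale_right_diff_distrib algebra_simps flip: scale_left_distrib)
  then have "hnorm K (hscale K (1/2) (x + y) - a) = hnorm K ((x - a) + (y - a)) / 2"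
    using xy assms(2) by (simp add: hnorm_scale carrier_simps)
  also have "\<dots> \<le> (hnorm K (x - a) + hnorm K (y - a)) / 2"
    using xy assms(2) by (intro divide_right_mono hnorm_triangle carrier_simps) auto
  finally show ?case using midhull_mid.IH by simp
qed (use assms in auto)

lemma midhull_inner_ball:
  assumes "A \<subseteq> hcarrier K" "y \<in> hcarrier K" "\<And>x. x \<in> A \<Longrightarrow> cmod (hinner K x y - c) \<le> r" "x \<in> midhull A"
  shows "cmod (hinner K x y - c) \<le> r"
  using assms(4)
proof induction
  case (midhull_mid x z)
  then have xz: "x \<in> hcarrier K" "z \<in> hcarrier K"
    using midhull_subset_subspace[OF carrier_subspace assms(1)] by auto
  have "hinner K (hscale K (1/2) (x + z)) y - c = ((hinner K x y - c) + (hinner K z y - c)) / 2"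
    using xz assms(2) by (simp add: inner_scale inner_add carrier_simps field_simps)
  have "cmod (hinner K (hscale K (1/2) (x + z)) y - c)
      \<le> (cmod (hinner K x y - c) + cmod (hinner K z y - c)) / 2"
    unfolding \<open>_ = _\<close> norm_divide norm_numeral by (intro divide_right_mono norm_triangle_ineq) simp
  then show ?case using midhull_mid.IH by simp
qed (use assms in auto)

text \<open>
  By Bessel's inequality the coefficients of \<open>y\<close> along an orthogonal family of bounded length are square
  summable, so infinitely many equal ones vanish.
\<close>

lemma constant_inner_orthogonal_family:
  assumes u: "\<And>i::nat. u i \<in> hcarrier K" and y: "y \<in> hcarrier K"
    and orth: "\<And>i j. i \<noteq> j \<Longrightarrow> hinner K (u i) (u j) = 0"
    and r: "\<And>i. hnorm K (u i) \<le> r" and c: "\<And>i. hinner K y (u i) = c"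
  shows "c = 0"
proof (rule ccontr)
  assume "c \<noteq> 0"
  have le: "real k * (cmod c)\<^sup>2 \<le> (hnorm K y)\<^sup>2 * r\<^sup>2" if "k > 0" for k
  proof -
    define s where "s = sum u {..<k}"
    have s: "s \<in> hcarrier K" unfolding s_def by (intro carrier_sum u)
    have "hinner K s s = (\<Sum>i<k. \<Sum>j<k. hinner K (u i) (u j))"
      using u by (subst sum.swap) (simp add: s_def inner_sum_left inner_sum_right carrier_sum)
    also have "\<dots> = (\<Sum>i<k. \<Sum>j<k. if i = j then hinner K (u i) (u i) else 0)"
      using orth by (intro sum.cong) auto
    also have "\<dots> = (\<Sum>i<k. of_real ((hnorm K (u i))\<^sup>2))"
      using u by (simp add: inner_self)
    finally have "(hnorm K s)\<^sup>2 = (\<Sum>i<k. (hnorm K (u i))\<^sup>2)"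
      using s by (simp add: hnorm_sq)
    also have "\<dots> \<le> (\<Sum>i<k. r\<^sup>2)"
      using u r by (intro sum_mono power_mono) (auto simp: hnorm_ge_0)
    finally have ns: "(hnorm K s)\<^sup>2 \<le> real k * r\<^sup>2" by simp
    have "hinner K y s = of_nat k * c"
      using u y c by (simp add: s_def inner_sum_right)
    then have "real k * cmod c \<le> hnorm K y * hnorm K s"
      using Cauchy_Schwarz[OF y s] by (simp add: norm_mult)
    then have "(real k * cmod c)\<^sup>2 \<le> (hnorm K y * hnorm K s)\<^sup>2"
      by (intro power_mono) auto
    also have "\<dots> \<le> (hnorm K y)\<^sup>2 * (real k * r\<^sup>2)"
      using ns by (simp add: power_mult_distrib mult_left_mono)
    finally have "real k * (real k * (cmod c)\<^sup>2) \<le> real k * ((hnorm K y)\<^sup>2 * r\<^sup>2)"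
      by (simp add: power_mult_distrib power2_eq_square mult_ac)
    then show ?thesis using \<open>k > 0\<close> by simp
  qed
  obtain k where k: "(hnorm K y)\<^sup>2 * r\<^sup>2 < real k * (cmod c)\<^sup>2"
    using ex_less_of_nat_mult[of "(cmod c)\<^sup>2"] \<open>c \<noteq> 0\<close> by auto
  then have "k > 0" by (cases k) (auto simp: mult_less_0_iff not_less)
  with le[of k] k show False by simp
qed

end

context complex_hilbert_space
begin

lemma Cauchy_hlim:
  assumes u: "range u \<subseteq> hcarrier K"
    and cau: "\<And>e. e > 0 \<Longrightarrow> \<exists>N. \<forall>n\<ge>N. \<forall>m\<ge>n. hnorm K (u m - u n) < e"
  shows "\<exists>l. hlim u l"
proof -
  have c: "u n \<in> hcarrier K" for n using u by auto
  have "MCauchy u"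
    unfolding MCauchy_def
  proof (intro conjI allI impI u)
    fix e :: real assume "e > 0"
    then obtain N where N: "\<forall>n\<ge>N. \<forall>m\<ge>n. hnorm K (u m - u n) < e" using cau by blast
    have "hdist K (u n) (u m) < e" if "n \<ge> N" "m \<ge> N" for n m
    proof (cases "n \<le> m")
      case True
      then have "hnorm K (u m - u n) < e" using N that by blast
      then show ?thesis using c hnorm_diff_commute[of "u n" "u m"] by (simp add: hdist_def)
    next
      case False
      then have "hnorm K (u n - u m) < e" using N that by simp
      then show ?thesis using c by (simp add: hdist_def)
    qed
    then show "\<exists>N. \<forall>n n'. N \<le> n \<longrightarrow> N \<le> n' \<longrightarrow> hdist K (u n) (u n') < e" by blast
  qed
  then show ?thesis using complete hlim_iff_limitin[OF u] by (auto simp: mcomplete_def)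
qed

text \<open>
  The parallelogram law turns every almost norm-minimal choice from decreasing sets into a Cauchy
  sequence. For a constant sequence of sets the limit is a point of least norm of the closure; for
  the hulls of the tails of a sequence it is a weak limit.
\<close>

lemma almost_minimal_limit:
  assumes C: "\<And>n. C n \<subseteq> hcarrier K"
    and mid: "\<And>n x y. \<lbrakk>x \<in> C n; y \<in> C n\<rbrakk> \<Longrightarrow> hscale K (1/2) (x + y) \<in> C n"
    and dec: "\<And>m n. m \<le> n \<Longrightarrow> C n \<subseteq> C m"
    and bdd: "\<And>n. \<exists>x\<in>C n. hnorm K x \<le> R"
  obtains u l where "\<And>n. u n \<in> C n" "hlim u l"
    "\<And>R. (\<And>n. \<exists>x\<in>C n. hnorm K x \<le> R) \<Longrightarrow> hnorm K l \<le> R"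
proof -
  \<comment> \<open>The infima \<open>d n\<close> increase to a limit \<open>D\<close>. Midpoints of \<open>u m\<close> and \<open>u n\<close> for \<open>n \<le> m\<close> lie in \<open>C n\<close>,
    so their norms are at least \<open>d n\<close>.\<close>
  define d where "d n = Inf (hnorm K ` C n)" for n
  have bb: "bdd_below (hnorm K ` C n)" for n
    using C by (intro bdd_belowI[of _ 0]) (auto intro: hnorm_ge_0)
  have ne: "hnorm K ` C n \<noteq> {}" for n using bdd by blast
  have d_le: "d n \<le> hnorm K x" if "x \<in> C n" for n x
    unfolding d_def using that by (intro cInf_lower bb) auto
  have d_R: "d n \<le> R" if "\<And>n. \<exists>x\<in>C n. hnorm K x \<le> R" for R n
    using that[of n] d_le by force
  have d_0: "0 \<le> d n" for n
    unfolding d_def using C by (intro cInf_greatest ne) (auto intro: hnorm_ge_0)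
  have "incseq d"
    unfolding incseq_def d_def using dec by (intro allI impI cInf_superset_mono ne bb) auto
  then obtain D where D: "d \<longlonglongrightarrow> D" "\<And>n. d n \<le> D"
    using incseq_convergent[of d R] d_R[OF bdd] by auto
  have "\<exists>x\<in>C n. hnorm K x < d n + 1 / real (Suc n)" for n
    using cInf_lessD[OF ne, of n "d n + 1 / real (Suc n)"] by (auto simp: d_def)
  then obtain u where u: "\<And>n. u n \<in> C n" "\<And>n. hnorm K (u n) < d n + 1 / real (Suc n)"
    by metis
  have uX: "u n \<in> hcarrier K" for n using u(1) C by auto
  define e where "e n = 4 * ((D + 1 / real (Suc n))\<^sup>2 - (d n)\<^sup>2)" for n
  have e: "(hnorm K (u m - u n))\<^sup>2 \<le> e n" if "m \<ge> n" for m n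
  proof -
    have "hnorm K (u m) \<le> D + 1 / real (Suc n)"
    proof -
      have "1 / real (Suc m) \<le> 1 / real (Suc n)" using that by (simp add: field_simps)
      then show ?thesis using u(2)[of m] D(2)[of m] by linarith
    qed
    moreover have "hnorm K (u n) \<le> D + 1 / real (Suc n)"
      using u(2)[of n] D(2)[of n] by linarith
    ultimately have "(hnorm K (u m))\<^sup>2 \<le> (D + 1 / real (Suc n))\<^sup>2" "(hnorm K (u n))\<^sup>2 \<le> (D + 1 / real (Suc n))\<^sup>2"
      using uX by (auto intro!: power_mono simp: hnorm_ge_0)
    moreover have "(d n)\<^sup>2 \<le> (hnorm K (hscale K (1/2) (u m + u n)))\<^sup>2"
      using u(1) dec[OF that] by (intro power_mono d_le mid d_0) auto
    ultimately show ?thesis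
      using parallelogram[of "u m" "u n"] uX by (simp add: e_def)
  qed
  have lim1: "(\<lambda>n. 1 / real (Suc n)) \<longlonglongrightarrow> 0" by (rule LIMSEQ_Suc[OF lim_1_over_n])
  have "e \<longlonglongrightarrow> 4 * ((D + 0)\<^sup>2 - D\<^sup>2)"
    unfolding e_def by (intro tendsto_intros D lim1)
  then have e0: "e \<longlonglongrightarrow> 0" by simp
  have "\<exists>l. hlim u l"
  proof (rule Cauchy_hlim)
    fix \<epsilon> :: real assume "\<epsilon> > 0"
    then have "\<forall>\<^sub>F n in sequentially. e n < \<epsilon>\<^sup>2"
      using e0 by (intro order_tendstoD(2)[OF e0]) auto
    then obtain N where N: "\<And>n. n \<ge> N \<Longrightarrow> e n < \<epsilon>\<^sup>2" by (auto simp: eventually_sequentially)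
    have "hnorm K (u m - u n) < \<epsilon>" if "n \<ge> N" "m \<ge> n" for m n
      using e[OF that(2)] N[OF that(1)] \<open>\<epsilon> > 0\<close> by (intro power2_less_imp_less[of _ \<epsilon>]) auto
    then show "\<exists>N. \<forall>n\<ge>N. \<forall>m\<ge>n. hnorm K (u m - u n) < \<epsilon>" by blast
  qed (use uX in auto)
  then obtain l where l: "hlim u l" ..
  have "hnorm K l \<le> R" if "\<And>n. \<exists>x\<in>C n. hnorm K x \<le> R" for R
  proof (rule LIMSEQ_le[OF hlim_hnorm[OF l]])
    have "(\<lambda>n. R + 1 / real (Suc n)) \<longlonglongrightarrow> R + 0" by (intro tendsto_intros lim1)
    then show "(\<lambda>n. R + 1 / real (Suc n)) \<longlonglongrightarrow> R" by simp
    show "\<exists>N. \<forall>n\<ge>N. hnorm K (u n) \<le> R + 1 / real (Suc n)"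
      using u(2) d_R[OF that] by (intro exI[of _ 0]) (meson add_right_mono less_imp_le order_trans)
  qed
  then show thesis using that u(1) l by blast
qed

section \<open>Orthogonal projections\<close>

lemma projection_exists:
  assumes W: "closed_subspace K W" and x: "x \<in> hcarrier K"
  shows "\<exists>p\<in>W. \<forall>y\<in>W. hinner K (x - p) y = 0"
proof -
  note W' = closed_subspaceD[OF W]
  define C where "C = {x - w |w. w \<in> W}"
  have C: "C \<subseteq> hcarrier K" using x W'(2) by (auto simp: C_def carrier_simps)
  have mid: "hscale K (1/2) (a + b) \<in> C" if ab: "a \<in> C" "b \<in> C" for a b
  proof -
    obtain v w where vw: "v \<in> W" "w \<in> W" "a = x - v" "b = x - w" using ab by (auto simp: C_def)
    have "hscale K (1/2) (a + b) = x - hscale K (1/2) (v + w)"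
      by (simp add: vw scale_right_distrib scale_right_diff_distrib algebra_simps flip: scale_left_distrib)
    then show ?thesis
      unfolding C_def using W'(1) vw by (auto intro!: exI[of _ "hscale K (1/2) (v + w)"] subspace_scale subspace_add)
  qed
  have xC: "x \<in> C" using subspace_0[OF W'(1)] by (auto simp: C_def intro!: exI[of _ 0])
  obtain u l where u: "\<And>n. u n \<in> C" and l: "hlim u l"
    and min: "\<And>R. (\<exists>a\<in>C. hnorm K a \<le> R) \<Longrightarrow> hnorm K l \<le> R"
    by (rule almost_minimal_limit[of "\<lambda>_. C" "hnorm K x"]) (use C mid xC in auto)
  note lX = hlim_carrier(2)[OF l]
  have "hlim (\<lambda>n. x + hscale K (-1) (u n)) (x + hscale K (-1) l)"
    by (intro hlim_add hlim_const x hlim_scale l)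
  then have "hlim (\<lambda>n. x - u n) (x - l)" by simp
  moreover have "x - u n \<in> W" for n using u[of n] by (auto simp: C_def)
  ultimately have pW: "x - l \<in> W" using W'(3)[of "\<lambda>n. x - u n"] by simp
  have "hinner K l y = 0" if y: "y \<in> W" for y
  proof (rule ccontr)
    define a where "a = hinner K l y"
    \<comment> \<open>Small enough for \<open>l - t a y\<close> to be shorter than \<open>l\<close>; the summand 1 keeps the denominator positive.\<close>
    define t where "t = 1 / ((hnorm K y)\<^sup>2 + 1)"
    assume "hinner K l y \<noteq> 0"
    then have a: "(cmod a)\<^sup>2 > 0" by (simp add: a_def)
    have yX: "y \<in> hcarrier K" using y W'(2) by auto
    let ?cy = "hscale K (of_real t * a) y"
    have "x - (x - l + ?cy) \<in> C"
      unfolding C_def using pW y W'(1) by (blast intro: subspace_add subspace_scale)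
    then have "hnorm K l \<le> hnorm K (l - ?cy)"
      by (intro min bexI[of _ "l - ?cy"]) (simp_all add: algebra_simps)
    then have "(hnorm K l)\<^sup>2 \<le> (hnorm K (l - ?cy))\<^sup>2"
      by (intro power_mono) (use lX in \<open>auto simp: hnorm_ge_0\<close>)
    also have "\<dots> = (hnorm K l)\<^sup>2 + t\<^sup>2 * (cmod a)\<^sup>2 * (hnorm K y)\<^sup>2 - 2 * t * (cmod a)\<^sup>2"
    proof -
      have "hinner K l ?cy = of_real (t * (cmod a)\<^sup>2)"
        using lX yX by (simp add: inner_scale_right a_def[symmetric] complex_norm_square mult_ac del: of_real_power)
      then show ?thesis
        using lX yX by (simp add: hnorm_sq_diff carrier_simps hnorm_scale norm_mult power_mult_distrib)
    qed
    finally have "2 * t * (cmod a)\<^sup>2 \<le> t\<^sup>2 * (hnorm K y)\<^sup>2 * (cmod a)\<^sup>2" by (simp add: mult_ac)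
    then have "(2 * t) * (cmod a)\<^sup>2 \<le> (t * (t * (hnorm K y)\<^sup>2)) * (cmod a)\<^sup>2"
      by (simp add: power2_eq_square mult_ac)
    then have "2 * t \<le> t * (t * (hnorm K y)\<^sup>2)" using a by (rule mult_right_le_imp_le)
    moreover have "t > 0" by (simp add: t_def add_nonneg_pos)
    ultimately have "2 \<le> t * (hnorm K y)\<^sup>2" by (simp add: mult.commute[of 2])
    moreover have "(hnorm K y)\<^sup>2 + 1 > 0" by (simp add: add_nonneg_pos)
    then have "t * (hnorm K y)\<^sup>2 \<le> 1" by (simp add: t_def pos_divide_le_eq)
    ultimately show False by simp
  qed
  then show ?thesis using pW by (intro bexI[of _ "x - l"]) auto
qed

definition proj :: "'v set \<Rightarrow> 'v \<Rightarrow> 'v"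
  where "proj W x = (SOME p. p \<in> W \<and> (\<forall>y\<in>W. hinner K (x - p) y = 0))"

lemma proj:
  assumes "closed_subspace K W" "x \<in> hcarrier K"
  shows proj_in: "proj W x \<in> W"
    and proj_orth: "\<And>y. y \<in> W \<Longrightarrow> hinner K (x - proj W x) y = 0"
    and proj_carrier: "proj W x \<in> hcarrier K"
proof -
  have "\<exists>p. p \<in> W \<and> (\<forall>y\<in>W. hinner K (x - p) y = 0)" using projection_exists[OF assms] by blast
  from someI_ex[OF this] show 1: "proj W x \<in> W" "\<And>y. y \<in> W \<Longrightarrow> hinner K (x - proj W x) y = 0"
    by (auto simp: proj_def)
  then show "proj W x \<in> hcarrier K" using closed_subspaceD(2)[OF assms(1)] by blast
qed

lemma proj_unique:
  assumes W: "closed_subspace K W" and x: "x \<in> hcarrier K"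
    and p: "p \<in> W" "\<And>y. y \<in> W \<Longrightarrow> hinner K (x - p) y = 0"
  shows "proj W x = p"
proof -
  note W' = closed_subspaceD[OF W]
  have pX: "p \<in> hcarrier K" "proj W x \<in> hcarrier K" using p W'(2) proj_carrier[OF W x] by auto
  have d: "p - proj W x \<in> W" using p proj_in[OF W x] W'(1) by (blast intro: subspace_diff)
  have "hinner K (p - proj W x) (p - proj W x)
      = hinner K ((x - proj W x) - (x - p)) (p - proj W x)" by simp
  also have "\<dots> = 0"
    using p(2)[OF d] proj_orth[OF W x d] pX x by (simp add: inner_diff_left carrier_simps del: diff_diff_eq2)
  finally show ?thesis using eq_0_if_orth_self[of "p - proj W x"] pX by (simp add: carrier_simps)
qed

lemma proj_add:
  assumes W: "closed_subspace K W" and x: "x \<in> hcarrier K" and y: "y \<in> hcarrier K"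
  shows "proj W (x + y) = proj W x + proj W y"
proof (rule proj_unique[OF W])
  note W' = closed_subspaceD[OF W]
  show "proj W x + proj W y \<in> W" using W'(1) proj_in[OF W] x y by (blast intro: subspace_add)
  fix z assume z: "z \<in> W"
  have "x + y - (proj W x + proj W y) = (x - proj W x) + (y - proj W y)" by simp
  then show "hinner K (x + y - (proj W x + proj W y)) z = 0"
    using z x y W'(2) proj_orth[OF W] proj_carrier[OF W]
    by (subst \<open>x + y - _ = _\<close>, subst inner_add) (auto simp: carrier_simps)
qed (use x y in \<open>auto simp: carrier_simps\<close>)

lemma proj_scale:
  assumes W: "closed_subspace K W" and x: "x \<in> hcarrier K"
  shows "proj W (hscale K c x) = hscale K c (proj W x)"
proof (rule proj_unique[OF W])
  note W' = closed_subspaceD[OF W]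
  show "hscale K c (proj W x) \<in> W" using W'(1) proj_in[OF W] x by (blast intro: subspace_scale)
  fix z assume z: "z \<in> W"
  then show "hinner K (hscale K c x - hscale K c (proj W x)) z = 0"
    using z x W'(2) proj_orth[OF W x] proj_carrier[OF W x] inner_scale[of "x - proj W x" z c]
    by (auto simp: carrier_simps scale_right_diff_distrib)
qed (use x in \<open>auto simp: carrier_simps\<close>)

lemma proj_inner_left:
  assumes W: "closed_subspace K W" and "x \<in> hcarrier K" "y \<in> W"
  shows "hinner K (proj W x) y = hinner K x y"
  using proj_orth[OF assms] assms proj_carrier[OF W] closed_subspaceD(2)[OF W]
  by (auto simp: inner_diff_left subset_iff)

lemma proj_inner_right:
  assumes W: "closed_subspace K W" and "x \<in> hcarrier K" "y \<in> W"
  shows "hinner K y (proj W x) = hinner K y x"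
  using proj_inner_left[OF assms] inner_commute[of y x] inner_commute[of y "proj W x"]
    assms proj_carrier[OF W] closed_subspaceD(2)[OF W] by auto

lemma proj_selfadjoint:
  assumes "closed_subspace K W" "x \<in> hcarrier K" "y \<in> hcarrier K"
  shows "hinner K (proj W x) y = hinner K x (proj W y)"
  using proj_inner_left[OF assms(1,2), of "proj W y"] proj_inner_right[OF assms(1,3), of "proj W x"]
    proj_in[OF assms(1)] assms by simp

text \<open>
  Adjoining a vector \<open>a\<close> to a closed subspace keeps it closed: the coefficient of \<open>a\<close> is a continuous
  function of the vector, being read off by the inner product with the component of \<open>a\<close> orthogonal to
  the subspace.
\<close>

lemma closed_subspace_span_finite:
  assumes "finite S" "S \<subseteq> hcarrier K"
  shows "closed_subspace K (span S)"
  using assms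
proof (induction S)
  case empty
  show ?case
  proof (rule closed_subspaceI)
    fix u l assume "\<And>n. u n \<in> span {}" and l: "hlim u l"
    then have "u = (\<lambda>_. 0)" by auto
    then show "l \<in> span {}" using hlim_unique[OF l, of 0] hlim_const[OF carrier_0] by simp
  qed (auto simp: carrier_0)
next
  case (insert a S)
  then have W: "closed_subspace K (span S)" and a: "a \<in> hcarrier K" and S: "S \<subseteq> hcarrier K" by auto
  define b where "b = a - proj (span S) a"
  have p: "proj (span S) a \<in> span S" "proj (span S) a \<in> hcarrier K"
    using proj_in[OF W a] proj_carrier[OF W a] by auto
  have b: "b \<in> hcarrier K" using a p by (simp add: b_def carrier_simps)
  have bo: "hinner K b y = 0" "hinner K y b = 0" if "y \<in> span S" for y
    using proj_orth[OF W a that] inner_commute[of y b] b that span_carrier[OF S] by (auto simp: b_def)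
  show ?case
  proof (cases "b = 0")
    case True
    then have "a \<in> span S" using p by (simp add: b_def)
    then show ?thesis using W by (simp add: span_redundant)
  next
    case False
    then have bb: "hinner K b b \<noteq> 0" using b eq_0_if_orth_self by blast
    have ab: "hinner K a b = hinner K b b"
      using bo(2)[OF p(1)] a p b inner_diff_left[of a "proj (span S) a" b] by (simp flip: b_def)
    show ?thesis
    proof (rule closed_subspaceI)
      show "span (insert a S) \<subseteq> hcarrier K" using insert.prems by (rule span_carrier)
      fix u l assume "\<And>n. u n \<in> span (insert a S)" and l: "hlim u l"
      then have "\<forall>n. \<exists>k. u n - hscale K k a \<in> span S" by (simp add: span_insert)
      then obtain k where k: "\<And>n. u n - hscale K (k n) a \<in> span S" by metis
      note uX = hlim_carrier[OF l]
      have "hinner K (u n) b = k n * hinner K b b" for n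
        using bo(2)[OF k[of n]] uX a b ab by (simp add: inner_diff_left carrier_simps inner_scale)
      then have kn: "k n = hinner K (u n) b / hinner K b b" for n using bb by simp
      define k' where "k' = hinner K l b / hinner K b b"
      have klim: "k \<longlonglongrightarrow> k'"
        unfolding kn k'_def using bb by (intro tendsto_intros hlim_inner l hlim_const b)
      have "hlim (\<lambda>n. hscale K (k n) a) (hscale K k' a)"
      proof (rule hlim_squeeze)
        show "hnorm K (hscale K (k n) a - hscale K k' a) \<le> cmod (k n - k') * hnorm K a" for n
          using a by (simp add: hnorm_scale flip: scale_left_diff_distrib)
        have "(\<lambda>n. cmod (k n - k') * hnorm K a) \<longlonglongrightarrow> 0 * hnorm K a"
          using klim by (intro tendsto_intros tendsto_norm_zero) (simp add: LIM_zero)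
        then show "(\<lambda>n. cmod (k n - k') * hnorm K a) \<longlonglongrightarrow> 0" by simp
      qed (use a in \<open>auto simp: carrier_simps\<close>)
      from hlim_add[OF l hlim_scale[OF this, of "-1"]]
      have "hlim (\<lambda>n. u n - hscale K (k n) a) (l - hscale K k' a)" by simp
      then have "l - hscale K k' a \<in> span S"
        using closed_subspaceD(3)[OF W, of "\<lambda>n. u n - hscale K (k n) a"] k by simp
      then show "l \<in> span (insert a S)" by (auto simp: span_insert)
    qed auto
  qed
qed

section \<open>Weak limits\<close>

text \<open>
  A three-epsilon argument based on the common bound \<open>R\<close>. It makes it possible to test weak convergence
  along an orbit against translates of the weak limit itself, which lie outside the orbit.
\<close>

lemma weak_convergence_extends:
  assumes x: "range x \<subseteq> hcarrier K" "\<And>n. hnorm K (x n) \<le> R" and \<eta>: "\<eta> \<in> hcarrier K" "hnorm K \<eta> \<le> R"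
    and A: "A \<subseteq> hcarrier K" "\<And>y. y \<in> A \<Longrightarrow> (\<lambda>n. hinner K (x n) y) \<longlonglongrightarrow> hinner K \<eta> y"
    and u: "\<And>n::nat. u n \<in> midhull A" "hlim u z"
  shows "(\<lambda>n. hinner K (x n) z) \<longlonglongrightarrow> hinner K \<eta> z"
proof -
  have xX: "x n \<in> hcarrier K" for n using x by auto
  have hullX: "y \<in> hcarrier K" if "y \<in> midhull A" for y
    using that midhull_subset_subspace[OF carrier_subspace A(1)] by auto
  have hull: "(\<lambda>n. hinner K (x n) y) \<longlonglongrightarrow> hinner K \<eta> y" if "y \<in> midhull A" for y
    using that
  proof induction
    case (midhull_mid y w)
    then have "y \<in> hcarrier K" "w \<in> hcarrier K" using hullX by auto
    then have e: "hinner K v (hscale K (1/2) (y + w)) = (hinner K v y + hinner K v w) / 2"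
      if "v \<in> hcarrier K" for v
      using that by (simp add: inner_scale_right inner_add_right carrier_simps)
    show ?case
      unfolding e[OF \<eta>(1)] e[OF xX] by (intro tendsto_intros midhull_mid.IH) auto
  qed (use A in auto)
  note zX = hlim_carrier(2)[OF u(2)]
  have R: "0 \<le> R" using hnorm_ge_0[OF \<eta>(1)] \<eta>(2) by simp
  show ?thesis
    unfolding tendsto_iff
  proof (intro allI impI)
    fix e :: real assume "e > 0"
    then have "e / 3 / (R + 1) > 0" using R by simp
    moreover have "(\<lambda>n. hnorm K (u n - z)) \<longlonglongrightarrow> 0" using u(2) by (simp add: hlim_def)
    ultimately have "\<forall>\<^sub>F k in sequentially. hnorm K (u k - z) < e / 3 / (R + 1)"
      by (rule order_tendstoD(2)[rotated])
    then obtain k where k: "hnorm K (u k - z) < e / 3 / (R + 1)"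
      by (auto simp: eventually_sequentially)
    have kX: "u k \<in> hcarrier K" using u hlim_carrier by blast
    have small: "cmod (hinner K v (u k) - hinner K v z) \<le> e / 3"
      if "v \<in> hcarrier K" "hnorm K v \<le> R" for v
    proof -
      have "cmod (hinner K v (u k) - hinner K v z) = cmod (hinner K v (u k - z))"
        using that kX zX by (simp add: inner_diff_right)
      also have "\<dots> \<le> hnorm K v * hnorm K (u k - z)"
        using that kX zX by (intro Cauchy_Schwarz carrier_simps)
      also have "\<dots> \<le> (R + 1) * (e / 3 / (R + 1))"
        using that kX zX k R by (intro mult_mono) (auto simp: hnorm_ge_0 carrier_simps)
      also have "\<dots> = e / 3" using R by (metis add_nonneg_eq_0_iff nonzero_mult_div_cancel_left
          times_divide_eq_right zero_le_one zero_neq_one)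
      finally show ?thesis .
    qed
    have "\<forall>\<^sub>F n in sequentially. dist (hinner K (x n) (u k)) (hinner K \<eta> (u k)) < e / 3"
      using hull[OF u(1)[of k]] \<open>e > 0\<close> by (intro tendstoD) auto
    then show "\<forall>\<^sub>F n in sequentially. dist (hinner K (x n) z) (hinner K \<eta> z) < e"
    proof eventually_elim
      case (elim n)
      have "hinner K (x n) z - hinner K \<eta> z = (hinner K (x n) z - hinner K (x n) (u k))
          + (hinner K (x n) (u k) - hinner K \<eta> (u k)) + (hinner K \<eta> (u k) - hinner K \<eta> z)" by simp
      moreover have "cmod (a + b + c) \<le> cmod a + cmod b + cmod c" for a b c
        by (rule order_trans[OF norm_triangle_ineq add_right_mono[OF norm_triangle_ineq]])
      ultimately have "cmod (hinner K (x n) z - hinner K \<eta> z) \<le> cmod (hinner K (x n) z - hinner K (x n) (u k))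
          + cmod (hinner K (x n) (u k) - hinner K \<eta> (u k)) + cmod (hinner K \<eta> (u k) - hinner K \<eta> z)"
        by metis
      then show ?case
        using small[OF xX x(2), of n] small[OF \<eta>] elim
        by (simp add: dist_norm norm_minus_commute)
    qed
  qed
qed

text \<open>
  Compactness of a countable product of discs yields a subsequence along which the inner products with
  all \<open>y \<in> Y\<close> converge. On the midpoint hull of a late tail these inner products are close to their
  limits, so an almost norm-minimal choice from these hulls converges to a vector with the right
  inner products.
\<close>

lemma weakly_convergent_subsequence:
  assumes x: "range x \<subseteq> hcarrier K" "\<And>n. hnorm K (x n) \<le> R"
    and Y: "countable Y" "Y \<subseteq> hcarrier K"
  obtains r \<eta> u where "strict_mono (r :: nat \<Rightarrow> nat)" "\<And>n::nat. u n \<in> midhull (range x)" "hlim u \<eta>"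
    "hnorm K \<eta> \<le> R" "\<And>y. y \<in> Y \<Longrightarrow> (\<lambda>n. hinner K (x (r n)) y) \<longlonglongrightarrow> hinner K \<eta> y"
proof -
  have xX: "x n \<in> hcarrier K" for n using x by auto
  have "\<exists>r. strict_mono (r :: nat \<Rightarrow> nat) \<and> (\<forall>y\<in>Y. convergent (\<lambda>n. hinner K (x (r n)) y))"
  proof (cases "Y = {}")
    case True
    then show ?thesis by (auto intro!: exI[of _ id] simp: strict_mono_id)
  next
    case False
    define y where "y = from_nat_into Y"
    have y: "range y = Y" using False Y(1) by (simp add: y_def range_from_nat_into)
    then have yX: "y k \<in> hcarrier K" for k using Y(2) by auto
    define f where "f n k = hinner K (x n) (y k)" for n k
    define B where "B = PiE UNIV (\<lambda>k. cball (0::complex) (R * hnorm K (y k)))"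
    have "compactin (product_topology (\<lambda>_::nat. euclidean) UNIV) B"
      unfolding B_def by (simp add: compactin_PiE)
    then have "compact B" by (simp add: euclidean_product_topology)
    then have "seq_compact B" by (rule compact_imp_seq_compact)
    moreover have "f n \<in> B" for n
    proof -
      have "cmod (hinner K (x n) (y k)) \<le> R * hnorm K (y k)" for k
        using Cauchy_Schwarz[OF xX yX] mult_right_mono[OF x(2) hnorm_ge_0[OF yX]]
        by (rule order_trans)
      then show ?thesis by (simp add: B_def f_def PiE_iff)
    qed
    ultimately obtain g r where "strict_mono (r :: nat \<Rightarrow> nat)" "(f \<circ> r) \<longlonglongrightarrow> g"
      unfolding seq_compact_def by metis
    have "(\<lambda>n. f (r n) k) \<longlonglongrightarrow> g k" for k
      using continuous_on_tendsto_compose[OF continuous_on_product_coordinates \<open>(f \<circ> r) \<longlonglongrightarrow> g\<close>, of k]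
      by simp
    then show ?thesis
      using \<open>strict_mono r\<close> y by (auto simp: f_def convergent_def)
  qed
  then obtain r where r: "strict_mono (r :: nat \<Rightarrow> nat)"
      and conv: "\<And>y. y \<in> Y \<Longrightarrow> convergent (\<lambda>n. hinner K (x (r n)) y)" by blast
  define C where "C n = midhull (x ` r ` {n..})" for n
  have "C n \<subseteq> hcarrier K" for n
    unfolding C_def using xX by (intro midhull_subset_subspace[OF carrier_subspace]) auto
  moreover have "C n \<subseteq> C m" if "m \<le> n" for m n
    unfolding C_def using that by (intro midhull_mono) auto
  moreover have "x (r n) \<in> C n" for n unfolding C_def by (intro midhull.intros) auto
  moreover have "\<exists>y\<in>C n. hnorm K y \<le> R" for n
    using x(2) calculation(3) by blast
  ultimately obtain u \<eta> where u: "\<And>n. u n \<in> C n" and \<eta>: "hlim u \<eta>"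
    and min: "\<And>R. (\<And>n. \<exists>x\<in>C n. hnorm K x \<le> R) \<Longrightarrow> hnorm K \<eta> \<le> R"
    by (rule_tac almost_minimal_limit[of C R]) (auto simp: C_def intro: midhull_mid)
  have R: "hnorm K \<eta> \<le> R" using min x(2) \<open>\<And>n. x (r n) \<in> C n\<close> by blast
  have lim: "(\<lambda>n. hinner K (x (r n)) y) \<longlonglongrightarrow> hinner K \<eta> y" if "y \<in> Y" for y
  proof -
    obtain c where c: "(\<lambda>n. hinner K (x (r n)) y) \<longlonglongrightarrow> c" using conv[OF \<open>y \<in> Y\<close>] by (auto simp: convergent_def)
    have yX: "y \<in> hcarrier K" using that Y by auto
    have "(\<lambda>n. hinner K (u n) y) \<longlonglongrightarrow> c"
      unfolding tendsto_iff
    proof (intro allI impI)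
      fix e :: real assume "e > 0"
      then have "\<forall>\<^sub>F n in sequentially. dist (hinner K (x (r n)) y) c < e / 2"
        using c by (intro tendstoD) auto
      then obtain N where N: "\<And>n. n \<ge> N \<Longrightarrow> cmod (hinner K (x (r n)) y - c) < e / 2"
        by (auto simp: eventually_sequentially dist_norm)
      have "cmod (hinner K (u n) y - c) \<le> e / 2" if "n \<ge> N" for n
        using u[of n] unfolding C_def
        by (rule midhull_inner_ball[rotated 3]) (use xX yX N that in \<open>auto intro: less_imp_le\<close>)
      then show "\<forall>\<^sub>F n in sequentially. dist (hinner K (u n) y) c < e"
        using \<open>e > 0\<close> by (force simp: eventually_sequentially dist_norm)
    qed
    then have "hinner K \<eta> y = c"
      using hlim_inner[OF \<eta> hlim_const[OF yX]] by (rule LIMSEQ_unique[symmetric])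
    then show ?thesis using c by simp
  qed
  have "u n \<in> midhull (range x)" for n
    using u[of n] midhull_mono[of "x ` r ` {n..}" "range x"] by (auto simp: C_def)
  then show thesis using that r \<eta> R lim by blast
qed

end

section \<open>Commensurability and commensurators\<close>

context group
begin

abbreviation conjugate :: "'a \<Rightarrow> 'a set \<Rightarrow> 'a set"
  where "conjugate g H \<equiv> g <# H #> inv g"

text \<open>
  For subgroups this says that \<open>H \<inter> K\<close> has finite index in \<open>H\<close>. Counting the left cosets of \<open>K\<close>
  that cover \<open>H\<close> makes transitivity and compatibility with conjugation immediate.
\<close>

definition almost_le :: "'a set \<Rightarrow> 'a set \<Rightarrow> bool"
  where "almost_le H K \<longleftrightarrow> (\<exists>E. finite E \<and> E \<subseteq> carrier G \<and> H \<subseteq> E <#> K)"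

lemma conjugate_iff: "x \<in> conjugate g H \<longleftrightarrow> (\<exists>h\<in>H. x = g \<otimes> h \<otimes> inv g)"
  by (auto simp: l_coset_def r_coset_def)

lemma conjugate_image: "conjugate g H = (\<lambda>h. g \<otimes> h \<otimes> inv g) ` H"
  by (auto simp: conjugate_iff)

lemma conjugate_mem: "h \<in> H \<Longrightarrow> g \<otimes> h \<otimes> inv g \<in> conjugate g H"
  by (auto simp: conjugate_iff)

lemma conjugate_subset: "\<lbrakk>H \<subseteq> carrier G; g \<in> carrier G\<rbrakk> \<Longrightarrow> conjugate g H \<subseteq> carrier G"
  by (auto simp: conjugate_image)

lemma conjugate_one: assumes "H \<subseteq> carrier G" shows "conjugate \<one> H = H"
proof -
  have "\<one> \<otimes> h \<otimes> inv \<one> = h" if "h \<in> H" for h using that assms by (simp add: subset_iff)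
  then show ?thesis unfolding conjugate_image by simp
qed

lemma conjugate_conjugate:
  assumes "H \<subseteq> carrier G" "g \<in> carrier G" "k \<in> carrier G"
  shows "conjugate g (conjugate k H) = conjugate (g \<otimes> k) H"
proof -
  have "g \<otimes> (k \<otimes> h \<otimes> inv k) \<otimes> inv g = (g \<otimes> k) \<otimes> h \<otimes> inv (g \<otimes> k)" if "h \<in> H" for h
    using assms that by (simp add: m_assoc inv_mult_group subset_iff)
  then show ?thesis by (simp add: conjugate_image image_image)
qed

lemma subgroup_conjugate:
  assumes H: "subgroup H G" and g: "g \<in> carrier G" shows "subgroup (conjugate g H) G"
proof -
  interpret H: subgroup H G by fact
  show ?thesis
  proof (rule subgroupI)
    show "conjugate g H \<subseteq> carrier G" using g H.subset by (rule_tac conjugate_subset)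
    show "conjugate g H \<noteq> {}" unfolding conjugate_image using H.one_closed by blast
    fix a assume "a \<in> conjugate g H"
    then obtain h where h: "h \<in> H" "a = g \<otimes> h \<otimes> inv g" by (auto simp: conjugate_iff)
    then have "inv a = g \<otimes> inv h \<otimes> inv g" using g by (simp add: inv_mult_group m_assoc)
    then show "inv a \<in> conjugate g H" using conjugate_mem[of "inv h" H g] h by simp
    fix b assume "b \<in> conjugate g H"
    then obtain k where k: "k \<in> H" "b = g \<otimes> k \<otimes> inv g" by (auto simp: conjugate_iff)
    then have "a \<otimes> b = g \<otimes> (h \<otimes> k) \<otimes> inv g" using g h
      by (simp add: m_assoc) (simp add: m_assoc[symmetric])
    then show "a \<otimes> b \<in> conjugate g H" using conjugate_mem[of "h \<otimes> k" H g] h k by simp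
  qed
qed

lemma almost_le_mono: "\<lbrakk>H \<subseteq> K; K \<subseteq> carrier G\<rbrakk> \<Longrightarrow> almost_le H K"
  unfolding almost_le_def set_mult_def
  by (intro exI[of _ "{\<one>}"]) (auto intro: l_one[symmetric])

lemma almost_le_trans:
  assumes HK: "almost_le H K" and KL: "almost_le K L" and L: "L \<subseteq> carrier G"
  shows "almost_le H L"
proof -
  obtain E where E: "finite E" "E \<subseteq> carrier G" "H \<subseteq> E <#> K" using HK by (auto simp: almost_le_def)
  obtain D where D: "finite D" "D \<subseteq> carrier G" "K \<subseteq> D <#> L" using KL by (auto simp: almost_le_def)
  have "finite (E <#> D)" using E(1) D(1) by (auto simp: set_mult_def)
  moreover have "E <#> D \<subseteq> carrier G" using E(2) D(2) by (auto simp: set_mult_def)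
  moreover have "H \<subseteq> E <#> D <#> L"
  proof
    fix h assume "h \<in> H"
    then obtain e k where ek: "e \<in> E" "k \<in> K" "h = e \<otimes> k" using E(3) by (auto simp: set_mult_def)
    then obtain d l where dl: "d \<in> D" "l \<in> L" "k = d \<otimes> l" using D(3) by (auto simp: set_mult_def)
    have "h = (e \<otimes> d) \<otimes> l" using ek dl E(2) D(2) L by (simp add: m_assoc subset_iff)
    then show "h \<in> E <#> D <#> L" using ek dl by (auto simp: set_mult_def)
  qed
  ultimately show ?thesis unfolding almost_le_def by blast
qed

lemma almost_le_conjugate:
  assumes HK: "almost_le H K" and K: "K \<subseteq> carrier G" and g: "g \<in> carrier G"
  shows "almost_le (conjugate g H) (conjugate g K)"
proof -
  obtain E where E: "finite E" "E \<subseteq> carrier G" "H \<subseteq> E <#> K" using HK by (auto simp: almost_le_def)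
  let ?D = "(\<lambda>e. g \<otimes> e \<otimes> inv g) ` E"
  have "conjugate g H \<subseteq> ?D <#> conjugate g K"
  proof
    fix x assume "x \<in> conjugate g H"
    then obtain h where h: "h \<in> H" "x = g \<otimes> h \<otimes> inv g" by (auto simp: conjugate_iff)
    then obtain e k where ek: "e \<in> E" "k \<in> K" "h = e \<otimes> k" using E(3) by (auto simp: set_mult_def)
    have "x = (g \<otimes> e \<otimes> inv g) \<otimes> (g \<otimes> k \<otimes> inv g)"
      using h ek g E(2) K by (simp add: subset_iff m_assoc) (simp add: subset_iff m_assoc[symmetric])
    then show "x \<in> ?D <#> conjugate g K" using ek conjugate_mem[of k K g] by (auto simp: set_mult_def)
  qed
  moreover have "finite ?D" "?D \<subseteq> carrier G" using E g by auto
  ultimately show ?thesis unfolding almost_le_def by blast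
qed

text \<open>
  Used with orbit maps \<open>f\<close>: the orbit of a point under \<open>H\<close> is finite only if its stabilizer has finite
  index.
\<close>

lemma almost_le_if_finite_image:
  assumes H: "H \<subseteq> carrier G" and fin: "finite (f ` H)"
    and eq: "\<And>h k. \<lbrakk>h \<in> H; k \<in> H; f h = f k\<rbrakk> \<Longrightarrow> inv h \<otimes> k \<in> N"
  shows "almost_le H N"
proof -
  define c where "c b = (SOME h. h \<in> H \<and> f h = b)" for b
  have c: "c (f h) \<in> H" "f (c (f h)) = f h" if "h \<in> H" for h
    using someI[of "\<lambda>k. k \<in> H \<and> f k = f h" h] that by (auto simp: c_def)
  have "H \<subseteq> c ` f ` H <#> N"
  proof
    fix h assume h: "h \<in> H"
    have "h = c (f h) \<otimes> (inv (c (f h)) \<otimes> h)"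
      using h c(1)[OF h] H by (simp add: subset_iff m_assoc[symmetric])
    then show "h \<in> c ` f ` H <#> N"
      using eq[OF c(1)[OF h] h c(2)[OF h]] h by (auto simp: set_mult_def)
  qed
  moreover have "c ` f ` H \<subseteq> carrier G" using c H by auto
  ultimately show ?thesis using fin unfolding almost_le_def by blast
qed

text \<open>
  Inversion matches the right cosets of \<open>H \<inter> K\<close> in \<open>H\<close> with the left cosets of \<open>K\<close> that meet \<open>H\<close>.
\<close>

lemma finite_rcosets_iff_almost_le:
  assumes H: "subgroup H G" and K: "subgroup K G"
  shows "finite (rcosets\<^bsub>G\<lparr>carrier := H\<rparr>\<^esub> (H \<inter> K)) \<longleftrightarrow> almost_le H K"
proof -
  interpret H: subgroup H G by fact
  interpret K: subgroup K G by fact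
  let ?M = "H \<inter> K"
  have M: "subgroup ?M G" using H K by (rule subgroups_Inter_pair)
  have rc: "rcosets\<^bsub>G\<lparr>carrier := H\<rparr>\<^esub> ?M = (\<lambda>h. ?M #> inv h) ` H"
  proof -
    have "rcosets\<^bsub>G\<lparr>carrier := H\<rparr>\<^esub> ?M = (\<lambda>h. ?M #> h) ` H" by (auto simp: RCOSETS_def r_coset_def)
    also have "\<dots> = (\<lambda>h. ?M #> h) ` (m_inv G ` H)"
    proof -
      have "m_inv G ` H = H"
        by (auto intro!: image_eqI[where x = "inv _"])
      then show ?thesis by simp
    qed
    finally show ?thesis by (simp add: image_image)
  qed
  show ?thesis
  proof
    assume fin: "finite (rcosets\<^bsub>G\<lparr>carrier := H\<rparr>\<^esub> ?M)"
    show "almost_le H K"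
    proof (rule almost_le_if_finite_image)
      show "finite ((\<lambda>h. ?M #> inv h) ` H)" using fin rc by simp
      fix h k assume hk: "h \<in> H" "k \<in> H" "?M #> inv h = ?M #> inv k"
      have "inv h \<in> ?M #> inv k" using rcos_self[OF _ M, of "inv h"] hk by simp
      then obtain m where m: "m \<in> ?M" "inv h = m \<otimes> inv k" by (auto simp: r_coset_def)
      then have "inv h \<otimes> k = m" using hk by (simp add: m_assoc)
      then show "inv h \<otimes> k \<in> K" using m by simp
    qed (rule H.subset)
  next
    assume "almost_le H K"
    then obtain E where E: "finite E" "E \<subseteq> carrier G" "H \<subseteq> E <#> K" by (auto simp: almost_le_def)
    define c where "c e = (SOME h. h \<in> H \<and> h \<in> e <# K)" for e
    have "(\<lambda>h. ?M #> inv h) ` H \<subseteq> (\<lambda>e. ?M #> inv (c e)) ` E"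
    proof
      fix C assume "C \<in> (\<lambda>h. ?M #> inv h) ` H"
      then obtain h where h: "h \<in> H" "C = ?M #> inv h" by blast
      then have "h \<in> E <#> K" using E(3) by blast
      then obtain e where e: "e \<in> E" "h \<in> e <# K" unfolding set_mult_def l_coset_def by blast
      have c: "c e \<in> H \<and> c e \<in> e <# K" unfolding c_def
        by (rule someI[of "\<lambda>h. h \<in> H \<and> h \<in> e <# K" h]) (simp add: h(1) e(2))
      obtain k l where kl: "k \<in> K" "h = e \<otimes> k" "l \<in> K" "c e = e \<otimes> l"
        using e c by (auto simp: l_coset_def)
      have eG: "e \<in> carrier G" using e E by auto
      have "inv h \<otimes> c e = inv k \<otimes> l"
        unfolding kl using eG kl by (simp add: inv_mult_group m_assoc) (simp add: m_assoc[symmetric])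
      moreover have "inv h \<otimes> c e \<in> H" using h(1) c by blast
      moreover have "inv k \<otimes> l \<in> K" using kl by blast
      ultimately have m: "inv h \<otimes> c e \<in> ?M" by simp
      have "C = ?M #> (inv h \<otimes> c e \<otimes> inv (c e))" using h c by (simp add: m_assoc)
      also have "\<dots> = ?M #> (inv h \<otimes> c e) #> inv (c e)"
        using h c H.subset by (subst coset_mult_assoc) auto
      also have "\<dots> = ?M #> inv (c e)"
        using m M by (simp add: coset_join2)
      finally show "C \<in> (\<lambda>e. ?M #> inv (c e)) ` E" using e by blast
    qed
    then show "finite (rcosets\<^bsub>G\<lparr>carrier := H\<rparr>\<^esub> ?M)"
      unfolding rc using E(1) by (rule finite_subset[OF _ finite_imageI])
  qed
qed

lemma commensurate_iff_almost_le:
  assumes "subgroup H G" "subgroup K G"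
  shows "commensurate G H K \<longleftrightarrow> almost_le H K \<and> almost_le K H"
  using finite_rcosets_iff_almost_le[OF assms] finite_rcosets_iff_almost_le[OF assms(2,1)]
  by (simp add: commensurate_def Int_commute)

lemma mem_Comm_iff:
  assumes "subgroup H G"
  shows "g \<in> Comm G H \<longleftrightarrow> g \<in> carrier G \<and> almost_le H (conjugate g H) \<and> almost_le (conjugate g H) H"
  using commensurate_iff_almost_le[OF assms subgroup_conjugate[OF assms]] by (auto simp: Comm_def)

lemma subgroup_subset_Comm:
  assumes H: "subgroup H G" shows "H \<subseteq> Comm G H"
proof
  interpret subgroup H G by fact
  fix h assume h: "h \<in> H"
  have "conjugate h H = H"
    using h lcos_self coset_join3[OF _ H h] coset_join2[OF _ H] by simp
  then show "h \<in> Comm G H"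
    using h H subset by (simp add: mem_Comm_iff almost_le_mono)
qed

lemma subgroup_Comm:
  assumes H: "subgroup H G" shows "subgroup (Comm G H) G"
proof (rule subgroupI)
  interpret subgroup H G by fact
  show "Comm G H \<subseteq> carrier G" by (auto simp: Comm_def)
  show "Comm G H \<noteq> {}" using subgroup_subset_Comm[OF H] one_closed by blast
  fix g assume g: "g \<in> Comm G H"
  then have gG: "g \<in> carrier G" and g1: "almost_le H (conjugate g H)" and g2: "almost_le (conjugate g H) H"
    using mem_Comm_iff[OF H] by auto
  have c: "conjugate (inv g) (conjugate g H) = H"
    using conjugate_conjugate[OF subset, of "inv g" g] conjugate_one[OF subset] gG by simp
  show "inv g \<in> Comm G H"
    using almost_le_conjugate[OF g1, of "inv g", unfolded c] almost_le_conjugate[OF g2, of "inv g", unfolded c]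
      gG subset conjugate_subset[OF subset gG]
    unfolding mem_Comm_iff[OF H] by blast
  fix k assume "k \<in> Comm G H"
  then have kG: "k \<in> carrier G" and k1: "almost_le H (conjugate k H)" and k2: "almost_le (conjugate k H) H"
    using mem_Comm_iff[OF H] by auto
  have "almost_le (conjugate g H) (conjugate (g \<otimes> k) H)" "almost_le (conjugate (g \<otimes> k) H) (conjugate g H)"
    using almost_le_conjugate[OF k1, of g] almost_le_conjugate[OF k2, of g] gG kG subset
    by (simp_all add: conjugate_conjugate conjugate_subset)
  then show "g \<otimes> k \<in> Comm G H"
    using almost_le_trans[OF g1, of "conjugate (g \<otimes> k) H"] almost_le_trans[OF _ g2, of "conjugate (g \<otimes> k) H"]
      gG kG subset by (simp add: mem_Comm_iff[OF H] conjugate_subset)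
qed

text \<open>
  The commensurator of \<open>V\<close> is a union of double cosets of \<open>V\<close>, finitely many by assumption, and each of
  its double cosets \<open>V f V\<close> consists of finitely many cosets of \<open>V\<close> because \<open>V\<close> is almost contained in its
  conjugate by \<open>f\<close>.
\<close>

lemma Comm_almost_le:
  assumes V: "subgroup V G" and F: "finite F" "F \<subseteq> carrier G" "carrier G \<subseteq> V <#> F <#> V"
  shows "almost_le (Comm G V) V"
proof -
  interpret V: subgroup V G by fact
  interpret C: subgroup "Comm G V" G using V by (rule subgroup_Comm)
  note VC = subgroup_subset_Comm[OF V]
  have "\<exists>E. finite E \<and> E \<subseteq> carrier G \<and> V <#> {f} \<subseteq> E <#> V" if f: "f \<in> F \<inter> Comm G V" for f
  proof -
    have fG: "f \<in> carrier G" using f by auto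
    obtain E where E: "finite E" "E \<subseteq> carrier G" "V \<subseteq> E <#> conjugate f V"
      using f mem_Comm_iff[OF V] by (auto simp: almost_le_def)
    have "V <#> {f} \<subseteq> (\<lambda>e. e \<otimes> f) ` E <#> V"
    proof
      fix x assume "x \<in> V <#> {f}"
      then obtain v where v: "v \<in> V" "x = v \<otimes> f" by (auto simp: set_mult_def)
      then have "v \<in> E <#> conjugate f V" using E(3) by blast
      then obtain e w where e: "e \<in> E" "w \<in> V" "v = e \<otimes> (f \<otimes> w \<otimes> inv f)"
        unfolding set_mult_def conjugate_image by blast
      have "x = (e \<otimes> f) \<otimes> w"
        using v e E(2) fG by (simp add: m_assoc subset_iff)
      then show "x \<in> (\<lambda>e. e \<otimes> f) ` E <#> V" using e by (auto simp: set_mult_def)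
    qed
    then show ?thesis using E fG by (intro exI[of _ "(\<lambda>e. e \<otimes> f) ` E"]) auto
  qed
  then obtain E where E: "\<And>f. f \<in> F \<inter> Comm G V \<Longrightarrow> finite (E f) \<and> E f \<subseteq> carrier G \<and> V <#> {f} \<subseteq> E f <#> V"
    by metis
  have "Comm G V \<subseteq> (\<Union>f\<in>F \<inter> Comm G V. E f) <#> V"
  proof
    fix x assume x: "x \<in> Comm G V"
    then have "x \<in> V <#> F <#> V" using F(3) C.subset by blast
    then obtain v f w where vfw: "v \<in> V" "f \<in> F" "w \<in> V" "x = v \<otimes> f \<otimes> w" by (auto simp: set_mult_def)
    have fG: "f \<in> carrier G" using vfw F by auto
    have "f = inv v \<otimes> x \<otimes> inv w" using vfw fG
      by (simp add: m_assoc) (simp add: m_assoc[symmetric])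
    moreover have "inv v \<in> Comm G V" "inv w \<in> Comm G V" using vfw VC by auto
    moreover have "inv v \<otimes> x \<otimes> inv w \<in> Comm G V"
      using calculation(2,3) x by (intro C.m_closed)
    ultimately have f: "f \<in> F \<inter> Comm G V" using vfw(2) by simp
    have "v \<otimes> f \<in> V <#> {f}" using vfw by (auto simp: set_mult_def)
    then have "v \<otimes> f \<in> E f <#> V" using E[OF f] by blast
    then obtain e u where eu: "e \<in> E f" "u \<in> V" "v \<otimes> f = e \<otimes> u" by (auto simp: set_mult_def)
    have "e \<in> carrier G" using eu E[OF f] by auto
    then have "x = e \<otimes> (u \<otimes> w)" using vfw eu by (simp add: m_assoc)
    then show "x \<in> (\<Union>f\<in>F \<inter> Comm G V. E f) <#> V" using f eu vfw by (auto simp: set_mult_def)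
  qed
  moreover have "finite (\<Union>f\<in>F \<inter> Comm G V. E f)" "(\<Union>f\<in>F \<inter> Comm G V. E f) \<subseteq> carrier G"
    using F E by auto
  ultimately show ?thesis unfolding almost_le_def by blast
qed

text \<open>
  The commensurator of \<open>V\<close> is commensurate with \<open>V\<close>, and so are their conjugates by a common element;
  hence both groups are commensurated by the same elements.
\<close>

lemma Comm_Comm:
  assumes V: "subgroup V G" and CV: "almost_le (Comm G V) V"
  shows "Comm G (Comm G V) = Comm G V"
proof
  interpret V: subgroup V G by fact
  interpret C: subgroup "Comm G V" G using V by (rule subgroup_Comm)
  note C = C.subgroup_axioms
  note VC = almost_le_mono[OF subgroup_subset_Comm[OF V] C.subset]
  show "Comm G V \<subseteq> Comm G (Comm G V)" using C by (rule subgroup_subset_Comm)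
  show "Comm G (Comm G V) \<subseteq> Comm G V"
  proof
    fix g assume "g \<in> Comm G (Comm G V)"
    then have g: "g \<in> carrier G" "almost_le (Comm G V) (conjugate g (Comm G V))" "almost_le (conjugate g (Comm G V)) (Comm G V)"
      using mem_Comm_iff[OF C] by auto
    note s = conjugate_subset[OF V.subset g(1)] conjugate_subset[OF C.subset g(1)]
    have "almost_le V (conjugate g V)"
      using almost_le_trans[OF almost_le_trans[OF VC g(2)] almost_le_conjugate[OF CV]] g(1) s V.subset by blast
    moreover have "almost_le (conjugate g V) V"
      using almost_le_trans[OF almost_le_trans[OF almost_le_conjugate[OF VC] g(3)] CV] g(1) s C.subset V.subset by blast
    ultimately show "g \<in> Comm G V" using g(1) mem_Comm_iff[OF V] by simp
  qed
qed

end

section \<open>Subrepresentations and matrix coefficients\<close>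

context complex_hilbert_space
begin

lemma hnorm_restrict [simp]: "hnorm (K\<lparr>hcarrier := W\<rparr>) = hnorm K"
  by (rule ext) (simp add: hnorm_def)

lemma inner_space_restrict:
  assumes "subspace W" "W \<subseteq> hcarrier K"
  shows "complex_inner_space (K\<lparr>hcarrier := W\<rparr>)"
proof -
  have "vector_space (hscale (K\<lparr>hcarrier := W\<rparr>))" using vector_space_axioms by simp
  then interpret W: vector_space "hscale (K\<lparr>hcarrier := W\<rparr>)" .
  show ?thesis
    by unfold_locales
      (use assms in \<open>auto simp: inner_add inner_scale inner_pos subset_iff intro: inner_commute\<close>)
qed

lemma hlim_restrict:
  assumes "subspace W" "W \<subseteq> hcarrier K"
  shows "complex_inner_space.hlim (K\<lparr>hcarrier := W\<rparr>) u l \<longleftrightarrow> range u \<subseteq> W \<and> l \<in> W \<and> hlim u l"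
proof -
  interpret W: complex_inner_space "K\<lparr>hcarrier := W\<rparr>" using assms by (rule inner_space_restrict)
  show ?thesis using assms(2) by (auto simp: W.hlim_def hlim_def)
qed

lemma hilbert_space_restrict:
  assumes W: "closed_subspace K W"
  shows "complex_hilbert_space (K\<lparr>hcarrier := W\<rparr>)"
proof -
  note W' = closed_subspaceD[OF W]
  interpret W: complex_inner_space "K\<lparr>hcarrier := W\<rparr>" using W'(1,2) by (rule inner_space_restrict)
  show ?thesis
  proof
    show "W.mcomplete"
      unfolding W.mcomplete_def
    proof (intro allI impI)
      fix u assume u: "W.MCauchy u"
      then have uW: "range u \<subseteq> W" unfolding W.MCauchy_def by simp
      then have "range u \<subseteq> hcarrier K" using W'(2) by blast
      moreover have "hdist (K\<lparr>hcarrier := W\<rparr>) (u m) (u n) = hdist K (u m) (u n)" for m n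
        using uW W'(2) by (auto simp: hdist_def)
      ultimately have "MCauchy u" using u unfolding W.MCauchy_def MCauchy_def by simp
      then obtain l where l: "hlim u l"
        using complete hlim_iff_limitin \<open>range u \<subseteq> hcarrier K\<close> by (auto simp: mcomplete_def)
      then have "l \<in> W" using W'(3)[of u l] uW by auto
      then have "W.hlim u l" using uW l hlim_restrict[OF W'(1,2)] by simp
      then show "\<exists>x. limitin W.mtopology u x sequentially"
        using W.hlim_iff_limitin uW by auto
    qed
  qed
qed

lemma closed_subspace_restrict_iff:
  assumes W: "closed_subspace K W"
  shows "closed_subspace (K\<lparr>hcarrier := W\<rparr>) L \<longleftrightarrow> closed_subspace K L \<and> L \<subseteq> W"
proof -
  note W' = closed_subspaceD[OF W]
  interpret W: complex_inner_space "K\<lparr>hcarrier := W\<rparr>" using W'(1,2) by (rule inner_space_restrict)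
  have sub: "W.subspace L \<longleftrightarrow> subspace L" by simp
  show ?thesis
  proof
    assume L: "closed_subspace (K\<lparr>hcarrier := W\<rparr>) L"
    note L' = W.closed_subspaceD[OF L]
    have LW: "L \<subseteq> W" using L'(2) by simp
    have "closed_subspace K L"
    proof (rule closed_subspaceI)
      fix u l assume u: "\<And>n. u n \<in> L" and l: "hlim u l"
      have "l \<in> W" using W'(3)[OF _ l] u LW by blast
      then have "W.hlim u l" using u l LW by (auto simp: hlim_restrict[OF W'(1,2)])
      then show "l \<in> L" using L'(3) u by blast
    qed (use L' LW W' sub in auto)
    then show "closed_subspace K L \<and> L \<subseteq> W" using LW by simp
  next
    assume L: "closed_subspace K L \<and> L \<subseteq> W"
    then have L1: "closed_subspace K L" by simp
    note L' = closed_subspaceD[OF L1]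
    show "closed_subspace (K\<lparr>hcarrier := W\<rparr>) L"
    proof (rule W.closed_subspaceI)
      fix u l assume "\<And>n. u n \<in> L" "W.hlim u l"
      then show "l \<in> L" using L'(3)[of u l] by (simp add: hlim_restrict[OF W'(1,2)])
    qed (use L L' sub in auto)
  qed
qed

end

lemma finite_positive_gap: "finite D \<Longrightarrow> \<exists>\<delta>>0. \<forall>d\<in>D. 0 < d \<longrightarrow> \<delta> \<le> (d::real)"
proof (induction D rule: finite_induct)
  case (insert d D)
  then obtain \<delta> where "\<delta> > 0" "\<forall>d\<in>D. 0 < d \<longrightarrow> \<delta> \<le> d" by blast
  then show ?case
    by (intro exI[of _ "if 0 < d then min \<delta> d else \<delta>"]) auto
qed (auto intro: exI[of _ 1])

context unitary_rep
begin

lemma act_carrier: "\<lbrakk>g \<in> carrier G; x \<in> hcarrier \<pi>\<rbrakk> \<Longrightarrow> act \<pi> g x \<in> hcarrier \<pi>"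
  using act_bij[of g] by (auto simp: bij_betw_def)

lemma act_one: assumes "x \<in> hcarrier \<pi>" shows "act \<pi> \<one>\<^bsub>G\<^esub> x = x"
proof -
  have "act \<pi> \<one>\<^bsub>G\<^esub> (act \<pi> \<one>\<^bsub>G\<^esub> x) = act \<pi> \<one>\<^bsub>G\<^esub> x"
    using act_mult[of "\<one>\<^bsub>G\<^esub>" "\<one>\<^bsub>G\<^esub>" x] assms by simp
  then show ?thesis
    using act_bij[of "\<one>\<^bsub>G\<^esub>"] assms act_carrier[of "\<one>\<^bsub>G\<^esub>" x] by (auto simp: bij_betw_def dest: inj_onD)
qed

lemma act_inv_cancel:
  assumes "g \<in> carrier G" "x \<in> hcarrier \<pi>"
  shows "act \<pi> (inv\<^bsub>G\<^esub> g) (act \<pi> g x) = x" "act \<pi> g (act \<pi> (inv\<^bsub>G\<^esub> g) x) = x"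
  using act_mult[of "inv\<^bsub>G\<^esub> g" g x] act_mult[of g "inv\<^bsub>G\<^esub> g" x] assms by (simp_all add: act_one)

lemma act_zero: "g \<in> carrier G \<Longrightarrow> act \<pi> g 0 = 0"
  using act_scale[of g 0 0] carrier_0 by simp

lemma act_diff:
  "\<lbrakk>g \<in> carrier G; x \<in> hcarrier \<pi>; y \<in> hcarrier \<pi>\<rbrakk> \<Longrightarrow> act \<pi> g (x - y) = act \<pi> g x - act \<pi> g y"
  using act_add[of g "x - y" y] by (simp add: carrier_simps)

lemma act_hnorm: "\<lbrakk>g \<in> carrier G; x \<in> hcarrier \<pi>\<rbrakk> \<Longrightarrow> hnorm \<pi> (act \<pi> g x) = hnorm \<pi> x"
  by (simp add: hnorm_def act_inner)

lemma act_inner_left: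
  "\<lbrakk>g \<in> carrier G; x \<in> hcarrier \<pi>; y \<in> hcarrier \<pi>\<rbrakk>
    \<Longrightarrow> hinner \<pi> (act \<pi> g x) y = hinner \<pi> x (act \<pi> (inv\<^bsub>G\<^esub> g) y)"
  using act_inner[of g x "act \<pi> (inv\<^bsub>G\<^esub> g) y"] by (simp add: act_carrier act_inv_cancel)

lemma hlim_act:
  assumes g: "g \<in> carrier G" and u: "hlim u l"
  shows "hlim (\<lambda>n. act \<pi> g (u n)) (act \<pi> g l)"
proof -
  have "hnorm \<pi> (act \<pi> g (u n) - act \<pi> g l) = hnorm \<pi> (u n - l)" for n
    using g hlim_carrier[OF u] act_hnorm[of g "u n - l"] by (simp add: act_diff carrier_simps)
  then show ?thesis using u g hlim_carrier[OF u] by (auto simp: hlim_def act_carrier)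
qed

lemma act_midhull:
  assumes g: "g \<in> carrier G" and A: "A \<subseteq> hcarrier \<pi>" and x: "x \<in> midhull A"
  shows "act \<pi> g x \<in> midhull (act \<pi> g ` A)"
  using x
proof induction
  case (midhull_mid x y)
  then have "x \<in> hcarrier \<pi>" "y \<in> hcarrier \<pi>"
    using midhull_subset_subspace[OF carrier_subspace A] by auto
  then show ?case
    using g midhull.midhull_mid[OF midhull_mid.IH] by (simp add: act_scale act_add carrier_simps)
qed (auto intro: midhull.intros)

lemma unitary_rep_restrict:
  assumes H: "subgroup H G" and W: "closed_subspace \<pi> W"
    and inv: "\<And>h x. \<lbrakk>h \<in> H; x \<in> W\<rbrakk> \<Longrightarrow> act \<pi> h x \<in> W"
  shows "unitary_rep (G\<lparr>carrier := H\<rparr>) (subtopology T H) (\<pi>\<lparr>hcarrier := W\<rparr>)"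
proof -
  note W' = closed_subspaceD[OF W]
  interpret H: subgroup H G by fact
  interpret HG: group "G\<lparr>carrier := H\<rparr>" using H G.group_axioms by (rule subgroup.subgroup_is_group)
  interpret W: complex_hilbert_space "\<pi>\<lparr>hcarrier := W\<rparr>" using W by (rule hilbert_space_restrict)
  have WX: "x \<in> hcarrier \<pi>" if "x \<in> W" for x using that W'(2) by blast
  show ?thesis
  proof
    show "topspace (subtopology T H) = carrier (G\<lparr>carrier := H\<rparr>)"
      using topspace_carrier H.subset by auto
  next
    fix g assume "g \<in> carrier (G\<lparr>carrier := H\<rparr>)"
    then have g: "g \<in> H" by simp
    then have gi: "inv\<^bsub>G\<^esub> g \<in> H" "inv\<^bsub>G\<^esub> g \<in> carrier G" "g \<in> carrier G" by auto
    have "bij_betw (act \<pi> g) W W"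
      by (rule bij_betw_byWitness[where f' = "act \<pi> (inv\<^bsub>G\<^esub> g)"])
        (use inv g gi WX in \<open>auto simp: act_inv_cancel\<close>)
    then show "bij_betw (act (\<pi>\<lparr>hcarrier := W\<rparr>) g) (hcarrier (\<pi>\<lparr>hcarrier := W\<rparr>)) (hcarrier (\<pi>\<lparr>hcarrier := W\<rparr>))"
      by simp
  next
    fix x assume "x \<in> hcarrier (\<pi>\<lparr>hcarrier := W\<rparr>)"
    then have x: "x \<in> W" by simp
    have cont: "continuous_map (subtopology T H) mtopology (\<lambda>g. act \<pi> g x)"
      using strongly_continuous[OF WX[OF x]] by (rule continuous_map_from_subtopology)
    have HT: "topspace (subtopology T H) = H" using topspace_carrier H.subset by auto
    show "continuous_map (subtopology T H) W.mtopology (\<lambda>g. act (\<pi>\<lparr>hcarrier := W\<rparr>) g x)"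
      unfolding W.continuous_map_to_metric
    proof (intro ballI allI impI)
      fix g and e :: real assume g: "g \<in> topspace (subtopology T H)" and e: "e > 0"
      then obtain U where U: "openin (subtopology T H) U" "g \<in> U"
          "\<forall>k\<in>U. act \<pi> k x \<in> mball (act \<pi> g x) e"
        using cont unfolding continuous_map_to_metric by blast
      have "act \<pi> k x \<in> W.mball (act \<pi> g x) e" if "k \<in> U" for k
      proof -
        have "k \<in> H" using openin_subset[OF U(1)] that HT by blast
        then have "act \<pi> k x \<in> W" "act \<pi> g x \<in> W" using inv x g HT by auto
        then show ?thesis using U(3) that WX unfolding W.in_mball by (auto simp: hdist_def)
      qed
      then show "\<exists>U. openin (subtopology T H) U \<and> g \<in> U \<and>
          (\<forall>y\<in>U. act (\<pi>\<lparr>hcarrier := W\<rparr>) y x \<in> W.mball (act (\<pi>\<lparr>hcarrier := W\<rparr>) g x) e)"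
        using U(1,2) by auto
    qed
  qed (use WX in \<open>auto simp: act_add act_scale act_inner act_mult\<close>)
qed

definition fixer :: "'v \<Rightarrow> 'g set"
  where "fixer x = {g \<in> carrier G. act \<pi> g x = x}"

definition coefficients :: "'v \<Rightarrow> complex set"
  where "coefficients x = (\<lambda>g. hinner \<pi> (act \<pi> g x) x) ` carrier G"

lemma subgroup_fixer: assumes x: "x \<in> hcarrier \<pi>" shows "subgroup (fixer x) G"
proof (rule G.subgroupI)
  show "fixer x \<noteq> {}" using act_one[OF x] by (auto simp: fixer_def)
  fix a b assume a: "a \<in> fixer x"
  then show "inv\<^bsub>G\<^esub> a \<in> fixer x" using act_inv_cancel(1)[of a x] x by (auto simp: fixer_def)
  assume "b \<in> fixer x"
  then show "a \<otimes>\<^bsub>G\<^esub> b \<in> fixer x" using a x by (auto simp: fixer_def act_mult)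
qed (auto simp: fixer_def)

lemma inner_orbit:
  assumes "a \<in> carrier G" "b \<in> carrier G" "x \<in> hcarrier \<pi>"
  shows "hinner \<pi> (act \<pi> a x) (act \<pi> b x) = hinner \<pi> (act \<pi> (inv\<^bsub>G\<^esub> b \<otimes>\<^bsub>G\<^esub> a) x) x"
  using assms by (simp add: act_mult act_inner_left act_carrier)

text \<open>
  Up to the constant \<open>2 \<parallel>x\<parallel>\<^sup>2\<close>, the squared distance of \<open>a x\<close> and \<open>b x\<close> is minus twice the real part of a
  matrix coefficient of \<open>x\<close>, so there is a least positive distance.
\<close>

lemma orbit_discrete:
  assumes x: "x \<in> hcarrier \<pi>" and fin: "finite (coefficients x)"
  obtains \<delta> where "\<delta> > 0"
    "\<And>a b. \<lbrakk>a \<in> carrier G; b \<in> carrier G; hnorm \<pi> (act \<pi> a x - act \<pi> b x) < \<delta>\<rbrakk> \<Longrightarrow> act \<pi> a x = act \<pi> b x"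
proof -
  let ?D = "(\<lambda>c. sqrt (2 * (hnorm \<pi> x)\<^sup>2 - 2 * Re c)) ` coefficients x"
  obtain \<delta> where \<delta>: "\<delta> > 0" "\<And>d. \<lbrakk>d \<in> ?D; 0 < d\<rbrakk> \<Longrightarrow> \<delta> \<le> d"
    using finite_positive_gap[of ?D] fin by blast
  have "act \<pi> a x = act \<pi> b x"
    if ab: "a \<in> carrier G" "b \<in> carrier G" and less: "hnorm \<pi> (act \<pi> a x - act \<pi> b x) < \<delta>" for a b
  proof -
    let ?d = "act \<pi> a x - act \<pi> b x"
    have d: "?d \<in> hcarrier \<pi>" using ab x by (simp add: act_carrier carrier_simps)
    have "(hnorm \<pi> ?d)\<^sup>2 = 2 * (hnorm \<pi> x)\<^sup>2 - 2 * Re (hinner \<pi> (act \<pi> (inv\<^bsub>G\<^esub> b \<otimes>\<^bsub>G\<^esub> a) x) x)"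
      using ab x by (simp add: hnorm_sq_diff act_carrier act_hnorm inner_orbit)
    then have "hnorm \<pi> ?d = sqrt (2 * (hnorm \<pi> x)\<^sup>2 - 2 * Re (hinner \<pi> (act \<pi> (inv\<^bsub>G\<^esub> b \<otimes>\<^bsub>G\<^esub> a) x) x))"
      using hnorm_ge_0[OF d] by (metis real_sqrt_abs abs_of_nonneg)
    then have "hnorm \<pi> ?d \<in> ?D" using ab by (auto simp: coefficients_def)
    then have "hnorm \<pi> ?d = 0" using \<delta>(2)[of "hnorm \<pi> ?d"] less hnorm_ge_0[OF d] by force
    then show ?thesis using hnorm_eq_0[OF d] by simp
  qed
  then show thesis using that \<delta>(1) by blast
qed

text \<open>
  As the orbit is discrete, the stabilizer is the preimage of a small ball around \<open>x\<close> under the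
  continuous orbit map.
\<close>

lemma openin_fixer:
  assumes x: "x \<in> hcarrier \<pi>" and fin: "finite (coefficients x)"
  shows "openin T (fixer x)"
proof -
  obtain \<delta> where \<delta>: "\<delta> > 0" "\<And>a b. \<lbrakk>a \<in> carrier G; b \<in> carrier G; hnorm \<pi> (act \<pi> a x - act \<pi> b x) < \<delta>\<rbrakk>
      \<Longrightarrow> act \<pi> a x = act \<pi> b x"
    using orbit_discrete[OF assms] by metis
  have "fixer x = {g \<in> topspace T. act \<pi> g x \<in> mball x \<delta>}"
  proof
    show "fixer x \<subseteq> {g \<in> topspace T. act \<pi> g x \<in> mball x \<delta>}"
      using x \<delta>(1) topspace_carrier by (auto simp: fixer_def hdist_def hnorm_zero)
    show "{g \<in> topspace T. act \<pi> g x \<in> mball x \<delta>} \<subseteq> fixer x"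
  proof
    fix g assume g: "g \<in> {g \<in> topspace T. act \<pi> g x \<in> mball x \<delta>}"
    then have gG: "g \<in> carrier G" using topspace_carrier by simp
    have "hnorm \<pi> (act \<pi> \<one>\<^bsub>G\<^esub> x - act \<pi> g x) < \<delta>"
      using g x by (auto simp: hdist_def act_one)
    then have "act \<pi> \<one>\<^bsub>G\<^esub> x = act \<pi> g x" using gG by (intro \<delta>(2)) auto
    then show "g \<in> fixer x" using gG x by (simp add: fixer_def act_one)
  qed
  qed
  then show ?thesis
    using openin_continuous_map_preimage[OF strongly_continuous[OF x], of "mball x \<delta>"] by simp
qed

end

section \<open>Non-archimedean Roelcke precompact groups\<close>

text \<open>
  The properties of a Roelcke precompact group of permutations of a countable set on which the
  decomposition depends. Small open subgroups provide fixed vectors, and countably many cosets make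
  the orbits of these vectors countable.
\<close>

locale nonarchimedean_Roelcke_group = group G
  for G :: "('g, 'm) monoid_scheme" and T :: "'g topology" +
  assumes topspace_T: "topspace T = carrier G"
    and translate_open: "\<lbrakk>g \<in> carrier G; openin T U\<rbrakk> \<Longrightarrow> openin T (g <#\<^bsub>G\<^esub> U)"
    and small_open_subgroup: "\<lbrakk>openin T U; \<one>\<^bsub>G\<^esub> \<in> U\<rbrakk> \<Longrightarrow> \<exists>V. subgroup V G \<and> openin T V \<and> V \<subseteq> U"
    and countable_cosets: "\<lbrakk>subgroup V G; openin T V\<rbrakk> \<Longrightarrow> countable ((\<lambda>g. g <#\<^bsub>G\<^esub> V) ` carrier G)"
    and Roelcke: "Roelcke_precompact G T"

lemma (in nonarchimedean_Roelcke_group) finite_double_cosets: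
  assumes "subgroup V G" "openin T V"
  obtains F where "finite F" "F \<subseteq> carrier G" "carrier G = V <#>\<^bsub>G\<^esub> F <#>\<^bsub>G\<^esub> V"
proof -
  have "V \<subseteq> carrier G \<and> (\<exists>U. openin T U \<and> \<one>\<^bsub>G\<^esub> \<in> U \<and> U \<subseteq> V)"
    using assms(2) subgroup.one_closed[OF assms(1)] subgroup.subset[OF assms(1)] by blast
  with Roelcke have "\<exists>F. finite F \<and> F \<subseteq> carrier G \<and> carrier G = V <#>\<^bsub>G\<^esub> F <#>\<^bsub>G\<^esub> V"
    unfolding Roelcke_precompact_def by (elim allE[of _ V]) (erule (1) mp)
  then show thesis using that by (elim exE conjE)
qed

lemma (in nonarchimedean_Roelcke_group) openin_overgroup:
  assumes V: "openin T V" "subgroup V G" and H: "subgroup H G" "V \<subseteq> H"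
  shows "openin T H"
proof -
  interpret V: subgroup V G by fact
  interpret H: subgroup H G by fact
  have "H = (\<Union>h\<in>H. h <#\<^bsub>G\<^esub> V)"
  proof
    show "H \<subseteq> (\<Union>h\<in>H. h <#\<^bsub>G\<^esub> V)" using lcos_self[OF _ V(2)] by auto
    show "(\<Union>h\<in>H. h <#\<^bsub>G\<^esub> V) \<subseteq> H" using H(2) by (auto simp: l_coset_def)
  qed
  moreover have "openin T (\<Union>h\<in>H. h <#\<^bsub>G\<^esub> V)"
    using V(1) translate_open by (intro openin_Union) auto
  ultimately show ?thesis by simp
qed

locale nonarchimedean_Roelcke_rep = unitary_rep G T \<pi> + G: nonarchimedean_Roelcke_group G T
  for G :: "('g, 'm) monoid_scheme" and T :: "'g topology" and \<pi> :: "('g, 'v::ab_group_add) urep"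
begin

text \<open>
  For a sufficiently small open subgroup \<open>V\<close> the orbit \<open>V x\<close>, and with it its closed convex hull, stays
  within distance \<open>\<parallel>x\<parallel> / 2\<close> of \<open>x\<close> and thus away from 0. The point of least norm in the hull is unique, hence
  fixed by \<open>V\<close>.
\<close>

lemma exists_open_fixed_vector:
  assumes Z: "invariant_subspace G \<pi> Z" and x: "x \<in> Z" "x \<noteq> 0"
  obtains V z where "subgroup V G" "openin T V" "z \<in> Z" "z \<noteq> 0" "\<And>v. v \<in> V \<Longrightarrow> act \<pi> v z = z"
proof -
  have Zc: "closed_subspace \<pi> Z" and Zi: "\<And>g z. \<lbrakk>g \<in> carrier G; z \<in> Z\<rbrakk> \<Longrightarrow> act \<pi> g z \<in> Z"
    using Z by (auto simp: invariant_subspace_def)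
  note Z' = closed_subspaceD[OF Zc]
  have xX: "x \<in> hcarrier \<pi>" using x Z' by auto
  have nx: "hnorm \<pi> x > 0" using hnorm_ge_0[OF xX] hnorm_eq_0[OF xX] x by simp
  let ?U = "{g \<in> topspace T. act \<pi> g x \<in> mball x (hnorm \<pi> x / 2)}"
  have "openin T ?U" by (rule openin_continuous_map_preimage[OF strongly_continuous[OF xX]]) simp
  moreover have "\<one>\<^bsub>G\<^esub> \<in> ?U" using xX nx by (simp add: topspace_carrier act_one)
  ultimately obtain V where V: "subgroup V G" "openin T V" "V \<subseteq> ?U"
    using G.small_open_subgroup by meson
  interpret V: subgroup V G by fact
  define A where "A = (\<lambda>v. act \<pi> v x) ` V"
  define C where "C = midhull A"
  have AX: "A \<subseteq> hcarrier \<pi>" using xX V.subset by (auto simp: A_def act_carrier)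
  have AZ: "A \<subseteq> Z" using x(1) Zi V.subset by (auto simp: A_def)
  have CZ: "C \<subseteq> Z" unfolding C_def using Z'(1) AZ by (rule midhull_subset_subspace)
  then have CX: "C \<subseteq> hcarrier \<pi>" using Z'(2) by blast
  have xC: "x \<in> C"
    unfolding C_def A_def using act_one[OF xX] V.one_closed by (intro midhull_base image_eqI[of _ _ "\<one>\<^bsub>G\<^esub>"]) auto
  have mid: "hscale \<pi> (1/2) (a + b) \<in> C" if "a \<in> C" "b \<in> C" for a b
    using that by (auto simp: C_def intro: midhull_mid)
  obtain u l where u: "\<And>n. u n \<in> C" and l: "hlim u l"
    and min: "\<And>R. (\<exists>a\<in>C. hnorm \<pi> a \<le> R) \<Longrightarrow> hnorm \<pi> l \<le> R"
    by (rule almost_minimal_limit[of "\<lambda>_. C" "hnorm \<pi> x"]) (use CX mid xC in auto)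
  note lX = hlim_carrier(2)[OF l]
  have uX: "u n \<in> hcarrier \<pi>" for n using u CX by blast
  have lZ: "l \<in> Z" using Z'(3)[OF _ l] u CZ by blast
  have CV: "act \<pi> v c \<in> C" if "v \<in> V" "c \<in> C" for v c
  proof -
    have "act \<pi> v c \<in> midhull (act \<pi> v ` A)"
      using that V.subset AX by (intro act_midhull) (auto simp: C_def)
    moreover have "act \<pi> v ` A \<subseteq> A"
      using that V.subset xX by (force simp: A_def subset_iff act_mult[symmetric])
    ultimately show ?thesis using midhull_mono[of "act \<pi> v ` A" A] by (auto simp: C_def)
  qed
  have near: "hnorm \<pi> (c - x) \<le> hnorm \<pi> x / 2" if "c \<in> C" for c
  proof (rule midhull_cball[OF AX xX])
    show "c \<in> midhull A" using that by (simp add: C_def)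
    fix a assume "a \<in> A"
    then obtain v where v: "v \<in> V" "a = act \<pi> v x" by (auto simp: A_def)
    then have "act \<pi> v x \<in> mball x (hnorm \<pi> x / 2)" using V(3) by blast
    then show "hnorm \<pi> (a - x) \<le> hnorm \<pi> x / 2"
      using v hnorm_diff_commute[of a x] xX act_carrier[of v x] V.subset by (auto simp: hdist_def)
  qed
  have "l \<noteq> 0"
  proof
    assume "l = 0"
    then have "(\<lambda>n. hnorm \<pi> (u n)) \<longlonglongrightarrow> 0" using hlim_hnorm[OF l] by (simp add: hnorm_zero)
    moreover have "hnorm \<pi> x / 2 \<le> hnorm \<pi> (u n)" for n
      using near[OF u[of n]] hnorm_triangle[of "x - u n" "u n"] hnorm_diff_commute[of x "u n"] uX[of n] xX
      by (simp add: carrier_simps)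
    ultimately have "hnorm \<pi> x / 2 \<le> 0" by (intro LIMSEQ_le_const) auto
    then show False using nx by simp
  qed
  moreover have "act \<pi> v l = l" if v: "v \<in> V" for v
  proof -
    have vG: "v \<in> carrier G" using v V.subset by blast
    have "(hnorm \<pi> (u n + hscale \<pi> (-1) (act \<pi> v (u n))))\<^sup>2 \<le> 4 * (hnorm \<pi> (u n))\<^sup>2 - 4 * (hnorm \<pi> l)\<^sup>2" for n
    proof -
      have "hnorm \<pi> l \<le> hnorm \<pi> (hscale \<pi> (1/2) (u n + act \<pi> v (u n)))"
        using mid[OF u CV[OF v u]] by (intro min) blast
      then have "(hnorm \<pi> l)\<^sup>2 \<le> (hnorm \<pi> (hscale \<pi> (1/2) (u n + act \<pi> v (u n))))\<^sup>2"
        using lX by (intro power_mono hnorm_ge_0)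
      then show ?thesis
        using parallelogram[of "u n" "act \<pi> v (u n)"] uX vG by (simp add: act_carrier act_hnorm)
    qed
    moreover have "(\<lambda>n. (hnorm \<pi> (u n + hscale \<pi> (-1) (act \<pi> v (u n))))\<^sup>2)
        \<longlonglongrightarrow> (hnorm \<pi> (l + hscale \<pi> (-1) (act \<pi> v l)))\<^sup>2"
      by (intro tendsto_power hlim_hnorm hlim_add hlim_scale hlim_act l vG)
    moreover have "(\<lambda>n. 4 * (hnorm \<pi> (u n))\<^sup>2 - 4 * (hnorm \<pi> l)\<^sup>2) \<longlonglongrightarrow> 4 * (hnorm \<pi> l)\<^sup>2 - 4 * (hnorm \<pi> l)\<^sup>2"
      by (intro tendsto_intros hlim_hnorm l)
    ultimately have "(hnorm \<pi> (l + hscale \<pi> (-1) (act \<pi> v l)))\<^sup>2 \<le> 4 * (hnorm \<pi> l)\<^sup>2 - 4 * (hnorm \<pi> l)\<^sup>2"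
      by (intro LIMSEQ_le[of _ _ "\<lambda>n. 4 * (hnorm \<pi> (u n))\<^sup>2 - 4 * (hnorm \<pi> l)\<^sup>2"]) auto
    then have "hnorm \<pi> (l - act \<pi> v l) = 0" by simp
    then show ?thesis using hnorm_eq_0[of "l - act \<pi> v l"] lX vG by (simp add: act_carrier carrier_simps)
  qed
  ultimately show thesis using that V lZ by blast
qed

text \<open>
  The matrix coefficient at \<open>v f w\<close> with \<open>v, w \<in> V\<close> equals the one at \<open>f\<close>.
\<close>

lemma finite_coefficients_if_open_fixer:
  assumes V: "subgroup V G" "openin T V" and z: "z \<in> hcarrier \<pi>" "\<And>v. v \<in> V \<Longrightarrow> act \<pi> v z = z"
  shows "finite (coefficients z)"
proof -
  interpret V: subgroup V G by fact
  obtain F where F: "finite F" "F \<subseteq> carrier G" "carrier G = V <#>\<^bsub>G\<^esub> F <#>\<^bsub>G\<^esub> V"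
    using G.finite_double_cosets[OF V] .
  have "coefficients z \<subseteq> (\<lambda>f. hinner \<pi> (act \<pi> f z) z) ` F"
  proof
    fix c assume "c \<in> coefficients z"
    then obtain g where g: "g \<in> carrier G" "c = hinner \<pi> (act \<pi> g z) z" by (auto simp: coefficients_def)
    then obtain v f w where vfw: "v \<in> V" "f \<in> F" "w \<in> V" "g = v \<otimes>\<^bsub>G\<^esub> f \<otimes>\<^bsub>G\<^esub> w"
      using F(3) unfolding set_mult_def by blast
    have m: "v \<in> carrier G" "f \<in> carrier G" "w \<in> carrier G" "inv\<^bsub>G\<^esub> v \<in> V" using vfw F(2) by auto
    then have "c = hinner \<pi> (act \<pi> f z) z"
      using vfw z g(2) by (simp add: act_mult act_inner_left act_carrier)
    then show "c \<in> (\<lambda>f. hinner \<pi> (act \<pi> f z) z) ` F" using vfw(2) by blast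
  qed
  then show ?thesis using F(1) finite_surj by blast
qed

lemma countable_orbit:
  assumes x: "x \<in> hcarrier \<pi>" and fin: "finite (coefficients x)"
  shows "countable ((\<lambda>g. act \<pi> g x) ` carrier G)"
proof -
  let ?V = "fixer x"
  have V: "subgroup ?V G" using x by (rule subgroup_fixer)
  have "act \<pi> g x = act \<pi> (SOME k. k \<in> g <#\<^bsub>G\<^esub> ?V) x" if g: "g \<in> carrier G" for g
  proof -
    have "g \<in> g <#\<^bsub>G\<^esub> ?V" using G.lcos_self[OF g V] .
    then have "(SOME k. k \<in> g <#\<^bsub>G\<^esub> ?V) \<in> g <#\<^bsub>G\<^esub> ?V" by (rule someI)
    then obtain v where "v \<in> ?V" "(SOME k. k \<in> g <#\<^bsub>G\<^esub> ?V) = g \<otimes>\<^bsub>G\<^esub> v" by (auto simp: l_coset_def)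
    then show ?thesis using g x by (auto simp: fixer_def act_mult)
  qed
  then have "(\<lambda>g. act \<pi> g x) ` carrier G
      = (\<lambda>C. act \<pi> (SOME k. k \<in> C) x) ` ((\<lambda>g. g <#\<^bsub>G\<^esub> ?V) ` carrier G)"
    by (simp add: image_image cong: image_cong)
  then show ?thesis
    using G.countable_cosets[OF V openin_fixer[OF assms]] by simp
qed

end

section \<open>Orthogonal translates and induced representations\<close>

lemma left_transversal_unique:
  assumes "group G" "subgroup H G" "left_transversal G H S"
    and "s \<in> S" "t \<in> S" "inv\<^bsub>G\<^esub> t \<otimes>\<^bsub>G\<^esub> s \<in> H"
  shows "s = t"
proof -
  interpret group G by fact
  have st: "s \<in> carrier G" "t \<in> carrier G" using assms by (auto simp: left_transversal_def)
  have "s = t \<otimes>\<^bsub>G\<^esub> (inv\<^bsub>G\<^esub> t \<otimes>\<^bsub>G\<^esub> s)" using st by (simp add: m_assoc[symmetric])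
  then have "s \<in> t <#\<^bsub>G\<^esub> H" using assms(6) by (auto simp: l_coset_def)
  moreover have "s \<in> s <#\<^bsub>G\<^esub> H" using st(1) assms(2) by (rule lcos_self)
  ultimately show ?thesis using assms(3,4,5) st by (auto simp: left_transversal_def)
qed

lemma (in unitary_rep) closed_subspace_act_vimage:
  assumes L: "closed_subspace \<pi> L" and g: "g \<in> carrier G"
  shows "closed_subspace \<pi> {x \<in> hcarrier \<pi>. act \<pi> g x \<in> L}"
proof (rule closed_subspaceI)
  note L' = closed_subspaceD[OF L]
  show "subspace {x \<in> hcarrier \<pi>. act \<pi> g x \<in> L}"
    using L'(1) g by (auto simp: subspace_def carrier_simps act_zero act_add act_scale)
  fix u l assume u: "\<And>n. u n \<in> {x \<in> hcarrier \<pi>. act \<pi> g x \<in> L}" and l: "hlim u l"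
  have "act \<pi> g l \<in> L" using L'(3)[OF _ hlim_act[OF g l]] u by simp
  then show "l \<in> {x \<in> hcarrier \<pi>. act \<pi> g x \<in> L}" using hlim_carrier[OF l] by simp
qed auto

lemma (in unitary_rep) proj_equivariant:
  assumes W: "closed_subspace \<pi> W" and g: "g \<in> carrier G"
    and inv: "\<And>y. y \<in> W \<Longrightarrow> act \<pi> g y \<in> W" "\<And>y. y \<in> W \<Longrightarrow> act \<pi> (inv\<^bsub>G\<^esub> g) y \<in> W"
    and x: "x \<in> hcarrier \<pi>"
  shows "proj W (act \<pi> g x) = act \<pi> g (proj W x)"
proof (rule proj_unique[OF W])
  show "act \<pi> g x \<in> hcarrier \<pi>" using g x by (rule act_carrier)
  show "act \<pi> g (proj W x) \<in> W" using proj_in[OF W x] by (rule inv)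
  fix y assume y: "y \<in> W"
  then have yX: "y \<in> hcarrier \<pi>" using closed_subspaceD(2)[OF W] by blast
  have "hinner \<pi> (act \<pi> g (x - proj W x)) y = hinner \<pi> (x - proj W x) (act \<pi> (inv\<^bsub>G\<^esub> g) y)"
    by (rule act_inner_left[OF g carrier_diff[OF x proj_carrier[OF W x]] yX])
  also have "\<dots> = 0" using proj_orth[OF W x inv(2)[OF y]] .
  finally show "hinner \<pi> (act \<pi> g x - act \<pi> g (proj W x)) y = 0"
    using g x proj_carrier[OF W x] by (simp add: act_diff)
qed

text \<open>
  The translates of \<open>W\<close> along distinct cosets of \<open>H\<close> are orthogonal. This is the internal
  description of the representation induced from the action of \<open>H\<close> on \<open>W\<close>.
\<close>

locale imprimitivity_block = unitary_rep G T \<pi>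
  for G :: "('g, 'm) monoid_scheme" and T :: "'g topology" and \<pi> :: "('g, 'v::ab_group_add) urep" +
  fixes H :: "'g set" and W :: "'v set"
  assumes H: "subgroup H G"
    and W: "closed_subspace \<pi> W"
    and WH: "\<lbrakk>h \<in> H; x \<in> W\<rbrakk> \<Longrightarrow> act \<pi> h x \<in> W"
    and orth: "\<lbrakk>g \<in> carrier G; g \<notin> H; x \<in> W; y \<in> W\<rbrakk> \<Longrightarrow> hinner \<pi> (act \<pi> g x) y = 0"
begin

definition translates :: "'v set"
  where "translates = (\<Union>g\<in>carrier G. act \<pi> g ` W)"

definition envelope :: "'v set"
  where "envelope = cspan translates"

text \<open>
  The component of \<open>x\<close> in \<open>g W\<close>, moved back to \<open>W\<close> by the inverse of \<open>g\<close>. As a function of \<open>g\<close> it is the element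
  of the induced representation that corresponds to \<open>x\<close>.
\<close>

definition coord :: "'v \<Rightarrow> 'g \<Rightarrow> 'v"
  where "coord x g = (if g \<in> carrier G then proj W (act \<pi> (inv\<^bsub>G\<^esub> g) x) else 0)"

lemma WX: "x \<in> W \<Longrightarrow> x \<in> hcarrier \<pi>"
  using closed_subspaceD(2)[OF W] by blast

lemma HG: "h \<in> H \<Longrightarrow> h \<in> carrier G"
  using subgroup.subset[OF H] by blast

lemma translates_carrier: "translates \<subseteq> hcarrier \<pi>"
  by (auto simp: translates_def WX act_carrier)

lemma closed_envelope: "closed_subspace \<pi> envelope"
  unfolding envelope_def by (rule closed_subspace_cspan[OF translates_carrier])

lemma envelope_carrier: "x \<in> envelope \<Longrightarrow> x \<in> hcarrier \<pi>"
  using closed_subspaceD(2)[OF closed_envelope] by blast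

lemma translates_envelope: "\<lbrakk>g \<in> carrier G; x \<in> W\<rbrakk> \<Longrightarrow> act \<pi> g x \<in> envelope"
  using span_subset_cspan[OF translates_carrier] span_base[of "act \<pi> g x" translates]
  by (auto simp: envelope_def translates_def)

lemma W_envelope: "x \<in> W \<Longrightarrow> x \<in> envelope"
  using translates_envelope[of "\<one>\<^bsub>G\<^esub>" x] by (simp add: act_one WX)

lemma invariant_envelope: "invariant_subspace G \<pi> envelope"
  unfolding invariant_subspace_def
proof (intro conjI ballI closed_envelope)
  fix g x assume g: "g \<in> carrier G" and x: "x \<in> envelope"
  have "translates \<subseteq> {x \<in> hcarrier \<pi>. act \<pi> g x \<in> envelope}"
    using g translates_envelope by (auto simp: translates_def act_mult[symmetric] WX act_carrier)
  then have "envelope \<subseteq> {x \<in> hcarrier \<pi>. act \<pi> g x \<in> envelope}"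
    using cspan_minimal[OF closed_subspace_act_vimage[OF closed_envelope g]] by (simp add: envelope_def)
  then show "act \<pi> g x \<in> envelope" using x by blast
qed

lemma proj_act:
  assumes "h \<in> H" "x \<in> hcarrier \<pi>"
  shows "proj W (act \<pi> h x) = act \<pi> h (proj W x)"
  using assms subgroup.m_inv_closed[OF H] by (intro proj_equivariant W HG WH)

lemma coord_carrier: "x \<in> hcarrier \<pi> \<Longrightarrow> coord x g \<in> W"
  using closed_subspaceD(1)[OF W] by (auto simp: coord_def act_carrier subspace_0 intro: proj_in[OF W])

lemma coord_outside: "g \<notin> carrier G \<Longrightarrow> coord x g = 0"
  by (simp add: coord_def)

lemma coord_mult:
  assumes "g \<in> carrier G" "h \<in> H" "x \<in> hcarrier \<pi>"
  shows "coord x (g \<otimes>\<^bsub>G\<^esub> h) = act \<pi> (inv\<^bsub>G\<^esub> h) (coord x g)"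
proof -
  have hi: "inv\<^bsub>G\<^esub> h \<in> H" using subgroup.m_inv_closed[OF H assms(2)] .
  have "act \<pi> (inv\<^bsub>G\<^esub> (g \<otimes>\<^bsub>G\<^esub> h)) x = act \<pi> (inv\<^bsub>G\<^esub> h) (act \<pi> (inv\<^bsub>G\<^esub> g) x)"
    using assms HG by (simp add: G.inv_mult_group act_mult)
  then show ?thesis
    using assms HG proj_act[OF hi, of "act \<pi> (inv\<^bsub>G\<^esub> g) x"] by (simp add: coord_def act_carrier)
qed

lemma coord_add: "\<lbrakk>x \<in> hcarrier \<pi>; y \<in> hcarrier \<pi>\<rbrakk> \<Longrightarrow> coord (x + y) g = coord x g + coord y g"
  by (simp add: coord_def act_add act_carrier proj_add[OF W])

lemma coord_scale: "x \<in> hcarrier \<pi> \<Longrightarrow> coord (hscale \<pi> c x) g = hscale \<pi> c (coord x g)"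
  by (simp add: coord_def act_scale act_carrier proj_scale[OF W])

lemma coord_act:
  assumes "k \<in> carrier G" "g \<in> carrier G" "x \<in> hcarrier \<pi>"
  shows "coord (act \<pi> k x) g = coord x (inv\<^bsub>G\<^esub> k \<otimes>\<^bsub>G\<^esub> g)"
  using assms by (simp add: coord_def G.inv_mult_group act_mult[symmetric])

lemma inner_coord:
  assumes "g \<in> carrier G" "x \<in> hcarrier \<pi>" "y \<in> W"
  shows "hinner \<pi> (coord x g) y = hinner \<pi> x (act \<pi> g y)" "hinner \<pi> y (coord x g) = hinner \<pi> (act \<pi> g y) x"
proof -
  show 1: "hinner \<pi> (coord x g) y = hinner \<pi> x (act \<pi> g y)"
    using assms act_inner_left[of "inv\<^bsub>G\<^esub> g" x y] WX by (simp add: coord_def proj_inner_left[OF W] act_carrier)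
  show "hinner \<pi> y (coord x g) = hinner \<pi> (act \<pi> g y) x"
    using 1 inner_commute[of y "coord x g"] inner_commute[of "act \<pi> g y" x] WX coord_carrier assms act_carrier
    by simp
qed

lemma orth_translates:
  assumes "g \<in> carrier G" "k \<in> carrier G" "inv\<^bsub>G\<^esub> k \<otimes>\<^bsub>G\<^esub> g \<notin> H" "x \<in> W" "y \<in> W"
  shows "hinner \<pi> (act \<pi> g x) (act \<pi> k y) = 0"
proof -
  have "hinner \<pi> (act \<pi> g x) (act \<pi> k y) = hinner \<pi> (act \<pi> (inv\<^bsub>G\<^esub> k) (act \<pi> g x)) y"
    using assms WX act_inner_left[of "inv\<^bsub>G\<^esub> k" "act \<pi> g x" y] by (simp add: act_carrier)
  also have "\<dots> = 0" using assms WX orth[of "inv\<^bsub>G\<^esub> k \<otimes>\<^bsub>G\<^esub> g" x y] by (simp add: act_mult)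
  finally show ?thesis .
qed

text \<open>
  For a set \<open>F\<close> of representatives of distinct cosets this is the orthogonal projection to the sum of
  the translates \<open>t W\<close> with \<open>t \<in> F\<close>.
\<close>

definition part :: "'g set \<Rightarrow> 'v \<Rightarrow> 'v"
  where "part F x = (\<Sum>t\<in>F. act \<pi> t (coord x t))"

context
  fixes S assumes S: "left_transversal G H S"
begin

lemma S_carrier: "t \<in> S \<Longrightarrow> t \<in> carrier G"
  using S by (auto simp: left_transversal_def)

lemma inner_translates:
  assumes "s \<in> S" "t \<in> S" "x \<in> W" "y \<in> W"
  shows "hinner \<pi> (act \<pi> s x) (act \<pi> t y) = (if s = t then hinner \<pi> x y else 0)"
proof (cases "s = t")
  case False
  then have "inv\<^bsub>G\<^esub> t \<otimes>\<^bsub>G\<^esub> s \<notin> H"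
    using left_transversal_unique[OF G.group_axioms H S assms(1,2)] by blast
  then show ?thesis using False assms S_carrier by (simp add: orth_translates)
qed (use assms S_carrier WX in \<open>simp add: act_inner\<close>)

lemma hnorm_sum_translates:
  assumes F: "finite F" "F \<subseteq> S" and a: "\<And>t. t \<in> F \<Longrightarrow> a t \<in> W"
  shows "(hnorm \<pi> (\<Sum>t\<in>F. act \<pi> t (a t)))\<^sup>2 = (\<Sum>t\<in>F. (hnorm \<pi> (a t))\<^sup>2)"
proof -
  let ?s = "\<Sum>t\<in>F. act \<pi> t (a t)"
  have c: "act \<pi> t (a t) \<in> hcarrier \<pi>" if "t \<in> F" for t
    using that F(2) a S_carrier WX by (intro act_carrier) auto
  have s: "?s \<in> hcarrier \<pi>" using c by (rule carrier_sum)
  have "hinner \<pi> ?s ?s = (\<Sum>t\<in>F. hinner \<pi> (act \<pi> t (a t)) ?s)"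
    by (rule inner_sum_left[OF c s])
  also have "\<dots> = (\<Sum>t\<in>F. \<Sum>s\<in>F. hinner \<pi> (act \<pi> t (a t)) (act \<pi> s (a s)))"
    by (intro sum.cong refl inner_sum_right c)
  also have "\<dots> = (\<Sum>t\<in>F. \<Sum>s\<in>F. if s = t then hinner \<pi> (a t) (a t) else 0)"
    using F(2) a by (intro sum.cong refl) (auto simp: inner_translates subset_iff)
  also have "\<dots> = (\<Sum>t\<in>F. of_real ((hnorm \<pi> (a t))\<^sup>2))"
    using F(1) a WX by (simp add: inner_self)
  finally have "of_real ((hnorm \<pi> ?s)\<^sup>2) = complex_of_real (\<Sum>t\<in>F. (hnorm \<pi> (a t))\<^sup>2)"
    using inner_self[OF s] by simp
  then show ?thesis by (simp only: of_real_eq_iff)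
qed

lemma part_carrier:
  assumes "F \<subseteq> S" "x \<in> hcarrier \<pi>" shows "part F x \<in> hcarrier \<pi>"
  unfolding part_def using assms S_carrier coord_carrier WX by (intro carrier_sum act_carrier) auto

lemma hnorm_diff_part:
  assumes F: "finite F" "F \<subseteq> S" and x: "x \<in> hcarrier \<pi>"
  shows "(hnorm \<pi> (x - part F x))\<^sup>2 = (hnorm \<pi> x)\<^sup>2 - (\<Sum>t\<in>F. (hnorm \<pi> (coord x t))\<^sup>2)"
proof -
  have c: "act \<pi> t (coord x t) \<in> hcarrier \<pi>" if "t \<in> F" for t
    using that F(2) x S_carrier coord_carrier WX by (intro act_carrier) auto
  have "hinner \<pi> x (part F x) = (\<Sum>t\<in>F. hinner \<pi> x (act \<pi> t (coord x t)))"
    unfolding part_def by (rule inner_sum_right[OF c x])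
  also have "\<dots> = (\<Sum>t\<in>F. of_real ((hnorm \<pi> (coord x t))\<^sup>2))"
  proof (intro sum.cong refl)
    fix t assume "t \<in> F"
    then have t: "t \<in> carrier G" using F(2) S_carrier by blast
    show "hinner \<pi> x (act \<pi> t (coord x t)) = of_real ((hnorm \<pi> (coord x t))\<^sup>2)"
      by (simp add: inner_coord(1)[OF t x coord_carrier[OF x], symmetric] inner_self[OF WX[OF coord_carrier[OF x]]])
  qed
  finally have "Re (hinner \<pi> x (part F x)) = (\<Sum>t\<in>F. (hnorm \<pi> (coord x t))\<^sup>2)" by simp
  moreover have "(hnorm \<pi> (part F x))\<^sup>2 = (\<Sum>t\<in>F. (hnorm \<pi> (coord x t))\<^sup>2)"
    unfolding part_def using F coord_carrier[OF x] by (intro hnorm_sum_translates)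
  ultimately show ?thesis
    using x part_carrier[OF F(2) x] by (simp add: hnorm_sq_diff)
qed

lemma hnorm_part_le:
  assumes F: "finite F" "F \<subseteq> S" and x: "x \<in> hcarrier \<pi>"
  shows "hnorm \<pi> (part F x) \<le> hnorm \<pi> x"
proof (rule power2_le_imp_le)
  have "(hnorm \<pi> (part F x))\<^sup>2 = (\<Sum>t\<in>F. (hnorm \<pi> (coord x t))\<^sup>2)"
    unfolding part_def using F coord_carrier[OF x] by (intro hnorm_sum_translates)
  also have "\<dots> = (hnorm \<pi> x)\<^sup>2 - (hnorm \<pi> (x - part F x))\<^sup>2" using hnorm_diff_part[OF assms] by simp
  finally show "(hnorm \<pi> (part F x))\<^sup>2 \<le> (hnorm \<pi> x)\<^sup>2" by simp
qed (rule hnorm_ge_0[OF x])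

lemma part_add:
  assumes "F \<subseteq> S" "x \<in> hcarrier \<pi>" "y \<in> hcarrier \<pi>"
  shows "part F (x + y) = part F x + part F y"
proof -
  have "act \<pi> t (coord (x + y) t) = act \<pi> t (coord x t) + act \<pi> t (coord y t)" if "t \<in> F" for t
    using that assms S_carrier coord_carrier WX by (simp add: coord_add act_add subset_iff)
  then show ?thesis by (simp add: part_def sum.distrib)
qed

lemma part_scale:
  assumes "F \<subseteq> S" "x \<in> hcarrier \<pi>"
  shows "part F (hscale \<pi> c x) = hscale \<pi> c (part F x)"
proof -
  have "act \<pi> t (coord (hscale \<pi> c x) t) = hscale \<pi> c (act \<pi> t (coord x t))" if "t \<in> F" for t
    using that assms S_carrier coord_carrier WX by (simp add: coord_scale act_scale subset_iff)
  then show ?thesis by (simp add: part_def scale_sum_right)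
qed

lemma part_translate:
  assumes g: "g \<in> carrier G" and w: "w \<in> W"
  shows "\<forall>\<^sub>F F in finite_subsets_at_top S. part F (act \<pi> g w) = act \<pi> g w"
proof -
  obtain t where t: "t \<in> S" "g \<in> t <#\<^bsub>G\<^esub> H" using S g by (auto simp: left_transversal_def)
  then obtain h where h: "h \<in> H" "g = t \<otimes>\<^bsub>G\<^esub> h" by (auto simp: l_coset_def)
  define v where "v = act \<pi> h w"
  have v: "v \<in> W" unfolding v_def using h(1) w by (rule WH)
  have gv: "act \<pi> g w = act \<pi> t v" using h t S_carrier HG w WX by (simp add: v_def act_mult)
  have tvX: "act \<pi> t v \<in> hcarrier \<pi>" using t(1) v S_carrier WX by (simp add: act_carrier)
  have coord: "coord (act \<pi> t v) s = (if s = t then v else 0)" if s: "s \<in> S" for s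
  proof -
    have "hinner \<pi> (act \<pi> (inv\<^bsub>G\<^esub> s) (act \<pi> t v) - (if s = t then v else 0)) y = 0" if y: "y \<in> W" for y
    proof -
      have "hinner \<pi> (act \<pi> (inv\<^bsub>G\<^esub> s) (act \<pi> t v)) y = hinner \<pi> (act \<pi> t v) (act \<pi> s y)"
        using act_inner_left[of "inv\<^bsub>G\<^esub> s" "act \<pi> t v" y] s y S_carrier WX tvX by simp
      also have "\<dots> = (if s = t then hinner \<pi> v y else 0)"
        using inner_translates[OF t(1) s v y] by auto
      finally show ?thesis
        using s y v WX S_carrier tvX by (simp add: inner_diff_left act_carrier carrier_0 inner_zero_left)
    qed
    then have "proj W (act \<pi> (inv\<^bsub>G\<^esub> s) (act \<pi> t v)) = (if s = t then v else 0)"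
      using s v S_carrier tvX closed_subspaceD(1)[OF W]
      by (intro proj_unique[OF W]) (auto simp: act_carrier subspace_0)
    then show ?thesis using s S_carrier by (simp add: coord_def)
  qed
  have "part F (act \<pi> g w) = act \<pi> g w" if F: "finite F" "t \<in> F" "F \<subseteq> S" for F
  proof -
    have "part F (act \<pi> t v) = (\<Sum>s\<in>F. if s = t then act \<pi> t v else 0)"
      unfolding part_def using F(3) S_carrier by (intro sum.cong refl) (auto simp: coord act_zero)
    also have "\<dots> = act \<pi> t v" using F(1,2) by simp
    finally show ?thesis by (simp add: gv)
  qed
  then show ?thesis
    unfolding eventually_finite_subsets_at_top using t(1) by (intro exI[of _ "{t}"]) simp
qed

lemma part_span:
  assumes "z \<in> span translates"
  shows "z \<in> hcarrier \<pi> \<and> (\<forall>\<^sub>F F in finite_subsets_at_top S. part F z = z)"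
  using assms
proof (induction rule: span_induct_alt)
  case base
  have "part F 0 = 0" if "F \<subseteq> S" for F
    using part_scale[OF that carrier_0, of 0] by simp
  then show ?case using carrier_0 by (auto intro: eventually_finite_subsets_at_top_weakI)
next
  case (step c x y)
  then obtain g w where gw: "g \<in> carrier G" "w \<in> W" "x = act \<pi> g w" by (auto simp: translates_def)
  have x: "x \<in> hcarrier \<pi>" and y: "y \<in> hcarrier \<pi>" using step translates_carrier by auto
  have "\<forall>\<^sub>F F in finite_subsets_at_top S. F \<subseteq> S" by (rule eventually_finite_subsets_at_top_weakI)
  moreover have "\<forall>\<^sub>F F in finite_subsets_at_top S. part F x = x" using part_translate[OF gw(1,2)] gw(3) by simp
  moreover have "\<forall>\<^sub>F F in finite_subsets_at_top S. part F y = y" using step by blast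
  ultimately have "\<forall>\<^sub>F F in finite_subsets_at_top S. part F (hscale \<pi> c x + y) = hscale \<pi> c x + y"
    by eventually_elim (simp add: part_add part_scale carrier_simps x y)
  then show ?case using x y by (simp add: carrier_simps)
qed

text \<open>
  Parseval's identity. Every vector \<open>z\<close> in the span of the translates is eventually fixed by \<open>part F\<close>, and
  \<open>part F\<close> is a contraction, so the distance of \<open>part F x\<close> from \<open>x\<close> is eventually at most twice the
  distance of \<open>z\<close> from \<open>x\<close>.
\<close>

lemma has_sum_hnorm_coord:
  assumes x: "x \<in> envelope"
  shows "((\<lambda>t. (hnorm \<pi> (coord x t))\<^sup>2) has_sum (hnorm \<pi> x)\<^sup>2) S"
  unfolding has_sum_def tendsto_iff
proof (intro allI impI)
  fix e :: real assume e: "e > 0"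
  have xX: "x \<in> hcarrier \<pi>" using x by (rule envelope_carrier)
  obtain u where u: "range u \<subseteq> span translates" "hlim u x"
    using x cspan_iff[OF translates_carrier] by (auto simp: envelope_def)
  have "(\<lambda>n. (2 * hnorm \<pi> (u n - x))\<^sup>2) \<longlonglongrightarrow> (2 * 0)\<^sup>2"
    using u(2) by (intro tendsto_intros) (simp add: hlim_def)
  then have "\<forall>\<^sub>F n in sequentially. (2 * hnorm \<pi> (u n - x))\<^sup>2 < e"
    by (rule order_tendstoD(2)) (use e in simp)
  then obtain n where n: "(2 * hnorm \<pi> (u n - x))\<^sup>2 < e" by (auto simp: eventually_sequentially)
  define z where "z = u n"
  have zs: "z \<in> span translates" using u(1) by (auto simp: z_def)
  have zX: "z \<in> hcarrier \<pi>" and zF: "\<forall>\<^sub>F F in finite_subsets_at_top S. part F z = z"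
    using part_span[OF zs] by auto
  have "dist (\<Sum>t\<in>F. (hnorm \<pi> (coord x t))\<^sup>2) ((hnorm \<pi> x)\<^sup>2) < e" if F: "finite F \<and> F \<subseteq> S" and Fz: "part F z = z" for F
  proof -
    note F = conjunct1[OF F] conjunct2[OF F]
    have pX: "part F x \<in> hcarrier \<pi>" "part F (z - x) \<in> hcarrier \<pi>"
      using F xX zX by (auto simp: part_carrier carrier_simps)
    have "part F z = part F (z - x) + part F x"
      using part_add[OF F(2), of "z - x" x] zX xX by (simp add: carrier_simps)
    then have eq: "x - part F x = (x - z) + part F (z - x)" using Fz by (simp add: algebra_simps)
    have "hnorm \<pi> (x - part F x) \<le> hnorm \<pi> (x - z) + hnorm \<pi> (part F (z - x))"
      unfolding eq using hnorm_triangle[of "x - z" "part F (z - x)"] pX xX zX by (simp add: carrier_simps)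
    also have "\<dots> \<le> 2 * hnorm \<pi> (z - x)"
      using hnorm_part_le[OF F(1,2), of "z - x"] hnorm_diff_commute[of x z] xX zX by (simp add: carrier_simps)
    finally have "(hnorm \<pi> (x - part F x))\<^sup>2 \<le> (2 * hnorm \<pi> (z - x))\<^sup>2"
      using pX xX by (intro power_mono hnorm_ge_0 carrier_simps)
    also have "\<dots> < e" using n by (simp add: z_def)
    finally have "(hnorm \<pi> x)\<^sup>2 - (\<Sum>t\<in>F. (hnorm \<pi> (coord x t))\<^sup>2) < e"
      using hnorm_diff_part[OF F(1,2) xX] by simp
    moreover have "0 \<le> (hnorm \<pi> x)\<^sup>2 - (\<Sum>t\<in>F. (hnorm \<pi> (coord x t))\<^sup>2)"
      using hnorm_diff_part[OF F(1,2) xX] zero_le_power2 by metis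
    ultimately show ?thesis by (simp add: dist_real_def abs_minus_commute)
  qed
  moreover have "\<forall>\<^sub>F F in finite_subsets_at_top S. finite F \<and> F \<subseteq> S"
    by (rule eventually_finite_subsets_at_top_weakI) simp
  ultimately show "\<forall>\<^sub>F F in finite_subsets_at_top S. dist (\<Sum>t\<in>F. (hnorm \<pi> (coord x t))\<^sup>2) ((hnorm \<pi> x)\<^sup>2) < e"
    using zF by (auto elim: eventually_elim2)
qed

lemma has_sum_inner_coord:
  assumes x: "x \<in> envelope" and y: "y \<in> envelope"
  shows "((\<lambda>t. hinner \<pi> (coord x t) (coord y t)) has_sum hinner \<pi> x y) S"
proof -
  note E = closed_subspaceD[OF closed_envelope]
  have xX: "x \<in> hcarrier \<pi>" "y \<in> hcarrier \<pi>" using x y envelope_carrier by auto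
  have q: "((\<lambda>t. complex_of_real ((hnorm \<pi> (coord z t))\<^sup>2)) has_sum of_real ((hnorm \<pi> z)\<^sup>2)) S" if "z \<in> envelope" for z
    using has_sum_hnorm_coord[OF that] by (rule has_sum_of_real)
  have mem: "x + y \<in> envelope" "x - y \<in> envelope" "x + hscale \<pi> \<i> y \<in> envelope" "x - hscale \<pi> \<i> y \<in> envelope"
    using x y E(1) by (auto intro: subspace_add subspace_diff subspace_scale)
  define N where "N = (\<lambda>z t. complex_of_real ((hnorm \<pi> (coord z t))\<^sup>2))"
  have "((\<lambda>t. N (x + y) t + - N (x - y) t + \<i> * N (x + hscale \<pi> \<i> y) t + - (\<i> * N (x - hscale \<pi> \<i> y) t)) has_sum
      of_real ((hnorm \<pi> (x + y))\<^sup>2) + - of_real ((hnorm \<pi> (x - y))\<^sup>2) + \<i> * of_real ((hnorm \<pi> (x + hscale \<pi> \<i> y))\<^sup>2)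
      + - (\<i> * of_real ((hnorm \<pi> (x - hscale \<pi> \<i> y))\<^sup>2))) S"
    unfolding N_def by (intro has_sum_add has_sum_uminusI has_sum_cmult_right q mem)
  moreover have "N (x + y) t + - N (x - y) t + \<i> * N (x + hscale \<pi> \<i> y) t + - (\<i> * N (x - hscale \<pi> \<i> y) t)
      = 4 * hinner \<pi> (coord x t) (coord y t)" for t
  proof -
    have "coord (x - z) t = coord x t - coord z t" if "z \<in> hcarrier \<pi>" for z
      using coord_add[of "x - z" z t] xX that by (simp add: carrier_simps)
    then show ?thesis
      using polarization[OF WX[OF coord_carrier[OF xX(1)]] WX[OF coord_carrier[OF xX(2)]], of t t] xX
      by (simp add: N_def coord_add coord_scale carrier_simps)
  qed
  ultimately have "((\<lambda>t. 4 * hinner \<pi> (coord x t) (coord y t)) has_sum 4 * hinner \<pi> x y) S"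
    using polarization[OF xX] by simp
  then have "((\<lambda>t. (1/4) * (4 * hinner \<pi> (coord x t) (coord y t))) has_sum (1/4) * (4 * hinner \<pi> x y)) S"
    by (rule has_sum_cmult_right)
  then show ?thesis by simp
qed

text \<open>
  Square summability makes the sums of \<open>t (f t)\<close> over suitable increasing finite subsets of \<open>S\<close> a Cauchy
  sequence, and the coordinates of its limit are the values of \<open>f\<close>.
\<close>

lemma coord_surj:
  assumes f0: "\<And>g. g \<notin> carrier G \<Longrightarrow> f g = 0" and fW: "\<And>g. g \<in> carrier G \<Longrightarrow> f g \<in> W"
    and fH: "\<And>g h. \<lbrakk>g \<in> carrier G; h \<in> H\<rbrakk> \<Longrightarrow> f (g \<otimes>\<^bsub>G\<^esub> h) = act \<pi> (inv\<^bsub>G\<^esub> h) (f g)"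
    and summ: "(\<lambda>t. (hnorm \<pi> (f t))\<^sup>2) summable_on S"
  shows "\<exists>x\<in>envelope. coord x = f"
proof -
  define q where "q t = (hnorm \<pi> (f t))\<^sup>2" for t
  have fS: "f t \<in> W" "f t \<in> hcarrier \<pi>" if "t \<in> S" for t using that S_carrier fW WX by auto
  have "\<exists>F. finite F \<and> F \<subseteq> S \<and> (\<forall>F'. finite F' \<and> F' \<subseteq> S - F \<longrightarrow> sum q F' < 1 / real (Suc n))" for n
  proof -
    obtain s where "(q has_sum s) S" using summ by (auto simp: q_def[abs_def] summable_on_def)
    then have "\<forall>\<^sub>F F in finite_subsets_at_top S. dist (sum q F) s < 1 / real (Suc n) / 2"
      unfolding has_sum_def by (rule tendstoD) simp
    then obtain F where F: "finite F" "F \<subseteq> S"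
        and near: "\<forall>F'. finite F' \<and> F \<subseteq> F' \<and> F' \<subseteq> S \<longrightarrow> dist (sum q F') s < 1 / real (Suc n) / 2"
      unfolding eventually_finite_subsets_at_top by (elim exE conjE)
    have "sum q F' < 1 / real (Suc n)" if F': "finite F'" "F' \<subseteq> S - F" for F'
    proof -
      have "sum q (F \<union> F') = sum q F + sum q F'" using F F' by (intro sum.union_disjoint) auto
      moreover have "dist (sum q F) s < 1 / real (Suc n) / 2" "dist (sum q (F \<union> F')) s < 1 / real (Suc n) / 2"
        using near F F' by auto
      ultimately show ?thesis unfolding dist_real_def abs_less_iff by linarith
    qed
    then show ?thesis using F by blast
  qed
  then obtain F where F: "\<And>n. finite (F n)" "\<And>n. F n \<subseteq> S"
      "\<And>n F'. \<lbrakk>finite F'; F' \<subseteq> S - F n\<rbrakk> \<Longrightarrow> sum q F' < 1 / real (Suc n)" by metis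
  \<comment> \<open>The sets \<open>F n\<close> are unrelated; their unions increase and leave out even less of the sum.\<close>
  define A where "A n = (\<Union>k\<le>n. F k)" for n
  have A: "finite (A n)" "A n \<subseteq> S" for n using F by (auto simp: A_def)
  have Amono: "A n \<subseteq> A m" if "n \<le> m" for n m using that unfolding A_def by (intro UN_mono) auto
  have Asmall: "sum q F' < 1 / real (Suc n)" if "finite F'" "F' \<subseteq> S - A n" for n F'
    using that by (intro F(3)) (auto simp: A_def)
  define u where "u n = (\<Sum>t\<in>A n. act \<pi> t (f t))" for n
  have summand: "act \<pi> t (f t) \<in> hcarrier \<pi>" "act \<pi> t (f t) \<in> translates" if "t \<in> S" for t
    using that S_carrier fS by (auto simp: act_carrier translates_def)
  have us: "u n \<in> span translates" for n
    unfolding u_def using subsetD[OF A(2)] by (intro span_sum span_base summand(2))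
  have uX: "range u \<subseteq> hcarrier \<pi>" "u n \<in> hcarrier \<pi>" for n
    using us span_carrier[OF translates_carrier] by auto
  have udiff: "(hnorm \<pi> (u m - u n))\<^sup>2 < 1 / real (Suc n)" if "n \<le> m" for m n
  proof -
    have "u m - u n = (\<Sum>t\<in>A m - A n. act \<pi> t (f t))"
      unfolding u_def by (rule sum_diff[OF A(1) Amono[OF that], symmetric])
    then have "(hnorm \<pi> (u m - u n))\<^sup>2 = sum q (A m - A n)"
      using hnorm_sum_translates[of "A m - A n" f] A fS by (auto simp: q_def)
    also have "\<dots> < 1 / real (Suc n)" using A by (intro Asmall) auto
    finally show ?thesis .
  qed
  have "\<exists>x. hlim u x"
  proof (rule Cauchy_hlim[OF uX(1)])
    fix e :: real assume e: "e > 0"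
    then obtain N where N: "1 / real (Suc N) < e\<^sup>2" using nat_approx_posE[of "e\<^sup>2"] by auto
    have "hnorm \<pi> (u m - u n) < e" if "n \<ge> N" "m \<ge> n" for m n
    proof (rule power2_less_imp_less)
      have "1 / real (Suc n) \<le> 1 / real (Suc N)" using that by (simp add: field_simps)
      then show "(hnorm \<pi> (u m - u n))\<^sup>2 < e\<^sup>2" using udiff[OF that(2)] N by simp
    qed (use e in simp)
    then show "\<exists>N. \<forall>n\<ge>N. \<forall>m\<ge>n. hnorm \<pi> (u m - u n) < e" by blast
  qed
  then obtain x where x: "hlim u x" ..
  have xE: "x \<in> envelope"
    using x us cspan_iff[OF translates_carrier] by (auto simp: envelope_def)
  have xX: "x \<in> hcarrier \<pi>" using xE by (rule envelope_carrier)
  have coordS: "coord x t = f t" if t: "t \<in> S" for t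
  proof -
    have "hinner \<pi> (act \<pi> (inv\<^bsub>G\<^esub> t) x - f t) y = 0" if y: "y \<in> W" for y
    proof -
      have tX: "t \<in> carrier G" "act \<pi> t y \<in> hcarrier \<pi>" "y \<in> hcarrier \<pi>"
        using t y S_carrier WX by (auto simp: act_carrier)
      have un: "hinner \<pi> (u n) (act \<pi> t y) = (if t \<in> A n then hinner \<pi> (f t) y else 0)" for n
      proof -
        have "hinner \<pi> (u n) (act \<pi> t y) = (\<Sum>s\<in>A n. hinner \<pi> (act \<pi> s (f s)) (act \<pi> t y))"
          unfolding u_def using subsetD[OF A(2)] tX(2) by (intro inner_sum_left summand(1))
        also have "\<dots> = (\<Sum>s\<in>A n. if s = t then hinner \<pi> (f t) y else 0)"
          using A fS t y by (intro sum.cong refl) (auto simp: inner_translates subset_iff)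
        finally show ?thesis using A(1) by simp
      qed
      have "\<exists>N. \<forall>n\<ge>N. hinner \<pi> (u n) (act \<pi> t y) = hinner \<pi> (f t) y"
      proof (cases "\<exists>N. t \<in> A N")
        case True
        then show ?thesis using un Amono by (metis subsetD)
      next
        case False
        have "q t \<le> 0"
        proof (rule field_le_epsilon)
          fix e :: real assume "e > 0"
          then obtain n where "1 / real (Suc n) < e" using nat_approx_posE by blast
          then show "q t \<le> 0 + e" using Asmall[of "{t}" n] False t by simp
        qed
        then have "f t = 0" using hnorm_eq_0[OF fS(2)[OF t]] by (simp add: q_def)
        then show ?thesis using un tX by (simp add: inner_zero_left)
      qed
      then have "(\<lambda>n. hinner \<pi> (u n) (act \<pi> t y)) \<longlonglongrightarrow> hinner \<pi> (f t) y"
        by (intro tendsto_eventually) (simp add: eventually_sequentially)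
      then have "hinner \<pi> x (act \<pi> t y) = hinner \<pi> (f t) y"
        using hlim_inner[OF x hlim_const[OF tX(2)]] LIMSEQ_unique by blast
      then show ?thesis
        using act_inner_left[of "inv\<^bsub>G\<^esub> t" x y] tX xX fS(2)[OF t] by (simp add: inner_diff_left act_carrier)
    qed
    then have "proj W (act \<pi> (inv\<^bsub>G\<^esub> t) x) = f t"
      using t S_carrier xX fS by (intro proj_unique[OF W]) (auto simp: act_carrier)
    then show ?thesis using t S_carrier by (simp add: coord_def)
  qed
  have "coord x g = f g" for g
  proof (cases "g \<in> carrier G")
    case True
    then obtain t where t: "t \<in> S" "g \<in> t <#\<^bsub>G\<^esub> H" using S by (auto simp: left_transversal_def)
    then obtain h where h: "h \<in> H" "g = t \<otimes>\<^bsub>G\<^esub> h" by (auto simp: l_coset_def)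
    then show ?thesis
      using coordS[OF t(1)] coord_mult[OF S_carrier[OF t(1)] h(1) xX] fH[OF S_carrier[OF t(1)] h(1)] by simp
  next
    case False
    then show ?thesis using f0 by (simp add: coord_def)
  qed
  then show ?thesis using xE by blast
qed

lemma coord_in_Ind:
  assumes x: "x \<in> envelope"
  shows "coord x \<in> hcarrier (Ind_along S G H (\<pi>\<lparr>hcarrier := W\<rparr>))"
  using x envelope_carrier[OF x] has_sum_hnorm_coord[OF x] coord_carrier coord_mult
  by (auto simp: Ind_along_def coord_outside summable_on_def)

lemma equivalent_Ind_along:
  "unitarily_equivalent G (\<pi>\<lparr>hcarrier := envelope\<rparr>) (Ind_along S G H (\<pi>\<lparr>hcarrier := W\<rparr>))"
  unfolding unitarily_equivalent_def
proof (intro exI[of _ coord] conjI ballI allI)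
  let ?\<rho> = "Ind_along S G H (\<pi>\<lparr>hcarrier := W\<rparr>)"
  note E = closed_subspaceD[OF closed_envelope]
  show "bij_betw coord (hcarrier (\<pi>\<lparr>hcarrier := envelope\<rparr>)) (hcarrier ?\<rho>)"
    unfolding bij_betw_def
  proof
    show "inj_on coord (hcarrier (\<pi>\<lparr>hcarrier := envelope\<rparr>))"
    proof (rule inj_onI)
      fix x y assume "x \<in> hcarrier (\<pi>\<lparr>hcarrier := envelope\<rparr>)" "y \<in> hcarrier (\<pi>\<lparr>hcarrier := envelope\<rparr>)"
        and eq: "coord x = coord y"
      then have xy: "x \<in> envelope" "y \<in> envelope" by auto
      then have d: "x - y \<in> envelope" using E(1) by (blast intro: subspace_diff)
      have X: "x \<in> hcarrier \<pi>" "y \<in> hcarrier \<pi>" "x - y \<in> hcarrier \<pi>" using xy d envelope_carrier by auto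
      have "coord (x - y) t = 0" for t
        using coord_add[OF X(3,2), of t] eq by simp
      then have "((\<lambda>t::'g. 0) has_sum (hnorm \<pi> (x - y))\<^sup>2) S"
        using has_sum_hnorm_coord[OF d] by (simp add: hnorm_zero)
      then have "(hnorm \<pi> (x - y))\<^sup>2 = 0" by (rule has_sum_unique) (rule has_sum_0, simp)
      then show "x = y" using hnorm_eq_0[OF X(3)] by simp
    qed
    show "coord ` hcarrier (\<pi>\<lparr>hcarrier := envelope\<rparr>) = hcarrier ?\<rho>"
    proof
      show "coord ` hcarrier (\<pi>\<lparr>hcarrier := envelope\<rparr>) \<subseteq> hcarrier ?\<rho>" using coord_in_Ind by auto
      show "hcarrier ?\<rho> \<subseteq> coord ` hcarrier (\<pi>\<lparr>hcarrier := envelope\<rparr>)"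
      proof
        fix f assume "f \<in> hcarrier ?\<rho>"
        then have "\<exists>x\<in>envelope. coord x = f" by (intro coord_surj) (auto simp: Ind_along_def)
        then show "f \<in> coord ` hcarrier (\<pi>\<lparr>hcarrier := envelope\<rparr>)" by auto
      qed
    qed
  qed
next
  fix x y assume "x \<in> hcarrier (\<pi>\<lparr>hcarrier := envelope\<rparr>)" "y \<in> hcarrier (\<pi>\<lparr>hcarrier := envelope\<rparr>)"
  then have xy: "x \<in> envelope" "y \<in> envelope" by auto
  then show "coord (x + y) = coord x + coord y" using envelope_carrier by (auto simp: fun_eq_iff coord_add)
  show "hinner (Ind_along S G H (\<pi>\<lparr>hcarrier := W\<rparr>)) (coord x) (coord y) = hinner (\<pi>\<lparr>hcarrier := envelope\<rparr>) x y"
    using has_sum_inner_coord[OF xy] by (simp add: Ind_along_def infsumI)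
next
  fix c x assume "x \<in> hcarrier (\<pi>\<lparr>hcarrier := envelope\<rparr>)"
  then show "coord (hscale (\<pi>\<lparr>hcarrier := envelope\<rparr>) c x) = hscale (Ind_along S G H (\<pi>\<lparr>hcarrier := W\<rparr>)) c (coord x)"
    using envelope_carrier by (auto simp: fun_eq_iff coord_scale Ind_along_def)
next
  fix g x assume "g \<in> carrier G" "x \<in> hcarrier (\<pi>\<lparr>hcarrier := envelope\<rparr>)"
  then show "coord (act (\<pi>\<lparr>hcarrier := envelope\<rparr>) g x) = act (Ind_along S G H (\<pi>\<lparr>hcarrier := W\<rparr>)) g (coord x)"
    using envelope_carrier coord_act by (auto simp: fun_eq_iff Ind_along_def coord_outside)
qed

end

lemma equivalent_Ind: "unitarily_equivalent G (\<pi>\<lparr>hcarrier := envelope\<rparr>) (Ind G H (\<pi>\<lparr>hcarrier := W\<rparr>))"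
  unfolding Ind_def
  by (rule equivalent_Ind_along) (rule someI_ex[OF left_transversal_exists[OF G.group_axioms H]])

end

section \<open>Minimal vectors and their commensurators\<close>

context nonarchimedean_Roelcke_rep
begin

text \<open>
  The coefficients of \<open>\<eta>\<close> are iterated limits of coefficients of \<open>\<xi>\<close>, which form a finite and hence closed
  set. If \<open>\<eta>\<close> were as long as \<open>\<xi>\<close>, then the weak convergence would be convergence in norm, contradicting
  the uniform discreteness of the orbit.
\<close>

lemma weak_limit_of_orbit:
  assumes Z: "invariant_subspace G \<pi> Z" and \<xi>: "\<xi> \<in> Z" and fin: "finite (coefficients \<xi>)"
    and y: "range y \<subseteq> (\<lambda>g. act \<pi> g \<xi>) ` carrier G" and inj: "inj y"
    and c: "\<And>n::nat. hinner \<pi> (y n) \<xi> = c"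
  obtains \<eta> where "\<eta> \<in> Z" "coefficients \<eta> \<subseteq> coefficients \<xi>" "hnorm \<pi> \<eta> < hnorm \<pi> \<xi>"
    "hinner \<pi> \<eta> \<xi> = c"
proof -
  have Zc: "closed_subspace \<pi> Z" and Zi: "\<And>g z. \<lbrakk>g \<in> carrier G; z \<in> Z\<rbrakk> \<Longrightarrow> act \<pi> g z \<in> Z"
    using Z by (auto simp: invariant_subspace_def)
  note Z' = closed_subspaceD[OF Zc]
  have \<xi>X: "\<xi> \<in> hcarrier \<pi>" using \<xi> Z' by auto
  define Y where "Y = (\<lambda>g. act \<pi> g \<xi>) ` carrier G"
  have Y: "countable Y" unfolding Y_def by (rule countable_orbit[OF \<xi>X fin])
  have YZ: "Y \<subseteq> Z" using Zi \<xi> by (auto simp: Y_def)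
  then have YX: "Y \<subseteq> hcarrier \<pi>" using Z'(2) by blast
  have Yact: "act \<pi> g z \<in> Y" if "g \<in> carrier G" "z \<in> Y" for g z
    using that \<xi>X by (auto simp: Y_def act_mult[symmetric])
  have \<xi>Y: "\<xi> \<in> Y" unfolding Y_def using act_one[OF \<xi>X] by (intro image_eqI[of _ _ "\<one>\<^bsub>G\<^esub>"]) auto
  have yY: "y n \<in> Y" for n using y by (auto simp: Y_def)
  have yX: "range y \<subseteq> hcarrier \<pi>" "y n \<in> hcarrier \<pi>" for n using yY YX by auto
  have ynorm: "hnorm \<pi> (y n) = hnorm \<pi> \<xi>" for n using yY[of n] \<xi>X by (auto simp: Y_def act_hnorm)
  obtain r \<eta> u where r: "strict_mono (r :: nat \<Rightarrow> nat)" and u: "\<And>n::nat. u n \<in> midhull (range y)" "hlim u \<eta>"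
    and le: "hnorm \<pi> \<eta> \<le> hnorm \<pi> \<xi>"
    and lim: "\<And>z. z \<in> Y \<Longrightarrow> (\<lambda>n. hinner \<pi> (y (r n)) z) \<longlonglongrightarrow> hinner \<pi> \<eta> z"
    using weakly_convergent_subsequence[OF yX(1) _ Y YX, of "hnorm \<pi> \<xi>"] ynorm by (metis order_refl)
  note \<eta>X = hlim_carrier(2)[OF u(2)]
  have wr: "range (\<lambda>n. y (r n)) \<subseteq> hcarrier \<pi>" using yX(2) by auto
  have lim_act: "(\<lambda>n. hinner \<pi> (y (r n)) (act \<pi> k \<eta>)) \<longlonglongrightarrow> hinner \<pi> \<eta> (act \<pi> k \<eta>)" if k: "k \<in> carrier G" for k
  proof (rule weak_convergence_extends[OF wr _ \<eta>X le YX lim])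
    show "hlim (\<lambda>n. act \<pi> k (u n)) (act \<pi> k \<eta>)" by (rule hlim_act[OF k u(2)])
    have "act \<pi> k ` range y \<subseteq> Y" using Yact[OF k] yY by auto
    then show "act \<pi> k (u n) \<in> midhull Y" for n
      using act_midhull[OF k yX(1) u(1)[of n]] midhull_mono by blast
  qed (use ynorm in auto)
  have closed: "closed (coefficients \<xi>)" using fin by (rule finite_imp_closed)
  have Ycoef: "hinner \<pi> a b \<in> coefficients \<xi>" if ab: "a \<in> Y" "b \<in> Y" for a b
  proof -
    obtain g k where "g \<in> carrier G" "k \<in> carrier G" "a = act \<pi> g \<xi>" "b = act \<pi> k \<xi>"
      using ab by (auto simp: Y_def)
    then show ?thesis using \<xi>X by (simp add: inner_orbit coefficients_def)
  qed
  have \<eta>coef: "hinner \<pi> \<eta> b \<in> coefficients \<xi>" if "b \<in> Y" for b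
    by (rule Lim_in_closed_set[OF closed _ _ lim[OF that]]) (use Ycoef yY that in auto)
  have "coefficients \<eta> \<subseteq> coefficients \<xi>"
  proof
    fix d assume "d \<in> coefficients \<eta>"
    then obtain k where k: "k \<in> carrier G" "d = hinner \<pi> (act \<pi> k \<eta>) \<eta>" by (auto simp: coefficients_def)
    have "(\<lambda>n. cnj (hinner \<pi> (y (r n)) (act \<pi> k \<eta>))) \<longlonglongrightarrow> cnj (hinner \<pi> \<eta> (act \<pi> k \<eta>))"
      by (intro tendsto_cnj lim_act k)
    then have l: "(\<lambda>n. hinner \<pi> (act \<pi> k \<eta>) (y (r n))) \<longlonglongrightarrow> d"
      using inner_commute[OF act_carrier[OF k(1) \<eta>X] yX(2)] inner_commute[OF act_carrier[OF k(1) \<eta>X] \<eta>X] k(2)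
      by simp
    have "hinner \<pi> (act \<pi> k \<eta>) (y (r n)) \<in> coefficients \<xi>" for n
      using k \<eta>X yX(2) \<eta>coef[OF Yact[of "inv\<^bsub>G\<^esub> k" "y (r n)"]] yY by (simp add: act_inner_left)
    then show "d \<in> coefficients \<xi>"
      by (intro Lim_in_closed_set[OF closed _ _ l]) auto
  qed
  moreover have "\<eta> \<in> Z"
  proof (rule Z'(3)[OF _ u(2)])
    show "u n \<in> Z" for n
      using u(1)[of n] midhull_subset_subspace[OF Z'(1), of "range y"] yY YZ by blast
  qed
  moreover have "hinner \<pi> \<eta> \<xi> = c"
    using lim[OF \<xi>Y] c by (simp add: LIMSEQ_const_iff)
  moreover have "hnorm \<pi> \<eta> \<noteq> hnorm \<pi> \<xi>"
  proof
    assume eq: "hnorm \<pi> \<eta> = hnorm \<pi> \<xi>"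
    obtain \<delta> where \<delta>: "\<delta> > 0" "\<And>a b. \<lbrakk>a \<in> carrier G; b \<in> carrier G; hnorm \<pi> (act \<pi> a \<xi> - act \<pi> b \<xi>) < \<delta>\<rbrakk>
        \<Longrightarrow> act \<pi> a \<xi> = act \<pi> b \<xi>"
      using orbit_discrete[OF \<xi>X fin] by metis
    have "(\<lambda>n. (hnorm \<pi> \<xi>)\<^sup>2 + (hnorm \<pi> \<xi>)\<^sup>2 - 2 * Re (hinner \<pi> (y (r n)) \<eta>))
        \<longlonglongrightarrow> (hnorm \<pi> \<xi>)\<^sup>2 + (hnorm \<pi> \<xi>)\<^sup>2 - 2 * Re (hinner \<pi> \<eta> \<eta>)"
      using lim_act[of "\<one>\<^bsub>G\<^esub>"] \<eta>X by (intro tendsto_intros) (simp add: act_one)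
    moreover have "(hnorm \<pi> \<xi>)\<^sup>2 + (hnorm \<pi> \<xi>)\<^sup>2 - 2 * Re (hinner \<pi> \<eta> \<eta>) = 0"
      using \<eta>X eq by (simp add: inner_self)
    moreover have "(hnorm \<pi> \<xi>)\<^sup>2 + (hnorm \<pi> \<xi>)\<^sup>2 - 2 * Re (hinner \<pi> (y (r n)) \<eta>) = (hnorm \<pi> (y (r n) - \<eta>))\<^sup>2" for n
      using yX(2) \<eta>X eq ynorm by (simp add: hnorm_sq_diff)
    ultimately have "(\<lambda>n. (hnorm \<pi> (y (r n) - \<eta>))\<^sup>2) \<longlonglongrightarrow> 0" by simp
    then have "\<forall>\<^sub>F n in sequentially. (hnorm \<pi> (y (r n) - \<eta>))\<^sup>2 < (\<delta> / 2)\<^sup>2"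
      by (rule order_tendstoD(2)) (use \<delta>(1) in simp)
    then obtain N where N: "\<And>n. n \<ge> N \<Longrightarrow> (hnorm \<pi> (y (r n) - \<eta>))\<^sup>2 < (\<delta> / 2)\<^sup>2"
      by (auto simp: eventually_sequentially)
    have small: "hnorm \<pi> (y (r n) - \<eta>) < \<delta> / 2" if "n \<ge> N" for n
      using N[OF that] \<delta>(1) by (intro power2_less_imp_less[of _ "\<delta> / 2"]) auto
    have "hnorm \<pi> (y (r N) - y (r (Suc N))) \<le> hnorm \<pi> (y (r N) - \<eta>) + hnorm \<pi> (\<eta> - y (r (Suc N)))"
      using hnorm_triangle[of "y (r N) - \<eta>" "\<eta> - y (r (Suc N))"] yX(2) \<eta>X by (simp add: carrier_simps)
    also have "\<dots> < \<delta>"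
      using small[of N] small[of "Suc N"] hnorm_diff_commute[of \<eta> "y (r (Suc N))"] yX(2) \<eta>X by simp
    finally have "hnorm \<pi> (y (r N) - y (r (Suc N))) < \<delta>" .
    moreover obtain a b where "a \<in> carrier G" "b \<in> carrier G" "y (r N) = act \<pi> a \<xi>" "y (r (Suc N)) = act \<pi> b \<xi>"
      using yY[of "r N"] yY[of "r (Suc N)"] by (auto simp: Y_def)
    ultimately have "y (r N) = y (r (Suc N))" using \<delta>(2) by simp
    then have "r N = r (Suc N)" using inj by (auto dest: injD)
    then show False using strict_mono_less[OF r, of N "Suc N"] by simp
  qed
  ultimately show thesis using that le by force
qed

text \<open>
  The squared norm of a vector is one of its coefficients, so only finitely many norms occur among
  the vectors with coefficients in a given finite set. A vector of least norm among them admits no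
  weak limit as above that is not orthogonal to it.
\<close>

lemma exists_minimal_vector:
  assumes Z: "invariant_subspace G \<pi> Z" and ne: "Z \<noteq> {0}"
  obtains \<xi> where "\<xi> \<in> Z" "\<xi> \<noteq> 0" "finite (coefficients \<xi>)"
    "\<And>g. \<lbrakk>g \<in> carrier G; hinner \<pi> (act \<pi> g \<xi>) \<xi> \<noteq> 0\<rbrakk> \<Longrightarrow> finite ((\<lambda>v. act \<pi> (v \<otimes>\<^bsub>G\<^esub> g) \<xi>) ` fixer \<xi>)"
proof -
  have Zc: "closed_subspace \<pi> Z" using Z by (auto simp: invariant_subspace_def)
  note Z' = closed_subspaceD[OF Zc]
  obtain x where "x \<in> Z" "x \<noteq> 0" using ne subspace_0[OF Z'(1)] by auto
  then obtain V z where V: "subgroup V G" "openin T V" and z: "z \<in> Z" "z \<noteq> 0" "\<And>v. v \<in> V \<Longrightarrow> act \<pi> v z = z"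
    using exists_open_fixed_vector[OF Z] by metis
  define F where "F = coefficients z"
  have fin: "finite F"
    unfolding F_def using finite_coefficients_if_open_fixer[OF V _ z(3)] z(1) Z'(2) by blast
  define N where "N = {hnorm \<pi> \<xi> |\<xi>. \<xi> \<in> Z \<and> \<xi> \<noteq> 0 \<and> coefficients \<xi> \<subseteq> F}"
  have "N \<subseteq> (\<lambda>c. sqrt (Re c)) ` F"
  proof
    fix n assume "n \<in> N"
    then obtain \<xi> where \<xi>: "n = hnorm \<pi> \<xi>" "\<xi> \<in> Z" "coefficients \<xi> \<subseteq> F" by (auto simp: N_def)
    then have "\<xi> \<in> hcarrier \<pi>" using Z'(2) by blast
    then have "hinner \<pi> \<xi> \<xi> \<in> coefficients \<xi>"
      unfolding coefficients_def using act_one by (intro image_eqI[of _ _ "\<one>\<^bsub>G\<^esub>"]) auto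
    then show "n \<in> (\<lambda>c. sqrt (Re c)) ` F" using \<xi> by (auto simp: hnorm_def)
  qed
  then have finN: "finite N" using fin finite_surj by blast
  have "hnorm \<pi> z \<in> N" using z by (auto simp: N_def F_def)
  then have "Min N \<in> N" using finN by (intro Min_in) auto
  then obtain \<xi> where \<xi>: "Min N = hnorm \<pi> \<xi>" "\<xi> \<in> Z" "\<xi> \<noteq> 0" "coefficients \<xi> \<subseteq> F"
    by (auto simp: N_def)
  have fin\<xi>: "finite (coefficients \<xi>)" using \<xi>(4) fin by (rule finite_subset)
  have \<xi>X: "\<xi> \<in> hcarrier \<pi>" using \<xi>(2) Z'(2) by blast
  have "finite ((\<lambda>v. act \<pi> (v \<otimes>\<^bsub>G\<^esub> g) \<xi>) ` fixer \<xi>)"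
    if g: "g \<in> carrier G" and c: "hinner \<pi> (act \<pi> g \<xi>) \<xi> \<noteq> 0" for g
  proof (rule ccontr)
    assume "\<not> finite ((\<lambda>v. act \<pi> (v \<otimes>\<^bsub>G\<^esub> g) \<xi>) ` fixer \<xi>)"
    then obtain y :: "nat \<Rightarrow> 'v" where y: "inj y" "range y \<subseteq> (\<lambda>v. act \<pi> (v \<otimes>\<^bsub>G\<^esub> g) \<xi>) ` fixer \<xi>"
      using infinite_countable_subset by blast
    have "hinner \<pi> (y n) \<xi> = hinner \<pi> (act \<pi> g \<xi>) \<xi>" for n
    proof -
      obtain v where v: "v \<in> fixer \<xi>" "y n = act \<pi> (v \<otimes>\<^bsub>G\<^esub> g) \<xi>" using y(2) by blast
      then have vG: "v \<in> carrier G" "inv\<^bsub>G\<^esub> v \<in> fixer \<xi>"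
        using subgroup.m_inv_closed[OF subgroup_fixer[OF \<xi>X]] by (auto simp: fixer_def)
      then show ?thesis
        using v g \<xi>X by (simp add: act_mult act_inner_left act_carrier fixer_def)
    qed
    moreover have "range y \<subseteq> (\<lambda>g. act \<pi> g \<xi>) ` carrier G"
      using y(2) g by (auto simp: fixer_def)
    ultimately obtain \<eta> where \<eta>: "\<eta> \<in> Z" "coefficients \<eta> \<subseteq> coefficients \<xi>" "hnorm \<pi> \<eta> < hnorm \<pi> \<xi>"
        "hinner \<pi> \<eta> \<xi> = hinner \<pi> (act \<pi> g \<xi>) \<xi>"
      using weak_limit_of_orbit[OF Z \<xi>(2) fin\<xi> _ y(1)] by metis
    have "\<eta> \<noteq> 0" using \<eta>(4) c \<xi>X by (auto simp: inner_zero_left)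
    then have "hnorm \<pi> \<eta> \<in> N" using \<eta>(1,2) \<xi>(4) by (auto simp: N_def)
    then show False using Min_le[OF finN, of "hnorm \<pi> \<eta>"] \<xi>(1) \<eta>(3) by simp
  qed
  then show thesis using that \<xi> fin\<xi> by blast
qed

text \<open>
  Let \<open>V\<close> be the stabilizer of a minimal vector \<open>\<xi>\<close> and \<open>H\<close> its commensurator. Finiteness of \<open>V g \<xi>\<close> says that
  \<open>V\<close> is almost contained in its conjugate by \<open>g\<close>; together with the same statement for the inverse of \<open>g\<close>
  this puts \<open>g\<close> into \<open>H\<close> whenever \<open>\<langle>g \<xi>, \<xi>\<rangle> \<noteq> 0\<close>. Inside the finite-dimensional span of \<open>H \<xi>\<close>, a nonzero
  \<open>H\<close>-invariant subspace spanned by as few vectors as possible is irreducible.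
\<close>

lemma exists_commensurator_block:
  assumes Z: "invariant_subspace G \<pi> Z" and ne: "Z \<noteq> {0}"
  shows "\<exists>H W. is_commensurator G T H \<and> W \<subseteq> Z \<and> imprimitivity_block G T \<pi> H W \<and>
    irreducible_rep (G\<lparr>carrier := H\<rparr>) (\<pi>\<lparr>hcarrier := W\<rparr>) \<and>
    G.almost_le H {h \<in> H. \<forall>x\<in>W. act \<pi> h x = x}"
proof -
  have Zc: "closed_subspace \<pi> Z" and Zi: "\<And>g z. \<lbrakk>g \<in> carrier G; z \<in> Z\<rbrakk> \<Longrightarrow> act \<pi> g z \<in> Z"
    using Z by (auto simp: invariant_subspace_def)
  note Z' = closed_subspaceD[OF Zc]
  obtain \<xi> where \<xi>: "\<xi> \<in> Z" "\<xi> \<noteq> 0" and fin: "finite (coefficients \<xi>)"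
    and min: "\<And>g. \<lbrakk>g \<in> carrier G; hinner \<pi> (act \<pi> g \<xi>) \<xi> \<noteq> 0\<rbrakk> \<Longrightarrow> finite ((\<lambda>v. act \<pi> (v \<otimes>\<^bsub>G\<^esub> g) \<xi>) ` fixer \<xi>)"
    using exists_minimal_vector[OF Z ne] by metis
  have \<xi>X: "\<xi> \<in> hcarrier \<pi>" using \<xi>(1) Z'(2) by blast
  define V where "V = fixer \<xi>"
  have V: "subgroup V G" "openin T V"
    unfolding V_def using subgroup_fixer[OF \<xi>X] openin_fixer[OF \<xi>X fin] by auto
  interpret V: subgroup V G by (rule V)
  define H where "H = Comm G V"
  have Hsub: "subgroup H G" unfolding H_def using V(1) by (rule G.subgroup_Comm)
  interpret H: subgroup H G by (rule Hsub)
  have VH: "V \<subseteq> H" unfolding H_def using V(1) by (rule G.subgroup_subset_Comm)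
  obtain F where F: "finite F" "F \<subseteq> carrier G" "carrier G = V <#>\<^bsub>G\<^esub> F <#>\<^bsub>G\<^esub> V"
    using G.finite_double_cosets[OF V] .
  have HV: "G.almost_le H V"
    unfolding H_def using V(1) F(1,2) equalityD1[OF F(3)] by (rule G.Comm_almost_le)
  have "is_commensurator G T H"
    unfolding is_commensurator_def
    using Hsub G.openin_overgroup[OF V(2,1) Hsub VH] G.Comm_Comm[OF V(1)] HV by (simp add: H_def)
  moreover
  have below: "G.almost_le V (G.conjugate g V)" if g: "g \<in> carrier G" and c: "hinner \<pi> (act \<pi> g \<xi>) \<xi> \<noteq> 0" for g
  proof (rule G.almost_le_if_finite_image)
    show "finite ((\<lambda>v. act \<pi> (v \<otimes>\<^bsub>G\<^esub> g) \<xi>) ` V)" unfolding V_def using g c by (rule min)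
    fix v w assume vw: "v \<in> V" "w \<in> V" "act \<pi> (v \<otimes>\<^bsub>G\<^esub> g) \<xi> = act \<pi> (w \<otimes>\<^bsub>G\<^esub> g) \<xi>"
    define k where "k = inv\<^bsub>G\<^esub> (v \<otimes>\<^bsub>G\<^esub> g) \<otimes>\<^bsub>G\<^esub> (w \<otimes>\<^bsub>G\<^esub> g)"
    have vG: "v \<in> carrier G" "w \<in> carrier G" using vw(1,2) by auto
    then have kG: "k \<in> carrier G" using g by (simp add: k_def)
    have "act \<pi> k \<xi> = act \<pi> (inv\<^bsub>G\<^esub> (v \<otimes>\<^bsub>G\<^esub> g)) (act \<pi> (w \<otimes>\<^bsub>G\<^esub> g) \<xi>)"
      unfolding k_def using vG g \<xi>X by (intro act_mult) auto
    also have "\<dots> = act \<pi> (inv\<^bsub>G\<^esub> (v \<otimes>\<^bsub>G\<^esub> g)) (act \<pi> (v \<otimes>\<^bsub>G\<^esub> g) \<xi>)" using vw(3) by simp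
    also have "\<dots> = \<xi>" using vG g \<xi>X by (intro act_inv_cancel) auto
    finally have kV: "k \<in> V" using kG unfolding V_def fixer_def by blast
    have "k = inv\<^bsub>G\<^esub> g \<otimes>\<^bsub>G\<^esub> (inv\<^bsub>G\<^esub> v \<otimes>\<^bsub>G\<^esub> w) \<otimes>\<^bsub>G\<^esub> g"
      unfolding k_def using vG g by (simp add: G.inv_mult_group G.m_assoc)
    then have "g \<otimes>\<^bsub>G\<^esub> k \<otimes>\<^bsub>G\<^esub> inv\<^bsub>G\<^esub> g = inv\<^bsub>G\<^esub> v \<otimes>\<^bsub>G\<^esub> w"
      using vG g by (simp add: G.m_assoc) (simp add: G.m_assoc[symmetric])
    then show "inv\<^bsub>G\<^esub> v \<otimes>\<^bsub>G\<^esub> w \<in> G.conjugate g V"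
      using G.conjugate_mem[OF kV, of g] by simp
  qed (rule V.subset)
  have orth0: "hinner \<pi> (act \<pi> g \<xi>) \<xi> = 0" if g: "g \<in> carrier G" "g \<notin> H" for g
  proof (rule ccontr)
    assume c: "hinner \<pi> (act \<pi> g \<xi>) \<xi> \<noteq> 0"
    have "hinner \<pi> (act \<pi> (inv\<^bsub>G\<^esub> g) \<xi>) \<xi> = cnj (hinner \<pi> (act \<pi> g \<xi>) \<xi>)"
      using g \<xi>X inner_commute[of \<xi> "act \<pi> g \<xi>"] by (simp add: act_inner_left act_carrier)
    then have "G.almost_le V (G.conjugate (inv\<^bsub>G\<^esub> g) V)" using c g by (intro below) auto
    from G.almost_le_conjugate[OF this _ g(1)]
    have "G.almost_le (G.conjugate g V) (G.conjugate g (G.conjugate (inv\<^bsub>G\<^esub> g) V))"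
      using g(1) G.conjugate_subset[OF V.subset G.inv_closed] by blast
    also have "G.conjugate g (G.conjugate (inv\<^bsub>G\<^esub> g) V) = V"
      using G.conjugate_conjugate[OF V.subset g(1), of "inv\<^bsub>G\<^esub> g"] G.conjugate_one[OF V.subset] g by simp
    finally have "g \<in> H"
      unfolding H_def using G.mem_Comm_iff[OF V(1)] below[OF g(1) c] g(1) by blast
    then show False using g by simp
  qed
  define Orb where "Orb = (\<lambda>h. act \<pi> h \<xi>) ` H"
  have OZ: "Orb \<subseteq> Z" using Zi \<xi>(1) by (auto simp: Orb_def)
  have OX: "Orb \<subseteq> hcarrier \<pi>" using OZ Z'(2) by blast
  have finO: "finite Orb"
  proof -
    obtain E where E: "finite E" "E \<subseteq> carrier G" "H \<subseteq> E <#>\<^bsub>G\<^esub> V" using HV by (auto simp: G.almost_le_def)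
    have "Orb \<subseteq> (\<lambda>e. act \<pi> e \<xi>) ` E"
    proof
      fix x assume "x \<in> Orb"
      then obtain h where h: "h \<in> H" "x = act \<pi> h \<xi>" by (auto simp: Orb_def)
      then obtain e v where "e \<in> E" "v \<in> V" "h = e \<otimes>\<^bsub>G\<^esub> v" using E(3) unfolding set_mult_def by blast
      moreover from this have "act \<pi> v \<xi> = \<xi>" unfolding V_def fixer_def by blast
      ultimately have "x = act \<pi> e \<xi>" using h(2) E(2) \<xi>X V.subset by (simp add: act_mult subset_iff)
      then show "x \<in> (\<lambda>e. act \<pi> e \<xi>) ` E" using \<open>e \<in> E\<close> by blast
    qed
    then show ?thesis using E(1) finite_surj by blast
  qed
  have OH: "act \<pi> h x \<in> Orb" if "h \<in> H" "x \<in> Orb" for h x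
    using that \<xi>X by (auto simp: Orb_def act_mult[symmetric])
  have \<xi>Orb: "\<xi> \<in> Orb" unfolding Orb_def using act_one[OF \<xi>X] by (intro image_eqI[of _ _ "\<one>\<^bsub>G\<^esub>"]) auto
  have act_span: "act \<pi> g x \<in> span B"
    if g: "g \<in> carrier G" and A: "A \<subseteq> hcarrier \<pi>" "act \<pi> g ` A \<subseteq> span B" and x: "x \<in> span A" for g A B x
  proof -
    have "x \<in> hcarrier \<pi> \<and> act \<pi> g x \<in> span B"
      using x
    proof (induction rule: span_induct_alt)
      case base then show ?case using g by (simp add: carrier_0 act_zero span_zero)
    next
      case (step c x y)
      moreover have "x \<in> hcarrier \<pi>" "act \<pi> g x \<in> span B" using A step(1) by auto
      ultimately show ?case using g by (simp add: act_add act_scale carrier_simps span_add span_scale)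
    qed
    then show ?thesis ..
  qed
  have orth_span: "hinner \<pi> (act \<pi> g x) y = 0"
    if g: "g \<in> carrier G" "g \<notin> H" and xy: "x \<in> span Orb" "y \<in> span Orb" for g x y
  proof -
    have OO: "hinner \<pi> (act \<pi> g a) b = 0" if ab: "a \<in> Orb" "b \<in> Orb" for a b
    proof -
      obtain h k where hk: "h \<in> H" "k \<in> H" "a = act \<pi> h \<xi>" "b = act \<pi> k \<xi>" using ab by (auto simp: Orb_def)
      have "inv\<^bsub>G\<^esub> k \<otimes>\<^bsub>G\<^esub> g \<otimes>\<^bsub>G\<^esub> h \<notin> H"
      proof
        assume "inv\<^bsub>G\<^esub> k \<otimes>\<^bsub>G\<^esub> g \<otimes>\<^bsub>G\<^esub> h \<in> H"
        then have "k \<otimes>\<^bsub>G\<^esub> (inv\<^bsub>G\<^esub> k \<otimes>\<^bsub>G\<^esub> g \<otimes>\<^bsub>G\<^esub> h) \<otimes>\<^bsub>G\<^esub> inv\<^bsub>G\<^esub> h \<in> H" using hk(1,2) by blast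
        moreover have "k \<otimes>\<^bsub>G\<^esub> (inv\<^bsub>G\<^esub> k \<otimes>\<^bsub>G\<^esub> g \<otimes>\<^bsub>G\<^esub> h) \<otimes>\<^bsub>G\<^esub> inv\<^bsub>G\<^esub> h = g"
          using hk(1,2) g(1) by (simp add: G.m_assoc) (simp add: G.m_assoc[symmetric])
        ultimately show False using g(2) by simp
      qed
      then have "hinner \<pi> (act \<pi> (inv\<^bsub>G\<^esub> k \<otimes>\<^bsub>G\<^esub> g \<otimes>\<^bsub>G\<^esub> h) \<xi>) \<xi> = 0"
        using hk(1,2) g(1) by (intro orth0) auto
      then show ?thesis
        using hk g(1) \<xi>X by (simp add: act_mult act_inner_left act_carrier)
    qed
    have 1: "span Orb \<subseteq> {y \<in> hcarrier \<pi>. \<forall>a\<in>act \<pi> g ` Orb. hinner \<pi> y a = 0}"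
    proof (rule span_minimal)
      have gO: "act \<pi> g ` Orb \<subseteq> hcarrier \<pi>" using OX g(1) by (auto simp: act_carrier)
      show "subspace {y \<in> hcarrier \<pi>. \<forall>a\<in>act \<pi> g ` Orb. hinner \<pi> y a = 0}"
        using closed_subspaceD(1)[OF closed_subspace_orth[OF gO]] .
      show "Orb \<subseteq> {y \<in> hcarrier \<pi>. \<forall>a\<in>act \<pi> g ` Orb. hinner \<pi> y a = 0}"
      proof
        fix b assume b: "b \<in> Orb"
        have "hinner \<pi> b (act \<pi> g a) = 0" if "a \<in> Orb" for a
          using OO[OF that b] inner_commute[of b "act \<pi> g a"] OX g(1) that b act_carrier[of g a] by auto
        then show "b \<in> {y \<in> hcarrier \<pi>. \<forall>a\<in>act \<pi> g ` Orb. hinner \<pi> y a = 0}" using b OX by auto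
      qed
    qed
    have yX: "y \<in> hcarrier \<pi>" using 1 xy by auto
    have "act \<pi> g x \<in> span (act \<pi> g ` Orb)"
      by (rule act_span[OF g(1) OX span_superset xy(1)])
    also have "span (act \<pi> g ` Orb) \<subseteq> {z \<in> hcarrier \<pi>. \<forall>b\<in>{y}. hinner \<pi> z b = 0}"
    proof (rule span_minimal)
      show "subspace {z \<in> hcarrier \<pi>. \<forall>b\<in>{y}. hinner \<pi> z b = 0}"
        using yX closed_subspaceD(1)[OF closed_subspace_orth[of "{y}"]] by simp
      show "act \<pi> g ` Orb \<subseteq> {z \<in> hcarrier \<pi>. \<forall>b\<in>{y}. hinner \<pi> z b = 0}"
      proof
        fix b assume b: "b \<in> act \<pi> g ` Orb"
        then have "hinner \<pi> y b = 0" "b \<in> hcarrier \<pi>" using 1 xy(2) OX g(1) act_carrier by auto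
        then show "b \<in> {z \<in> hcarrier \<pi>. \<forall>b\<in>{y}. hinner \<pi> z b = 0}"
          using inner_commute[of b y] yX by simp
      qed
    qed
    finally show ?thesis by simp
  qed
  define good where "good S \<longleftrightarrow> finite S \<and> S \<subseteq> span Orb \<and> span S \<noteq> {0} \<and> (\<forall>h\<in>H. \<forall>x\<in>span S. act \<pi> h x \<in> span S)" for S
  have "good Orb"
    unfolding good_def
  proof (intro conjI ballI)
    show "span Orb \<noteq> {0}" using span_base[OF \<xi>Orb] \<xi>(2) by blast
    fix h x assume hx: "h \<in> H" "x \<in> span Orb"
    show "act \<pi> h x \<in> span Orb"
    proof (rule act_span[OF _ OX _ hx(2)])
      show "act \<pi> h ` Orb \<subseteq> span Orb" using OH[OF hx(1)] span_base by blast
    qed (use hx(1) in simp)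
  qed (use finO span_superset in auto)
  then obtain S where S: "good S" and Smin: "\<And>B. good B \<Longrightarrow> card S \<le> card B"
    using ex_has_least_nat[of good Orb card] by auto
  define W where "W = span S"
  have WO: "W \<subseteq> span Orb" unfolding W_def using S by (auto simp: good_def span_minimal subspace_span)
  have SX: "S \<subseteq> hcarrier \<pi>" using S span_carrier[OF OX] by (auto simp: good_def)
  have WZ: "W \<subseteq> Z" using WO span_minimal[OF OZ Z'(1)] by blast
  have W: "closed_subspace \<pi> W" unfolding W_def using S SX by (auto simp: good_def intro: closed_subspace_span_finite)
  note W' = closed_subspaceD[OF W]
  have WH: "act \<pi> h x \<in> W" if "h \<in> H" "x \<in> W" for h x using that S by (auto simp: good_def W_def)
  have W0: "W \<noteq> {0}" using S by (auto simp: good_def W_def)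
  have irr: "irreducible_rep (G\<lparr>carrier := H\<rparr>) (\<pi>\<lparr>hcarrier := W\<rparr>)"
    unfolding irreducible_rep_def
  proof (intro conjI allI impI)
    show "hcarrier (\<pi>\<lparr>hcarrier := W\<rparr>) \<noteq> {0}" using W0 by simp
    fix L assume "invariant_subspace (G\<lparr>carrier := H\<rparr>) (\<pi>\<lparr>hcarrier := W\<rparr>) L"
    then have L: "closed_subspace \<pi> L" "L \<subseteq> W" and LH: "\<And>h x. \<lbrakk>h \<in> H; x \<in> L\<rbrakk> \<Longrightarrow> act \<pi> h x \<in> L"
      by (auto simp: invariant_subspace_def closed_subspace_restrict_iff[OF W])
    note L' = closed_subspaceD[OF L(1)]
    show "L = {0} \<or> L = hcarrier (\<pi>\<lparr>hcarrier := W\<rparr>)"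
    proof (rule ccontr)
      assume "\<not> (L = {0} \<or> L = hcarrier (\<pi>\<lparr>hcarrier := W\<rparr>))"
      then obtain x where L0: "L \<noteq> {0}" and x: "x \<in> W" "x \<notin> L" using L(2) by auto
      obtain B where B: "B \<subseteq> L" "independent B" "L \<subseteq> span B" using maximal_independent_subset .
      have LB: "span B = L" using B span_minimal[OF B(1) L'(1)] by blast
      have "independent (insert x B)" using B(2) x(2) LB by (intro independent_insertI) simp_all
      then have bound: "finite (insert x B) \<and> card (insert x B) \<le> card S"
        using S x(1) B(1) L(2) by (intro independent_span_bound) (auto simp: good_def W_def)
      have "good B"
        unfolding good_def using bound B(1) L(2) WO LB L0 LH by auto
      then have "card S \<le> card B" by (rule Smin)
      moreover have "x \<notin> B" using x(2) B(1) by blast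
      ultimately show False using bound by (auto simp: card_insert_if)
    qed
  qed
  have "G.almost_le H {h \<in> H. \<forall>x\<in>W. act \<pi> h x = x}"
  proof (rule G.almost_le_if_finite_image)
    have "(\<lambda>h. restrict (act \<pi> h) Orb) ` H \<subseteq> Orb \<rightarrow>\<^sub>E Orb" using OH by auto
    moreover have "finite (Orb \<rightarrow>\<^sub>E Orb)" using finO by (intro finite_PiE) auto
    ultimately show "finite ((\<lambda>h. restrict (act \<pi> h) Orb) ` H)" by (rule finite_subset)
    fix h k assume hk: "h \<in> H" "k \<in> H" "restrict (act \<pi> h) Orb = restrict (act \<pi> k) Orb"
    let ?g = "inv\<^bsub>G\<^esub> h \<otimes>\<^bsub>G\<^esub> k"
    have gH: "?g \<in> H" using hk by auto
    have "act \<pi> ?g x = x" if "x \<in> Orb" for x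
    proof -
      have "act \<pi> h x = act \<pi> k x" using hk(3) that by (metis restrict_apply')
      then show ?thesis using hk(1,2) that OX act_inv_cancel(1)[of h x] by (auto simp: act_mult)
    qed
    have "x \<in> hcarrier \<pi> \<and> act \<pi> ?g x = x" if "x \<in> span Orb" for x
      using that
    proof (induction rule: span_induct_alt)
      case base then show ?case using gH by (simp add: carrier_0 act_zero)
    next
      case (step c x y)
      moreover have "x \<in> hcarrier \<pi>" "act \<pi> ?g x = x"
        using OX step(1) \<open>\<And>x. x \<in> Orb \<Longrightarrow> act \<pi> ?g x = x\<close> by auto
      moreover have "?g \<in> carrier G" using gH by simp
      ultimately show ?case by (simp add: act_add act_scale carrier_simps)
    qed
    then show "?g \<in> {h \<in> H. \<forall>x\<in>W. act \<pi> h x = x}" using gH WO by auto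
  qed (rule H.subset)
  moreover have "imprimitivity_block G T \<pi> H W"
    by unfold_locales (use Hsub W WH orth_span WO in blast)+
  ultimately show ?thesis using WZ irr by blast
qed

end

section \<open>Irreducibility and decomposition\<close>

context imprimitivity_block
begin

lemma subgroup_kernel: "subgroup {h \<in> H. \<forall>x\<in>W. act \<pi> h x = x} G"
proof (rule G.subgroupI)
  show "{h \<in> H. \<forall>x\<in>W. act \<pi> h x = x} \<subseteq> carrier G" using HG by auto
  show "{h \<in> H. \<forall>x\<in>W. act \<pi> h x = x} \<noteq> {}"
    using act_one WX subgroup.one_closed[OF H] by blast
  fix a assume a: "a \<in> {h \<in> H. \<forall>x\<in>W. act \<pi> h x = x}"
  have "act \<pi> (inv\<^bsub>G\<^esub> a) x = x" if "x \<in> W" for x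
    using act_inv_cancel(1)[of a x] a HG WX that by auto
  then show "inv\<^bsub>G\<^esub> a \<in> {h \<in> H. \<forall>x\<in>W. act \<pi> h x = x}"
    using a subgroup.m_inv_closed[OF H] by auto
  fix b assume "b \<in> {h \<in> H. \<forall>x\<in>W. act \<pi> h x = x}"
  then show "a \<otimes>\<^bsub>G\<^esub> b \<in> {h \<in> H. \<forall>x\<in>W. act \<pi> h x = x}"
    using a subgroup.m_closed[OF H] by (auto simp: act_mult HG WX)
qed

text \<open>
  If the orbit of the coset \<open>g H\<close> under \<open>N\<close> were infinite, then the vectors \<open>n g w\<close> for \<open>n\<close> in a suitable
  sequence would be pairwise orthogonal, while all of them have the same inner product with the
  \<open>N\<close>-fixed vector \<open>y\<close>.
\<close>

lemma almost_le_if_inner_nonzero: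
  assumes N: "subgroup N G" and y: "y \<in> hcarrier \<pi>" "\<And>n. n \<in> N \<Longrightarrow> act \<pi> n y = y"
    and g: "g \<in> carrier G" and w: "w \<in> W" and ne: "hinner \<pi> y (act \<pi> g w) \<noteq> 0"
  shows "G.almost_le N (G.conjugate g H)"
proof (rule G.almost_le_if_finite_image[where f = "\<lambda>n. (n \<otimes>\<^bsub>G\<^esub> g) <#\<^bsub>G\<^esub> H"])
  interpret N: subgroup N G by (rule N)
  show "N \<subseteq> carrier G" by (rule N.subset)
  fix n k assume nk: "n \<in> N" "k \<in> N" "(n \<otimes>\<^bsub>G\<^esub> g) <#\<^bsub>G\<^esub> H = (k \<otimes>\<^bsub>G\<^esub> g) <#\<^bsub>G\<^esub> H"
  have "k \<otimes>\<^bsub>G\<^esub> g \<in> (n \<otimes>\<^bsub>G\<^esub> g) <#\<^bsub>G\<^esub> H"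
    unfolding nk(3) using nk(2) g by (intro G.lcos_self H) auto
  then obtain h where h: "h \<in> H" "k \<otimes>\<^bsub>G\<^esub> g = n \<otimes>\<^bsub>G\<^esub> g \<otimes>\<^bsub>G\<^esub> h" by (auto simp: l_coset_def)
  have m: "n \<in> carrier G" "k \<in> carrier G" "h \<in> carrier G" using nk h HG by auto
  have "inv\<^bsub>G\<^esub> n \<otimes>\<^bsub>G\<^esub> k = inv\<^bsub>G\<^esub> n \<otimes>\<^bsub>G\<^esub> (k \<otimes>\<^bsub>G\<^esub> g) \<otimes>\<^bsub>G\<^esub> inv\<^bsub>G\<^esub> g"
    using m g by (simp add: G.m_assoc)
  also have "\<dots> = g \<otimes>\<^bsub>G\<^esub> h \<otimes>\<^bsub>G\<^esub> inv\<^bsub>G\<^esub> g"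
    unfolding h(2) using m g by (simp add: G.m_assoc) (simp add: G.m_assoc[symmetric])
  finally show "inv\<^bsub>G\<^esub> n \<otimes>\<^bsub>G\<^esub> k \<in> G.conjugate g H" using G.conjugate_mem[OF h(1)] by simp
next
  interpret N: subgroup N G by (rule N)
  let ?f = "\<lambda>n. (n \<otimes>\<^bsub>G\<^esub> g) <#\<^bsub>G\<^esub> H"
  show "finite (?f ` N)"
  proof (rule ccontr)
    assume "\<not> finite (?f ` N)"
    then obtain s :: "nat \<Rightarrow> 'g set" where s: "inj s" "range s \<subseteq> ?f ` N"
      using infinite_countable_subset by blast
    then have "\<forall>i. \<exists>n\<in>N. s i = ?f n" by auto
    then obtain n where n: "\<And>i. n i \<in> N" "\<And>i. s i = ?f (n i)" by metis
    have nG: "n i \<otimes>\<^bsub>G\<^esub> g \<in> carrier G" "n i \<in> carrier G" "inv\<^bsub>G\<^esub> (n i) \<in> N" for i using n(1)[of i] g by auto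
    have wX: "w \<in> hcarrier \<pi>" using w by (rule WX)
    have "hinner \<pi> y (act \<pi> g w) = 0"
    proof (rule constant_inner_orthogonal_family[where u = "\<lambda>i. act \<pi> (n i \<otimes>\<^bsub>G\<^esub> g) w" and y = y and r = "hnorm \<pi> w"])
      show "act \<pi> (n i \<otimes>\<^bsub>G\<^esub> g) w \<in> hcarrier \<pi>" for i using nG(1) wX by (rule act_carrier)
      show "hnorm \<pi> (act \<pi> (n i \<otimes>\<^bsub>G\<^esub> g) w) \<le> hnorm \<pi> w" for i using nG(1) wX by (simp add: act_hnorm)
      fix i
      have "hinner \<pi> (act \<pi> (inv\<^bsub>G\<^esub> (n i)) y) (act \<pi> g w) = hinner \<pi> y (act \<pi> (n i) (act \<pi> g w))"
        using act_inner_left[of "inv\<^bsub>G\<^esub> (n i)" y "act \<pi> g w"] nG y(1) g wX by (simp add: act_carrier)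
      then show "hinner \<pi> y (act \<pi> (n i \<otimes>\<^bsub>G\<^esub> g) w) = hinner \<pi> y (act \<pi> g w)"
        using y(2)[OF nG(3)] nG(2) g wX by (simp add: act_mult)
    next
      fix i j :: nat assume ij: "i \<noteq> j"
      have "inv\<^bsub>G\<^esub> (n j \<otimes>\<^bsub>G\<^esub> g) \<otimes>\<^bsub>G\<^esub> (n i \<otimes>\<^bsub>G\<^esub> g) \<notin> H"
      proof
        assume h: "inv\<^bsub>G\<^esub> (n j \<otimes>\<^bsub>G\<^esub> g) \<otimes>\<^bsub>G\<^esub> (n i \<otimes>\<^bsub>G\<^esub> g) \<in> H"
        have "n i \<otimes>\<^bsub>G\<^esub> g = (n j \<otimes>\<^bsub>G\<^esub> g) \<otimes>\<^bsub>G\<^esub> (inv\<^bsub>G\<^esub> (n j \<otimes>\<^bsub>G\<^esub> g) \<otimes>\<^bsub>G\<^esub> (n i \<otimes>\<^bsub>G\<^esub> g))"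
          using nG(1)[of i] nG(1)[of j] by (metis G.inv_closed G.m_assoc G.l_one G.r_inv)
        then have "n i \<otimes>\<^bsub>G\<^esub> g \<in> (n j \<otimes>\<^bsub>G\<^esub> g) <#\<^bsub>G\<^esub> H" using h unfolding l_coset_def by blast
        then have "?f (n j) = ?f (n i)" using nG(1)[of j] H by (rule G.l_repr_independence)
        then show False using n(2) s(1) ij by (metis injD)
      qed
      then show "hinner \<pi> (act \<pi> (n i \<otimes>\<^bsub>G\<^esub> g) w) (act \<pi> (n j \<otimes>\<^bsub>G\<^esub> g) w) = 0"
        using nG(1) w by (intro orth_translates)
    qed (use y in auto)
    then show False using ne by simp
  qed
qed

text \<open>
  Let \<open>P\<close> be the projection onto an invariant subspace \<open>L\<close>. It commutes with \<open>G\<close>, so \<open>P x\<close> is fixed by the kernel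
  of the action on \<open>W\<close> for every \<open>x \<in> W\<close>. If \<open>P x\<close> is not orthogonal to \<open>g W\<close>, then \<open>H\<close> is almost contained in
  its conjugate by \<open>g\<close>, and since \<open>P\<close> is selfadjoint also in the one by the inverse of \<open>g\<close>; hence \<open>g \<in> H\<close>. So \<open>P\<close>
  maps \<open>W\<close> to itself, and irreducibility of \<open>W\<close> leaves only the two trivial possibilities for \<open>L\<close>.
\<close>

lemma irreducible_envelope:
  assumes comm: "Comm G H = H" and fin: "G.almost_le H {h \<in> H. \<forall>x\<in>W. act \<pi> h x = x}"
    and irr: "irreducible_rep (G\<lparr>carrier := H\<rparr>) (\<pi>\<lparr>hcarrier := W\<rparr>)"
  shows "irreducible_rep G (\<pi>\<lparr>hcarrier := envelope\<rparr>)"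
  unfolding irreducible_rep_def
proof (intro conjI allI impI)
  have W0: "W \<noteq> {0}" using irr by (simp add: irreducible_rep_def)
  then show "hcarrier (\<pi>\<lparr>hcarrier := envelope\<rparr>) \<noteq> {0}"
    using W_envelope subspace_0[OF closed_subspaceD(1)[OF W]] by auto
  fix L assume "invariant_subspace G (\<pi>\<lparr>hcarrier := envelope\<rparr>) L"
  then have L: "closed_subspace \<pi> L" and LE: "L \<subseteq> envelope" and LG: "\<And>g x. \<lbrakk>g \<in> carrier G; x \<in> L\<rbrakk> \<Longrightarrow> act \<pi> g x \<in> L"
    by (auto simp: invariant_subspace_def closed_subspace_restrict_iff[OF closed_envelope])
  note L' = closed_subspaceD[OF L]
  define N where "N = {h \<in> H. \<forall>x\<in>W. act \<pi> h x = x}"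
  have N: "subgroup N G" unfolding N_def by (rule subgroup_kernel)
  have P_act: "proj L (act \<pi> g x) = act \<pi> g (proj L x)" if "g \<in> carrier G" "x \<in> hcarrier \<pi>" for g x
    using that by (intro proj_equivariant[OF L] LG) auto
  have PX: "proj L x \<in> hcarrier \<pi>" if "x \<in> W" for x using proj_carrier[OF L WX[OF that]] .
  have below: "G.almost_le H (G.conjugate g H)"
    if g: "g \<in> carrier G" and m: "x \<in> W" "y \<in> W" and ne: "hinner \<pi> (proj L x) (act \<pi> g y) \<noteq> 0" for g x y
  proof (rule G.almost_le_trans)
    show "G.almost_le H N" using fin by (simp add: N_def)
    show "G.almost_le N (G.conjugate g H)"
    proof (rule almost_le_if_inner_nonzero[OF N PX[OF m(1)] _ g m(2) ne])
      fix n assume "n \<in> N"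
      then show "act \<pi> n (proj L x) = proj L x"
        using P_act[of n x] m(1) HG WX by (auto simp: N_def)
    qed
    show "G.conjugate g H \<subseteq> carrier G" using subgroup.subset[OF H] g by (rule G.conjugate_subset)
  qed
  have off: "hinner \<pi> (proj L x) (act \<pi> g y) = 0"
    if g: "g \<in> carrier G" "g \<notin> H" and m: "x \<in> W" "y \<in> W" for g x y
  proof (rule ccontr)
    assume ne: "hinner \<pi> (proj L x) (act \<pi> g y) \<noteq> 0"
    have X: "x \<in> hcarrier \<pi>" "y \<in> hcarrier \<pi>" "act \<pi> g y \<in> hcarrier \<pi>" "proj L y \<in> hcarrier \<pi>"
        "act \<pi> (inv\<^bsub>G\<^esub> g) x \<in> hcarrier \<pi>"
      using m g(1) WX PX by (auto simp: act_carrier)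
    have "hinner \<pi> (proj L x) (act \<pi> g y) = hinner \<pi> x (act \<pi> g (proj L y))"
      using proj_selfadjoint[OF L X(1,3)] P_act[OF g(1) X(2)] by simp
    also have "\<dots> = hinner \<pi> (act \<pi> (inv\<^bsub>G\<^esub> g) x) (proj L y)"
      using act_inner_left[of "inv\<^bsub>G\<^esub> g" x "proj L y"] g(1) X by simp
    finally have "hinner \<pi> (proj L y) (act \<pi> (inv\<^bsub>G\<^esub> g) x) \<noteq> 0"
      using ne inner_commute[OF X(5,4)] by simp
    then have "G.almost_le H (G.conjugate (inv\<^bsub>G\<^esub> g) H)" using g(1) m by (intro below) auto
    note sub = subgroup.subset[OF H]
    from G.almost_le_conjugate[OF \<open>G.almost_le H (G.conjugate (inv\<^bsub>G\<^esub> g) H)\<close> _ g(1)]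
    have "G.almost_le (G.conjugate g H) (G.conjugate g (G.conjugate (inv\<^bsub>G\<^esub> g) H))"
      using g(1) G.conjugate_subset[OF sub G.inv_closed] by blast
    also have "G.conjugate g (G.conjugate (inv\<^bsub>G\<^esub> g) H) = H"
      using G.conjugate_conjugate[OF sub g(1), of "inv\<^bsub>G\<^esub> g"] G.conjugate_one[OF sub] g by simp
    finally have "g \<in> Comm G H" using G.mem_Comm_iff[OF H] below[OF g(1) m ne] g(1) by blast
    then show False using comm g(2) by simp
  qed
  have PW: "proj L x \<in> W" if x: "x \<in> W" for x
  proof -
    have pE: "proj L x \<in> envelope" using proj_in[OF L WX[OF x]] LE by blast
    define p where "p = proj W (proj L x)"
    have p: "p \<in> W" unfolding p_def by (rule proj_in[OF W PX[OF x]])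
    define d where "d = proj L x - p"
    have dE: "d \<in> envelope"
      unfolding d_def using pE p W_envelope closed_subspaceD(1)[OF closed_envelope] by (blast intro: subspace_diff)
    have "hinner \<pi> d z = 0" if z: "z \<in> translates" for z
    proof -
      obtain g y where gy: "g \<in> carrier G" "y \<in> W" "z = act \<pi> g y" using z by (auto simp: translates_def)
      show ?thesis
      proof (cases "g \<in> H")
        case True
        then show ?thesis using proj_orth[OF W PX[OF x]] WH gy by (simp add: d_def p_def)
      next
        case False
        have "hinner \<pi> p (act \<pi> g y) = 0"
          using orth_translates[of "\<one>\<^bsub>G\<^esub>" g p y] gy(1,2) False p WX act_one[OF WX[OF p]]
            subgroup.m_inv_closed[OF H, of "inv\<^bsub>G\<^esub> g"] by auto
        then show ?thesis
          using off[OF gy(1) False x gy(2)] PX[OF x] WX p gy by (simp add: d_def inner_diff_left act_carrier)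
      qed
    qed
    then have "hinner \<pi> d d = 0"
      using orth_cspan(1)[OF translates_carrier envelope_carrier[OF dE], of d] dE by (simp add: envelope_def)
    then have "d = 0" using eq_0_if_orth_self[OF envelope_carrier[OF dE]] by simp
    then show ?thesis using p by (simp add: d_def)
  qed
  have "invariant_subspace (G\<lparr>carrier := H\<rparr>) (\<pi>\<lparr>hcarrier := W\<rparr>) (L \<inter> W)"
  proof -
    have "closed_subspace \<pi> (L \<inter> W)"
      using L W by (auto simp: closed_subspace_def intro: subspace_inter)
    then show ?thesis
      using LG WH HG by (auto simp: invariant_subspace_def closed_subspace_restrict_iff[OF W])
  qed
  then have "L \<inter> W = {0} \<or> L \<inter> W = W" using irr by (auto simp: irreducible_rep_def)
  then show "L = {0} \<or> L = hcarrier (\<pi>\<lparr>hcarrier := envelope\<rparr>)"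
  proof
    assume "L \<inter> W = W"
    then have "translates \<subseteq> L" using LG by (auto simp: translates_def)
    then have "envelope \<subseteq> L" unfolding envelope_def using L by (intro cspan_minimal)
    then show ?thesis using LE by auto
  next
    assume LW: "L \<inter> W = {0}"
    have P0: "proj L x = 0" if "x \<in> W" for x using PW[OF that] proj_in[OF L WX[OF that]] LW by blast
    have "l = 0" if l: "l \<in> L" for l
    proof -
      have lX: "l \<in> hcarrier \<pi>" using l L'(2) by blast
      have "hinner \<pi> l z = 0" if z: "z \<in> translates" for z
      proof -
        obtain g y where gy: "g \<in> carrier G" "y \<in> W" "z = act \<pi> g y" using z by (auto simp: translates_def)
        have gl: "act \<pi> (inv\<^bsub>G\<^esub> g) l \<in> L" using LG l gy(1) by simp
        have "hinner \<pi> l z = hinner \<pi> (act \<pi> (inv\<^bsub>G\<^esub> g) l) y"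
          using act_inner_left[of "inv\<^bsub>G\<^esub> g" l y] gy lX WX by simp
        also have "\<dots> = hinner \<pi> (act \<pi> (inv\<^bsub>G\<^esub> g) l) (proj L y)"
          using proj_inner_right[OF L WX[OF gy(2)] gl] by simp
        also have "\<dots> = 0" using P0[OF gy(2)] gl L'(2) by (auto simp: inner_zero_right)
        finally show ?thesis .
      qed
      then have "hinner \<pi> l l = 0"
        using orth_cspan(1)[OF translates_carrier lX, of l] l LE by (auto simp: envelope_def)
      then show "l = 0" using eq_0_if_orth_self[OF lX] by simp
    qed
    then have "L = {0}" using subspace_0[OF L'(1)] by auto
    then show ?thesis ..
  qed
qed

lemma factors_through_kernel:
  assumes fin: "G.almost_le H {h \<in> H. \<forall>x\<in>W. act \<pi> h x = x}"
  shows "factors_through_finite_quotient (G\<lparr>carrier := H\<rparr>) (\<pi>\<lparr>hcarrier := W\<rparr>)"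
proof -
  define N where "N = {h \<in> H. \<forall>x\<in>W. act \<pi> h x = x}"
  have N: "subgroup N G" unfolding N_def by (rule subgroup_kernel)
  have NH: "N \<subseteq> H" by (auto simp: N_def)
  interpret HG: group "G\<lparr>carrier := H\<rparr>" using H G.group_axioms by (rule subgroup.subgroup_is_group)
  have "N \<lhd> G\<lparr>carrier := H\<rparr>"
    unfolding HG.normal_inv_iff
  proof (intro conjI ballI)
    show "subgroup N (G\<lparr>carrier := H\<rparr>)" using N H NH by (rule G.subgroup_incl)
    fix h n assume "h \<in> carrier (G\<lparr>carrier := H\<rparr>)" and n: "n \<in> N"
    then have h: "h \<in> H" by simp
    have hi: "inv\<^bsub>G\<lparr>carrier := H\<rparr>\<^esub> h = inv\<^bsub>G\<^esub> h" using H h by (rule G.m_inv_consistent)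
    have nH: "n \<in> H" using n NH by blast
    have hiH: "inv\<^bsub>G\<^esub> h \<in> H" using H h by (rule subgroup.m_inv_closed)
    have "act \<pi> (h \<otimes>\<^bsub>G\<^esub> n \<otimes>\<^bsub>G\<^esub> inv\<^bsub>G\<^esub> h) x = x" if x: "x \<in> W" for x
    proof -
      have ix: "act \<pi> (inv\<^bsub>G\<^esub> h) x \<in> W" using hiH x by (rule WH)
      have "act \<pi> (h \<otimes>\<^bsub>G\<^esub> n \<otimes>\<^bsub>G\<^esub> inv\<^bsub>G\<^esub> h) x = act \<pi> h (act \<pi> n (act \<pi> (inv\<^bsub>G\<^esub> h) x))"
        using h nH HG x WX by (simp add: act_mult act_carrier)
      also have "\<dots> = act \<pi> h (act \<pi> (inv\<^bsub>G\<^esub> h) x)" using n ix by (simp add: N_def)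
      also have "\<dots> = x" using h HG x WX by (simp add: act_inv_cancel)
      finally show ?thesis .
    qed
    then have "h \<otimes>\<^bsub>G\<^esub> n \<otimes>\<^bsub>G\<^esub> inv\<^bsub>G\<^esub> h \<in> N"
      unfolding N_def using h nH hiH subgroup.m_closed[OF H] by blast
    then show "h \<otimes>\<^bsub>G\<lparr>carrier := H\<rparr>\<^esub> n \<otimes>\<^bsub>G\<lparr>carrier := H\<rparr>\<^esub> inv\<^bsub>G\<lparr>carrier := H\<rparr>\<^esub> h \<in> N"
      by (simp add: hi)
  qed
  moreover have "finite (carrier (G\<lparr>carrier := H\<rparr> Mod N))"
    using G.finite_rcosets_iff_almost_le[OF H N] fin NH
    by (simp add: FactGroup_def Int_absorb1 flip: N_def)
  moreover have "act \<pi> h x = act \<pi> (SOME c. c \<in> N #>\<^bsub>G\<lparr>carrier := H\<rparr>\<^esub> h) x" if h: "h \<in> H" and x: "x \<in> W" for h x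
  proof -
    have c: "N #>\<^bsub>G\<lparr>carrier := H\<rparr>\<^esub> h = N #>\<^bsub>G\<^esub> h" by (simp add: r_coset_def)
    have "h \<in> N #>\<^bsub>G\<^esub> h" using HG[OF h] N by (rule G.rcos_self)
    then have "(SOME c. c \<in> N #>\<^bsub>G\<^esub> h) \<in> N #>\<^bsub>G\<^esub> h" by (rule someI)
    then obtain n where n: "n \<in> N" "(SOME c. c \<in> N #>\<^bsub>G\<^esub> h) = n \<otimes>\<^bsub>G\<^esub> h" by (auto simp: r_coset_def)
    have nG: "n \<in> carrier G" "h \<in> carrier G" "x \<in> hcarrier \<pi>" using n NH h x HG WX by auto
    have "act \<pi> n (act \<pi> h x) = act \<pi> h x" using n(1) WH[OF h x] by (auto simp: N_def)
    then show ?thesis unfolding c n(2) using nG by (simp add: act_mult)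
  qed
  ultimately show ?thesis
    unfolding factors_through_finite_quotient_def
    by (intro exI[of _ N] exI[of _ "\<lambda>C x. act \<pi> (SOME c. c \<in> C) x"]) simp
qed

end

text \<open>
  The structure \<open>\<tau>\<close> is only assumed to be a vector space: the axioms of an inner product, and with
  them the metric that defines closed subspaces of \<open>\<tau>\<close>, are transported along the equivalence.
\<close>

lemma irreducible_rep_equivalent:
  fixes \<rho> :: "('g, 'v::ab_group_add) urep" and \<tau> :: "('g, 'w::ab_group_add) urep"
  assumes "complex_inner_space \<rho>" and vs: "vector_space (hscale \<tau>)"
    and inv: "\<And>g x. \<lbrakk>g \<in> carrier G; x \<in> hcarrier \<rho>\<rbrakk> \<Longrightarrow> act \<rho> g x \<in> hcarrier \<rho>"
    and eq: "unitarily_equivalent G \<rho> \<tau>" and irr: "irreducible_rep G \<rho>"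
  shows "irreducible_rep G \<tau>"
proof -
  interpret A: complex_inner_space \<rho> by fact
  interpret V: vector_space "hscale \<tau>" by fact
  obtain \<Phi> where bij: "bij_betw \<Phi> (hcarrier \<rho>) (hcarrier \<tau>)"
    and add: "\<And>x y. \<lbrakk>x \<in> hcarrier \<rho>; y \<in> hcarrier \<rho>\<rbrakk> \<Longrightarrow> \<Phi> (x + y) = \<Phi> x + \<Phi> y"
    and scale: "\<And>c x. x \<in> hcarrier \<rho> \<Longrightarrow> \<Phi> (hscale \<rho> c x) = hscale \<tau> c (\<Phi> x)"
    and inner: "\<And>x y. \<lbrakk>x \<in> hcarrier \<rho>; y \<in> hcarrier \<rho>\<rbrakk> \<Longrightarrow> hinner \<tau> (\<Phi> x) (\<Phi> y) = hinner \<rho> x y"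
    and act: "\<And>g x. \<lbrakk>g \<in> carrier G; x \<in> hcarrier \<rho>\<rbrakk> \<Longrightarrow> \<Phi> (act \<rho> g x) = act \<tau> g (\<Phi> x)"
    using eq unfolding unitarily_equivalent_def by blast
  have img: "hcarrier \<tau> = \<Phi> ` hcarrier \<rho>" using bij by (simp add: bij_betw_def)
  have zero: "\<Phi> 0 = 0" using scale[of 0 0] A.carrier_0 by simp
  have diff: "\<Phi> (x - y) = \<Phi> x - \<Phi> y" if "x \<in> hcarrier \<rho>" "y \<in> hcarrier \<rho>" for x y
    using add[of "x - y" y] that by (simp add: A.carrier_simps)
  interpret B: complex_inner_space \<tau>
  proof
    show "V.subspace (hcarrier \<tau>)"
      unfolding V.subspace_def img
      by (auto simp: A.carrier_simps add[symmetric] scale[symmetric] intro!: image_eqI[of 0 \<Phi> 0] zero[symmetric])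
  next
    fix x y z assume "x \<in> hcarrier \<tau>" "y \<in> hcarrier \<tau>" "z \<in> hcarrier \<tau>"
    then show "hinner \<tau> (x + y) z = hinner \<tau> x z + hinner \<tau> y z"
      unfolding img by (auto simp: add[symmetric] inner A.carrier_simps A.inner_add)
  next
    fix c x y assume "x \<in> hcarrier \<tau>" "y \<in> hcarrier \<tau>"
    then show "hinner \<tau> (hscale \<tau> c x) y = c * hinner \<tau> x y"
      unfolding img by (auto simp: scale[symmetric] inner A.carrier_simps A.inner_scale)
  next
    fix x y assume "x \<in> hcarrier \<tau>" "y \<in> hcarrier \<tau>"
    then show "hinner \<tau> x y = cnj (hinner \<tau> y x)"
      unfolding img by (auto simp: inner intro: A.inner_commute)
  next
    fix x assume "x \<in> hcarrier \<tau>" "x \<noteq> 0"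
    then show "0 < Re (hinner \<tau> x x)"
      unfolding img using zero by (auto simp: inner intro: A.inner_pos)
  qed
  have hlim: "B.hlim (\<lambda>n. \<Phi> (u n)) (\<Phi> l)" if l: "A.hlim u l" for u l
  proof -
    have "hnorm \<tau> (\<Phi> (u n) - \<Phi> l) = hnorm \<rho> (u n - l)" for n
      using A.hlim_carrier[OF l] by (simp add: hnorm_def diff[symmetric] inner A.carrier_simps)
    then show ?thesis using l A.hlim_carrier[OF l] by (auto simp: A.hlim_def B.hlim_def img)
  qed
  show ?thesis
    unfolding irreducible_rep_def
  proof (intro conjI allI impI)
    show "hcarrier \<tau> \<noteq> {0}"
    proof
      assume "hcarrier \<tau> = {0}"
      then have "\<forall>x\<in>hcarrier \<rho>. \<Phi> x = \<Phi> 0" using img zero by auto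
      then have "hcarrier \<rho> = {0}" using bij A.carrier_0 unfolding bij_betw_def inj_on_def by blast
      then show False using irr by (simp add: irreducible_rep_def)
    qed
    fix W assume W: "invariant_subspace G \<tau> W"
    then have Wc: "closed_subspace \<tau> W" and WG: "\<And>g x. \<lbrakk>g \<in> carrier G; x \<in> W\<rbrakk> \<Longrightarrow> act \<tau> g x \<in> W"
      by (auto simp: invariant_subspace_def)
    note W' = B.closed_subspaceD[OF Wc]
    define L where "L = {x \<in> hcarrier \<rho>. \<Phi> x \<in> W}"
    have WL: "W = \<Phi> ` L" using W'(2) img by (auto simp: L_def)
    have "closed_subspace \<rho> L"
    proof (rule A.closed_subspaceI)
      show "A.subspace L"
        using W'(1) by (auto simp: L_def A.subspace_def V.subspace_def A.carrier_simps zero add scale)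
      fix u l assume u: "\<And>n. u n \<in> L" and l: "A.hlim u l"
      have "\<Phi> l \<in> W" using W'(3)[OF _ hlim[OF l]] u by (simp add: L_def)
      then show "l \<in> L" using A.hlim_carrier[OF l] by (simp add: L_def)
    qed (auto simp: L_def)
    then have "invariant_subspace G \<rho> L"
      using WG inv by (auto simp: invariant_subspace_def L_def act)
    then have "L = {0} \<or> L = hcarrier \<rho>" using irr by (simp add: irreducible_rep_def)
    then show "W = {0} \<or> W = hcarrier \<tau>" using WL img zero by auto
  qed
qed

lemma vector_space_Ind:
  assumes "vector_space (hscale \<sigma>)" shows "vector_space (hscale (Ind G H \<sigma>))"
proof -
  interpret vector_space "hscale \<sigma>" by fact
  show ?thesis
    by unfold_locales
      (simp_all add: Ind_def Ind_along_def fun_eq_iff scale_right_distrib scale_left_distrib)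
qed

definition commensurator_induced :: "('g, 'm) monoid_scheme \<Rightarrow> 'g topology \<Rightarrow> ('g, 'v::ab_group_add) urep \<Rightarrow> bool"
  where "commensurator_induced G T \<pi> \<longleftrightarrow> (\<exists>H (\<sigma> :: ('g, 'v) urep).
    is_commensurator G T H \<and>
    unitary_rep (G\<lparr>carrier := H\<rparr>) (subtopology T H) \<sigma> \<and>
    irreducible_rep (G\<lparr>carrier := H\<rparr>) \<sigma> \<and>
    factors_through_finite_quotient (G\<lparr>carrier := H\<rparr>) \<sigma> \<and>
    irreducible_rep G (Ind G H \<sigma>) \<and>
    unitarily_equivalent G \<pi> (Ind G H \<sigma>))"

context nonarchimedean_Roelcke_rep
begin

lemma exists_commensurator_induced_subrep:
  assumes Z: "invariant_subspace G \<pi> Z" and ne: "Z \<noteq> {0}"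
  obtains U where "invariant_subspace G \<pi> U" "U \<subseteq> Z" "U \<noteq> {0}"
    "commensurator_induced G T (\<pi>\<lparr>hcarrier := U\<rparr>)"
proof -
  obtain H W where comm: "is_commensurator G T H" and WZ: "W \<subseteq> Z" and block: "imprimitivity_block G T \<pi> H W"
    and irr: "irreducible_rep (G\<lparr>carrier := H\<rparr>) (\<pi>\<lparr>hcarrier := W\<rparr>)"
    and fin: "G.almost_le H {h \<in> H. \<forall>x\<in>W. act \<pi> h x = x}"
    using exists_commensurator_block[OF Z ne] by blast
  interpret block: imprimitivity_block G T \<pi> H W by (rule block)
  have HH: "Comm G H = H" using comm by (simp add: is_commensurator_def)
  let ?\<sigma> = "\<pi>\<lparr>hcarrier := W\<rparr>" and ?E = "\<pi>\<lparr>hcarrier := block.envelope\<rparr>"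
  have irrE: "irreducible_rep G ?E"
    using HH fin irr by (rule block.irreducible_envelope)
  have E: "block.envelope \<subseteq> Z"
  proof -
    have "block.translates \<subseteq> Z"
      using Z WZ by (auto simp: block.translates_def invariant_subspace_def)
    then show ?thesis
      unfolding block.envelope_def using Z by (intro cspan_minimal) (auto simp: invariant_subspace_def)
  qed
  have inv: "act \<pi> g x \<in> block.envelope" if "g \<in> carrier G" "x \<in> block.envelope" for g x
    using block.invariant_envelope that by (auto simp: invariant_subspace_def)
  interpret E: complex_hilbert_space ?E using block.closed_envelope by (rule hilbert_space_restrict)
  have "irreducible_rep G (Ind G H ?\<sigma>)"
  proof (rule irreducible_rep_equivalent[OF E.complex_inner_space_axioms _ _ block.equivalent_Ind irrE])
    show "vector_space (hscale (Ind G H ?\<sigma>))"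
      using vector_space_axioms by (intro vector_space_Ind) simp
  qed (use inv in auto)
  then have "commensurator_induced G T ?E"
    unfolding commensurator_induced_def
    using comm unitary_rep_restrict[OF block.H block.W block.WH] irr block.factors_through_kernel[OF fin]
      block.equivalent_Ind by blast
  moreover have "block.envelope \<noteq> {0}" using irrE by (simp add: irreducible_rep_def)
  ultimately show thesis using that block.invariant_envelope E by blast
qed

text \<open>
  A maximal orthogonal family of subrepresentations of the required form has orthogonal complement 0,
  because a nonzero complement would contain another one.
\<close>

theorem sum_of_commensurator_induced:
  "\<exists>\<W>. hilbert_direct_sum \<pi> \<W> \<and>
    (\<forall>W\<in>\<W>. invariant_subspace G \<pi> W \<and> commensurator_induced G T (\<pi>\<lparr>hcarrier := W\<rparr>))"
proof -
  define \<A> where "\<A> = {\<W>. (\<forall>W\<in>\<W>. invariant_subspace G \<pi> W \<and> commensurator_induced G T (\<pi>\<lparr>hcarrier := W\<rparr>)) \<and>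
    (\<forall>W\<in>\<W>. \<forall>W'\<in>\<W>. W \<noteq> W' \<longrightarrow> (\<forall>x\<in>W. \<forall>y\<in>W'. hinner \<pi> x y = 0))}"
  have "\<exists>\<W>\<in>\<A>. \<forall>\<V>\<in>\<A>. \<W> \<subseteq> \<V> \<longrightarrow> \<V> = \<W>"
  proof (rule subset_Zorn')
    fix \<C> assume "subset.chain \<A> \<C>"
    then have C: "\<C> \<subseteq> \<A>" "\<And>P Q. \<lbrakk>P \<in> \<C>; Q \<in> \<C>\<rbrakk> \<Longrightarrow> P \<subseteq> Q \<or> Q \<subseteq> P"
      by (auto simp: subset.chain_def)
    show "\<Union>\<C> \<in> \<A>"
      unfolding \<A>_def
    proof (intro CollectI conjI ballI impI)
      fix W assume "W \<in> \<Union>\<C>"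
      then show "invariant_subspace G \<pi> W" "commensurator_induced G T (\<pi>\<lparr>hcarrier := W\<rparr>)"
        using C(1) by (auto simp: \<A>_def)
    next
      fix W W' x y assume W: "W \<in> \<Union>\<C>" "W' \<in> \<Union>\<C>" "W \<noteq> W'" "x \<in> W" "y \<in> W'"
      then obtain P P' where "P \<in> \<C>" "P' \<in> \<C>" "W \<in> P" "W' \<in> P'" by blast
      then obtain Q where "Q \<in> \<A>" "W \<in> Q" "W' \<in> Q" using C by (metis subsetD)
      then show "hinner \<pi> x y = 0" using W(3-5) unfolding \<A>_def by blast
    qed
  qed
  then obtain \<W> where W: "\<W> \<in> \<A>" and max: "\<And>\<V>. \<lbrakk>\<V> \<in> \<A>; \<W> \<subseteq> \<V>\<rbrakk> \<Longrightarrow> \<V> = \<W>" by blast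
  have closed: "closed_subspace \<pi> W" and inv: "\<And>g x. \<lbrakk>g \<in> carrier G; x \<in> W\<rbrakk> \<Longrightarrow> act \<pi> g x \<in> W" if "W \<in> \<W>" for W
    using W that by (auto simp: \<A>_def invariant_subspace_def)
  have UX: "\<Union>\<W> \<subseteq> hcarrier \<pi>" using closed closed_subspaceD(2) by blast
  define Z where "Z = {x \<in> hcarrier \<pi>. \<forall>y\<in>\<Union>\<W>. hinner \<pi> x y = 0}"
  have Zc: "closed_subspace \<pi> Z" unfolding Z_def using UX by (rule closed_subspace_orth)
  have Zinv: "invariant_subspace G \<pi> Z"
    unfolding invariant_subspace_def
  proof (intro conjI ballI Zc)
    fix g x assume g: "g \<in> carrier G" and x: "x \<in> Z"
    then have xX: "x \<in> hcarrier \<pi>" by (simp add: Z_def)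
    have "hinner \<pi> (act \<pi> g x) y = 0" if y: "y \<in> W" "W \<in> \<W>" for y W
    proof -
      have "act \<pi> (inv\<^bsub>G\<^esub> g) y \<in> \<Union>\<W>" using inv[OF y(2) _ y(1)] g y(2) by blast
      moreover have "y \<in> hcarrier \<pi>" using y UX by blast
      moreover have "hinner \<pi> x (act \<pi> (inv\<^bsub>G\<^esub> g) y) = 0" using calculation(1) x unfolding Z_def by blast
      ultimately show ?thesis using g xX by (simp add: act_inner_left)
    qed
    then show "act \<pi> g x \<in> Z" using g xX by (auto simp: Z_def act_carrier)
  qed
  have Z0: "Z = {0}"
  proof (rule ccontr)
    assume "Z \<noteq> {0}"
    then obtain U where U: "invariant_subspace G \<pi> U" "U \<subseteq> Z" "U \<noteq> {0}"
        "commensurator_induced G T (\<pi>\<lparr>hcarrier := U\<rparr>)"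
      using exists_commensurator_induced_subrep[OF Zinv] by metis
    have orth: "hinner \<pi> x y = 0" "hinner \<pi> y x = 0" if "x \<in> U" "y \<in> W" "W \<in> \<W>" for x y W
    proof -
      show 1: "hinner \<pi> x y = 0" using that U(2) by (auto simp: Z_def)
      have "x \<in> hcarrier \<pi>" "y \<in> hcarrier \<pi>" using that U(2) UX by (auto simp: Z_def)
      then show "hinner \<pi> y x = 0" using inner_commute[of y x] 1 by simp
    qed
    have "insert U \<W> \<in> \<A>"
      unfolding \<A>_def
    proof (intro CollectI conjI ballI impI)
      fix V assume "V \<in> insert U \<W>"
      then show "invariant_subspace G \<pi> V" "commensurator_induced G T (\<pi>\<lparr>hcarrier := V\<rparr>)"
        using W U(1,4) by (auto simp: \<A>_def)
    next
      fix V V' x y assume V: "V \<in> insert U \<W>" "V' \<in> insert U \<W>" "V \<noteq> V'" "x \<in> V" "y \<in> V'"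
      then consider "V = U" "V' \<in> \<W>" | "V' = U" "V \<in> \<W>" | "V \<in> \<W>" "V' \<in> \<W>" by blast
      then show "hinner \<pi> x y = 0"
      proof cases
        case 1 then show ?thesis using orth(1) V by blast
      next
        case 2 then show ?thesis using orth(2) V by blast
      next
        case 3 then show ?thesis using W V(3-5) by (auto simp: \<A>_def)
      qed
    qed
    then have "U \<in> \<W>" using max[of "insert U \<W>"] by blast
    have Uc: "closed_subspace \<pi> U" using U(1) by (simp add: invariant_subspace_def)
    have "x = 0" if "x \<in> U" for x
      using orth(1)[OF that that \<open>U \<in> \<W>\<close>] that closed_subspaceD(2)[OF Uc] by (intro eq_0_if_orth_self) auto
    then show False using U(3) subspace_0[OF closed_subspaceD(1)[OF Uc]] by blast
  qed
  have "cspan (\<Union>\<W>) = hcarrier \<pi>"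
  proof
    note cl = closed_subspace_cspan[OF UX]
    show "cspan (\<Union>\<W>) \<subseteq> hcarrier \<pi>" using closed_subspaceD(2)[OF cl] .
    show "hcarrier \<pi> \<subseteq> cspan (\<Union>\<W>)"
    proof
      fix x assume x: "x \<in> hcarrier \<pi>"
      have "x - proj (cspan (\<Union>\<W>)) x \<in> Z"
        unfolding Z_def
      proof (intro CollectI conjI ballI)
        show "x - proj (cspan (\<Union>\<W>)) x \<in> hcarrier \<pi>" using x proj_carrier[OF cl x] by (rule carrier_diff)
        fix y assume "y \<in> \<Union>\<W>"
        then have "y \<in> cspan (\<Union>\<W>)" using span_subset_cspan[OF UX] span_base by blast
        then show "hinner \<pi> (x - proj (cspan (\<Union>\<W>)) x) y = 0" by (rule proj_orth[OF cl x])
      qed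
      then have "x = proj (cspan (\<Union>\<W>)) x" using Z0 by simp
      then show "x \<in> cspan (\<Union>\<W>)" using proj_in[OF cl x] by simp
    qed
  qed
  then have "hilbert_direct_sum \<pi> \<W>"
    unfolding hilbert_direct_sum_def cspan_def using W closed by (simp add: \<A>_def)
  moreover have "\<forall>W\<in>\<W>. invariant_subspace G \<pi> W \<and> commensurator_induced G T (\<pi>\<lparr>hcarrier := W\<rparr>)"
    using W by (simp add: \<A>_def)
  ultimately show ?thesis by blast
qed

end

section \<open>Groups of permutations of a countable set\<close>

lemma perm_group_simps:
  "carrier (perm_group \<Omega> G) = G"
  "g \<in> Bij \<Omega> \<Longrightarrow> h \<in> Bij \<Omega> \<Longrightarrow> g \<otimes>\<^bsub>perm_group \<Omega> G\<^esub> h = compose \<Omega> g h"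
  "\<one>\<^bsub>perm_group \<Omega> G\<^esub> = (\<lambda>x\<in>\<Omega>. x)"
  by (simp_all add: perm_group_def BijGroup_def)

lemma perm_group_restrict: "perm_group \<Omega> H = (perm_group \<Omega> G)\<lparr>carrier := H\<rparr>"
  by (simp add: perm_group_def)

lemma perm_topology_restrict: "H \<subseteq> G \<Longrightarrow> perm_topology \<Omega> H = subtopology (perm_topology \<Omega> G) H"
  by (simp add: perm_topology_def subtopology_subtopology Int_absorb1)

definition pointwise_fixer :: "('a \<Rightarrow> 'a) set \<Rightarrow> 'a set \<Rightarrow> ('a \<Rightarrow> 'a) set"
  where "pointwise_fixer G A = {g \<in> G. \<forall>a\<in>A. g a = a}"

context
  fixes \<Omega> :: "'a set" and G :: "('a \<Rightarrow> 'a) set"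
  assumes G: "subgroup G (BijGroup \<Omega>)"
begin

abbreviation (input) "\<GG> \<equiv> perm_group \<Omega> G"
abbreviation (input) "\<TT> \<equiv> perm_topology \<Omega> G"

lemma group_perm_group: "group \<GG>"
  unfolding perm_group_def using G group_BijGroup by (rule subgroup.subgroup_is_group)

lemma G_Bij: "g \<in> G \<Longrightarrow> g \<in> Bij \<Omega>"
  using subgroup.subset[OF G] by (auto simp: BijGroup_def)

lemma G_maps: "\<lbrakk>g \<in> G; x \<in> \<Omega>\<rbrakk> \<Longrightarrow> g x \<in> \<Omega>"
  using Bij_imp_funcset[OF G_Bij] by blast

lemma G_PiE: "G \<subseteq> \<Omega> \<rightarrow>\<^sub>E \<Omega>"
proof
  fix g assume "g \<in> G"
  then show "g \<in> \<Omega> \<rightarrow>\<^sub>E \<Omega>"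
    unfolding PiE_def using Bij_imp_funcset[OF G_Bij] Bij_imp_extensional[OF G_Bij] by blast
qed

lemma mult_apply: "\<lbrakk>g \<in> G; h \<in> G; x \<in> \<Omega>\<rbrakk> \<Longrightarrow> (g \<otimes>\<^bsub>\<GG>\<^esub> h) x = g (h x)"
  by (simp add: perm_group_simps G_Bij compose_def)

lemma topspace_perm_topology: "topspace \<TT> = G"
  using G_PiE by (auto simp: perm_topology_def)

lemma inv_apply:
  assumes "g \<in> G" "x \<in> \<Omega>" shows "(inv\<^bsub>\<GG>\<^esub> g) (g x) = x"
proof -
  interpret group \<GG> by (rule group_perm_group)
  have "inv\<^bsub>\<GG>\<^esub> g \<in> G" using inv_closed[of g] assms(1) by (simp add: perm_group_simps)
  then have "(inv\<^bsub>\<GG>\<^esub> g) (g x) = (inv\<^bsub>\<GG>\<^esub> g \<otimes>\<^bsub>\<GG>\<^esub> g) x" using assms by (simp add: mult_apply)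
  also have "\<dots> = x" using l_inv[of g] assms by (simp add: perm_group_simps)
  finally show ?thesis .
qed

lemma subgroup_pointwise_fixer:
  assumes A: "A \<subseteq> \<Omega>" shows "subgroup (pointwise_fixer G A) \<GG>"
proof -
  interpret group \<GG> by (rule group_perm_group)
  show ?thesis
  proof (rule subgroupI)
    show "pointwise_fixer G A \<subseteq> carrier \<GG>" by (auto simp: pointwise_fixer_def perm_group_simps)
    have "\<one>\<^bsub>\<GG>\<^esub> \<in> pointwise_fixer G A"
      using one_closed A by (auto simp: pointwise_fixer_def perm_group_simps)
    then show "pointwise_fixer G A \<noteq> {}" by blast
    fix a assume a: "a \<in> pointwise_fixer G A"
    have aG: "a \<in> G" using a by (simp add: pointwise_fixer_def)
    have "(inv\<^bsub>\<GG>\<^esub> a) x = x" if "x \<in> A" for x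
      using inv_apply[OF aG, of x] a that A by (auto simp: pointwise_fixer_def)
    then show "inv\<^bsub>\<GG>\<^esub> a \<in> pointwise_fixer G A"
      using inv_closed[of a] aG by (simp add: pointwise_fixer_def perm_group_simps)
    fix b assume b: "b \<in> pointwise_fixer G A"
    then have bG: "b \<in> G" by (simp add: pointwise_fixer_def)
    have "(a \<otimes>\<^bsub>\<GG>\<^esub> b) x = x" if "x \<in> A" for x
      using mult_apply[OF aG bG, of x] a b that A by (auto simp: pointwise_fixer_def)
    then show "a \<otimes>\<^bsub>\<GG>\<^esub> b \<in> pointwise_fixer G A"
      using m_closed[of a b] aG bG by (simp add: pointwise_fixer_def perm_group_simps)
  qed
qed

lemma openin_pointwise_fixer:
  assumes A: "finite A" "A \<subseteq> \<Omega>" shows "openin \<TT> (pointwise_fixer G A)"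
proof -
  let ?B = "\<Pi>\<^sub>E i\<in>\<Omega>. if i \<in> A then {i} else \<Omega>"
  have "pointwise_fixer G A = ?B \<inter> G"
  proof
    show "pointwise_fixer G A \<subseteq> ?B \<inter> G"
      using G_PiE by (auto simp: pointwise_fixer_def PiE_iff)
    show "?B \<inter> G \<subseteq> pointwise_fixer G A"
      using A(2) by (force simp: pointwise_fixer_def PiE_iff)
  qed
  moreover have "openin (product_topology (\<lambda>_. discrete_topology \<Omega>) \<Omega>) ?B"
  proof (subst openin_PiE_gen, rule disjI2, intro conjI ballI)
    have "{i \<in> \<Omega>. (if i \<in> A then {i} else \<Omega>) \<noteq> topspace (discrete_topology \<Omega>)} \<subseteq> A" by auto
    then show "finite {i \<in> \<Omega>. (if i \<in> A then {i} else \<Omega>) \<noteq> topspace (discrete_topology \<Omega>)}"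
      using A(1) by (rule finite_subset)
  qed auto
  ultimately show ?thesis by (auto simp: perm_topology_def openin_subtopology)
qed

lemma pointwise_fixer_in_nhd:
  assumes U: "openin \<TT> U" "\<one>\<^bsub>\<GG>\<^esub> \<in> U"
  obtains A where "finite A" "A \<subseteq> \<Omega>" "pointwise_fixer G A \<subseteq> U"
proof -
  obtain V where V: "openin (product_topology (\<lambda>_. discrete_topology \<Omega>) \<Omega>) V" "U = V \<inter> G"
    using U(1) by (auto simp: perm_topology_def openin_subtopology)
  have "(\<lambda>x\<in>\<Omega>. x) \<in> V" using U(2) V(2) by (simp add: perm_group_simps)
  then obtain B where B: "finite {i \<in> \<Omega>. B i \<noteq> \<Omega>}" "(\<lambda>x\<in>\<Omega>. x) \<in> PiE \<Omega> B" "PiE \<Omega> B \<subseteq> V"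
    using V(1) unfolding openin_product_topology_alt by force
  have "pointwise_fixer G {i \<in> \<Omega>. B i \<noteq> \<Omega>} \<subseteq> U"
  proof
    fix g assume g: "g \<in> pointwise_fixer G {i \<in> \<Omega>. B i \<noteq> \<Omega>}"
    then have gG: "g \<in> G" by (simp add: pointwise_fixer_def)
    have "g i \<in> B i" if i: "i \<in> \<Omega>" for i
    proof (cases "B i = \<Omega>")
      case True then show ?thesis using G_maps[OF gG i] by simp
    next
      case False
      then have "g i = i" using g i by (simp add: pointwise_fixer_def)
      moreover have "(\<lambda>x\<in>\<Omega>. x) i \<in> B i" using B(2) i by (rule PiE_mem)
      ultimately show ?thesis using i by simp
    qed
    then have "g \<in> PiE \<Omega> B" using gG G_PiE by (auto simp: PiE_iff)
    then show "g \<in> U" using B(3) V(2) gG by blast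
  qed
  then show thesis using that[of "{i \<in> \<Omega>. B i \<noteq> \<Omega>}"] B(1) by auto
qed

lemma openin_translate:
  assumes g: "g \<in> G" and U: "openin \<TT> U"
  shows "openin \<TT> (g <#\<^bsub>\<GG>\<^esub> U)"
proof -
  interpret group \<GG> by (rule group_perm_group)
  let ?k = "inv\<^bsub>\<GG>\<^esub> g"
  have k: "?k \<in> G" using inv_closed[of g] g by (simp add: perm_group_simps)
  have UG: "U \<subseteq> G" using openin_subset[OF U] by (simp add: topspace_perm_topology)
  have "continuous_map \<TT> \<TT> (\<lambda>x. ?k \<otimes>\<^bsub>\<GG>\<^esub> x)"
    unfolding perm_topology_def continuous_map_in_subtopology
  proof
    let ?P = "product_topology (\<lambda>_. discrete_topology \<Omega>) \<Omega>"
    show "continuous_map (subtopology ?P G) ?P (\<lambda>x. ?k \<otimes>\<^bsub>\<GG>\<^esub> x)"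
      unfolding continuous_map_componentwise
    proof (intro conjI ballI)
      show "(\<lambda>x. ?k \<otimes>\<^bsub>\<GG>\<^esub> x) ` topspace (subtopology ?P G) \<subseteq> extensional \<Omega>"
        using k by (auto simp: perm_group_simps G_Bij compose_def)
      fix i assume i: "i \<in> \<Omega>"
      have "continuous_map (subtopology ?P G) (discrete_topology \<Omega>) (\<lambda>x. x i)"
        by (rule continuous_map_from_subtopology[OF continuous_map_product_projection[OF i]])
      moreover have "continuous_map (discrete_topology \<Omega>) (discrete_topology \<Omega>) ?k"
        using G_maps[OF k] by (auto simp: continuous_map_def)
      ultimately have "continuous_map (subtopology ?P G) (discrete_topology \<Omega>) (?k \<circ> (\<lambda>x. x i))"
        by (rule continuous_map_compose)
      then show "continuous_map (subtopology ?P G) (discrete_topology \<Omega>) (\<lambda>x. (?k \<otimes>\<^bsub>\<GG>\<^esub> x) i)"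
        by (rule continuous_map_eq) (use k i in \<open>simp add: mult_apply\<close>)
    qed
    show "(\<lambda>x. ?k \<otimes>\<^bsub>\<GG>\<^esub> x) \<in> topspace (subtopology ?P G) \<rightarrow> G"
      using k m_closed[of ?k] by (auto simp: perm_group_simps(1))
  qed
  then have "openin \<TT> {x \<in> topspace \<TT>. ?k \<otimes>\<^bsub>\<GG>\<^esub> x \<in> U}" using U by (rule openin_continuous_map_preimage)
  moreover have "g <#\<^bsub>\<GG>\<^esub> U = {x \<in> topspace \<TT>. ?k \<otimes>\<^bsub>\<GG>\<^esub> x \<in> U}"
  proof
    show "g <#\<^bsub>\<GG>\<^esub> U \<subseteq> {x \<in> topspace \<TT>. ?k \<otimes>\<^bsub>\<GG>\<^esub> x \<in> U}"
    proof
      fix x assume "x \<in> g <#\<^bsub>\<GG>\<^esub> U"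
      then obtain u where u: "u \<in> U" "x = g \<otimes>\<^bsub>\<GG>\<^esub> u" by (auto simp: l_coset_def)
      have c: "g \<in> carrier \<GG>" "u \<in> carrier \<GG>" using g u UG by (auto simp: perm_group_simps)
      have "?k \<otimes>\<^bsub>\<GG>\<^esub> x = u" unfolding u(2) using c by (simp add: m_assoc[symmetric])
      moreover have "x \<in> G" using m_closed[OF c] u(2) by (simp add: perm_group_simps(1))
      ultimately show "x \<in> {x \<in> topspace \<TT>. ?k \<otimes>\<^bsub>\<GG>\<^esub> x \<in> U}" using u(1) by (simp add: topspace_perm_topology)
    qed
    show "{x \<in> topspace \<TT>. ?k \<otimes>\<^bsub>\<GG>\<^esub> x \<in> U} \<subseteq> g <#\<^bsub>\<GG>\<^esub> U"
    proof
      fix x assume x: "x \<in> {x \<in> topspace \<TT>. ?k \<otimes>\<^bsub>\<GG>\<^esub> x \<in> U}"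
      then have c: "x \<in> carrier \<GG>" "g \<in> carrier \<GG>" using g by (auto simp: perm_group_simps topspace_perm_topology)
      have "x = g \<otimes>\<^bsub>\<GG>\<^esub> (?k \<otimes>\<^bsub>\<GG>\<^esub> x)" using c by (simp add: m_assoc[symmetric])
      then show "x \<in> g <#\<^bsub>\<GG>\<^esub> U" using x unfolding l_coset_def by blast
    qed
  qed
  ultimately show ?thesis by simp
qed

text \<open>
  An open subgroup contains the pointwise stabilizer of a finite set \<open>A\<close>, so a coset is determined by
  the restriction to \<open>A\<close> of any of its elements.
\<close>

lemma countable_cosets_perm_group:
  assumes \<Omega>: "countable \<Omega>" and V: "subgroup V \<GG>" "openin \<TT> V"
  shows "countable ((\<lambda>g. g <#\<^bsub>\<GG>\<^esub> V) ` G)"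
proof -
  interpret group \<GG> by (rule group_perm_group)
  obtain A where A: "finite A" "A \<subseteq> \<Omega>" "pointwise_fixer G A \<subseteq> V"
    using pointwise_fixer_in_nhd[OF V(2) subgroup.one_closed[OF V(1)]] .
  define c where "c r = (SOME g. g \<in> G \<and> restrict g A = r)" for r
  have c: "c (restrict g A) \<in> G" "restrict (c (restrict g A)) A = restrict g A" if "g \<in> G" for g
    using someI[of "\<lambda>h. h \<in> G \<and> restrict h A = restrict g A" g] that by (auto simp: c_def)
  have "g <#\<^bsub>\<GG>\<^esub> V = c (restrict g A) <#\<^bsub>\<GG>\<^esub> V" if g: "g \<in> G" for g
  proof -
    let ?h = "c (restrict g A)"
    note h = c[OF g]
    have C: "g \<in> carrier \<GG>" "?h \<in> carrier \<GG>" using g h(1) by (simp_all add: perm_group_simps)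
    have k: "inv\<^bsub>\<GG>\<^esub> g \<in> G" using inv_closed[OF C(1)] by (simp add: perm_group_simps)
    have "(inv\<^bsub>\<GG>\<^esub> g \<otimes>\<^bsub>\<GG>\<^esub> ?h) a = a" if a: "a \<in> A" for a
    proof -
      have "?h a = g a" using h(2) a by (metis restrict_apply')
      then show ?thesis using mult_apply[OF k h(1), of a] inv_apply[OF g, of a] a A(2) by auto
    qed
    then have "inv\<^bsub>\<GG>\<^esub> g \<otimes>\<^bsub>\<GG>\<^esub> ?h \<in> V"
      using A(3) m_closed[OF inv_closed[OF C(1)] C(2)] by (auto simp: pointwise_fixer_def perm_group_simps(1))
    moreover have "?h = g \<otimes>\<^bsub>\<GG>\<^esub> (inv\<^bsub>\<GG>\<^esub> g \<otimes>\<^bsub>\<GG>\<^esub> ?h)" using C by (simp add: m_assoc[symmetric])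
    ultimately have "?h \<in> g <#\<^bsub>\<GG>\<^esub> V" unfolding l_coset_def by blast
    then show ?thesis using C(1) V(1) by (rule l_repr_independence)
  qed
  then have "(\<lambda>g. g <#\<^bsub>\<GG>\<^esub> V) ` G \<subseteq> (\<lambda>r. c r <#\<^bsub>\<GG>\<^esub> V) ` (A \<rightarrow>\<^sub>E \<Omega>)"
    using G_maps A(2) by (force simp: image_iff intro!: bexI[of _ "restrict _ A"])
  moreover have "countable (A \<rightarrow>\<^sub>E \<Omega>)" using A(1) \<Omega> by (intro countable_PiE) auto
  ultimately show ?thesis by (meson countable_image countable_subset)
qed

end

lemma nonarchimedean_Roelcke_perm_group:
  assumes "countable \<Omega>" "subgroup G (BijGroup \<Omega>)" "Roelcke_precompact (perm_group \<Omega> G) (perm_topology \<Omega> G)"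
  shows "nonarchimedean_Roelcke_group (perm_group \<Omega> G) (perm_topology \<Omega> G)"
proof -
  interpret group "perm_group \<Omega> G" using assms(2) by (rule group_perm_group)
  show ?thesis
  proof
    fix U assume U: "openin (perm_topology \<Omega> G) U" "\<one>\<^bsub>perm_group \<Omega> G\<^esub> \<in> U"
    obtain A where A: "finite A" "A \<subseteq> \<Omega>" "pointwise_fixer G A \<subseteq> U"
      using pointwise_fixer_in_nhd[OF assms(2) U] .
    show "\<exists>V. subgroup V (perm_group \<Omega> G) \<and> openin (perm_topology \<Omega> G) V \<and> V \<subseteq> U"
      using A subgroup_pointwise_fixer[OF assms(2) A(2)] openin_pointwise_fixer[OF assms(2) A(1,2)] by blast
  qed (use assms in \<open>simp_all add: topspace_perm_topology openin_translate countable_cosets_perm_group perm_group_simps(1)\<close>)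
qed

theorem theorem4p2:
  fixes \<Omega> :: "'a set" and G :: "('a \<Rightarrow> 'a) set"
    and \<pi> :: "('a \<Rightarrow> 'a, 'v::ab_group_add) urep"
  assumes "countable \<Omega>" and "infinite \<Omega>"
    and "subgroup G (BijGroup \<Omega>)"
    and "Roelcke_precompact (perm_group \<Omega> G) (perm_topology \<Omega> G)"
    and "unitary_rep (perm_group \<Omega> G) (perm_topology \<Omega> G) \<pi>"
  shows "\<exists>\<W>. hilbert_direct_sum \<pi> \<W> \<and>
    (\<forall>W\<in>\<W>. invariant_subspace (perm_group \<Omega> G) \<pi> W \<and>
      (\<exists>H (\<sigma> :: ('a \<Rightarrow> 'a, 'v) urep).
        is_commensurator (perm_group \<Omega> G) (perm_topology \<Omega> G) H \<and>
        unitary_rep (perm_group \<Omega> H) (perm_topology \<Omega> H) \<sigma> \<and>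
        irreducible_rep (perm_group \<Omega> H) \<sigma> \<and>
        factors_through_finite_quotient (perm_group \<Omega> H) \<sigma> \<and>
        irreducible_rep (perm_group \<Omega> G) (Ind (perm_group \<Omega> G) H \<sigma>) \<and>
        unitarily_equivalent (perm_group \<Omega> G)
          (\<pi>\<lparr>hcarrier := W\<rparr>) (Ind (perm_group \<Omega> G) H \<sigma>)))"
proof -
  let ?G = "perm_group \<Omega> G" and ?T = "perm_topology \<Omega> G"
  interpret rep: nonarchimedean_Roelcke_rep ?G ?T \<pi>
    using assms(5) nonarchimedean_Roelcke_perm_group[OF assms(1,3,4)]
    by (rule nonarchimedean_Roelcke_rep.intro)
  obtain \<W> where \<W>: "hilbert_direct_sum \<pi> \<W>"
      "\<And>W. W \<in> \<W> \<Longrightarrow> invariant_subspace ?G \<pi> W \<and> commensurator_induced ?G ?T (\<pi>\<lparr>hcarrier := W\<rparr>)"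
    using rep.sum_of_commensurator_induced by blast
  have "\<exists>H (\<sigma> :: ('a \<Rightarrow> 'a, 'v) urep). is_commensurator ?G ?T H \<and>
      unitary_rep (perm_group \<Omega> H) (perm_topology \<Omega> H) \<sigma> \<and>
      irreducible_rep (perm_group \<Omega> H) \<sigma> \<and>
      factors_through_finite_quotient (perm_group \<Omega> H) \<sigma> \<and>
      irreducible_rep ?G (Ind ?G H \<sigma>) \<and>
      unitarily_equivalent ?G (\<pi>\<lparr>hcarrier := W\<rparr>) (Ind ?G H \<sigma>)" if W: "W \<in> \<W>" for W
  proof -
    obtain H and \<sigma> :: "('a \<Rightarrow> 'a, 'v) urep" where H: "is_commensurator ?G ?T H"
      and \<sigma>: "unitary_rep (?G\<lparr>carrier := H\<rparr>) (subtopology ?T H) \<sigma>"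
        "irreducible_rep (?G\<lparr>carrier := H\<rparr>) \<sigma>"
        "factors_through_finite_quotient (?G\<lparr>carrier := H\<rparr>) \<sigma>"
        "irreducible_rep ?G (Ind ?G H \<sigma>)" "unitarily_equivalent ?G (\<pi>\<lparr>hcarrier := W\<rparr>) (Ind ?G H \<sigma>)"
      using \<W>(2)[OF W] unfolding commensurator_induced_def by blast
    have "H \<subseteq> G"
      using H subgroup.subset[of H ?G] by (simp add: is_commensurator_def perm_group_simps(1))
    note \<sigma>' = \<sigma>[folded perm_group_restrict[of \<Omega> H G] perm_topology_restrict[OF \<open>H \<subseteq> G\<close>, of \<Omega>]]
    show ?thesis
      by (intro exI[of _ H] exI[of _ \<sigma>] conjI H \<sigma>')
  qed
  then show ?thesis using \<W> by blast
qed

end
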